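(* Let $(\mathcal M,d)$ be a projective-metric space of hyperbolic type. The set of the centers of $(\mathcal M,d)$ contains a non-empty open set if and only if $(\mathcal M,d)$ is the hyperbolic geometry.
   Context: A projective-metric space of hyperbolic type of dimension $n\in\mathbb N$ is a metric space $(\mathcal M,d)$, where $\mathcal M$ is a proper open convex subset of $\mathbb R^n$, such that $d$ is complete, continuous with respect to the standard topology, the geodesic lines of $d$ are exactly the non-empty intersections of $\mathcal M$ with the straight lines, and the geodesic lines of $d$ are isometric with a Euclidean straight line. A metric point reflection at $O\in\mathcal M$ is a non-identical involutive $d$-isometry of $\mathcal M$ onto $\mathcal M$ that fixes $O$ and maps every geodesic line passing through $O$ onto itself. A point $O\in\mathcal M$ is a center of $(\mathcal M,d)$ if there exists a metric point reflection at $O$. For collinear points, the affine ratio $(A,B;C)$ is defined by $(A,B;C)\overrightarrow{BC}=\overrightarrow{AC}$, and the affine cross ratio is $(A,B;C,D)=(A,B;C)/(A,B;D)$. The hyperbolic geometry is the Hilbert geometry $(\mathcal I,d_{\mathcal I})$ given in an open (solid) ellipsoid $\mathcal I\subset\mathbb R^n$, where the Hilbert metric is $d_{\mathcal I}(A,B)=0$ if $A=B$, and $d_{\mathcal I}(A,B)=\frac12|\ln(A,B;C,D)|$ if $A\ne B$, with $C,D$ the endpoints of the open segment in which the line $AB$ meets $\mathcal I$.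
   Formalization: "Is the hyperbolic geometry" is taken to mean: isometric, up to a positive constant factor, to the Hilbert geometry of an open ellipsoid; literally the claim fails, e.g. for twice the Hilbert metric of an ellipsoid, or the model inside a paraboloid. *)

theory Defs
  imports "HOL-Analysis.Analysis"
begin

text \<open>Geodesic lines in the sense of Busemann: images of locally isometric maps from the real line.
  That they are globally isometric to the line is a separate axiom of projective-metric spaces of
  hyperbolic type.\<close>

definition geodesic_line :: "'a set \<Rightarrow> ('a \<Rightarrow> 'a \<Rightarrow> real) \<Rightarrow> 'a set \<Rightarrow> bool" where
  "geodesic_line M d L \<longleftrightarrow>
     (\<exists>\<gamma> :: real \<Rightarrow> 'a. range \<gamma> = L \<and> range \<gamma> \<subseteq> M \<and>
        (\<forall>t. \<exists>e>0. \<forall>r\<in>{t - e<..<t + e}. \<forall>s\<in>{t - e<..<t + e}. d (\<gamma> r) (\<gamma> s) = \<bar>r - s\<bar>))"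

definition isometric_to_real_line :: "('a \<Rightarrow> 'a \<Rightarrow> real) \<Rightarrow> 'a set \<Rightarrow> bool" where
  "isometric_to_real_line d L \<longleftrightarrow>
     (\<exists>f :: real \<Rightarrow> 'a. bij_betw f UNIV L \<and> (\<forall>r s. d (f r) (f s) = \<bar>r - s\<bar>))"

definition straight_line :: "'a::euclidean_space set \<Rightarrow> bool" where
  "straight_line L \<longleftrightarrow> affine L \<and> aff_dim L = 1"

text \<open>The locale \<^locale>\<open>Metric_space\<close> also asks \<^term>\<open>d\<close> to be nonnegative and symmetric outside
  \<^term>\<open>M\<close>. Only the values of \<^term>\<open>d\<close> on \<^term>\<open>M\<close> matter below, so this is no restriction.\<close>

definition projective_metric_hyperbolic_type ::
    "'a::euclidean_space set \<Rightarrow> ('a \<Rightarrow> 'a \<Rightarrow> real) \<Rightarrow> bool" where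
  "projective_metric_hyperbolic_type M d \<longleftrightarrow>
     open M \<and> convex M \<and> M \<noteq> UNIV \<and>
     Metric_space M d \<and> Metric_space.mcomplete M d \<and>
     continuous_on (M \<times> M) (\<lambda>(x, y). d x y) \<and>
     {L. geodesic_line M d L} = {M \<inter> L |L. straight_line L \<and> M \<inter> L \<noteq> {}} \<and>
     (\<forall>L. geodesic_line M d L \<longrightarrow> isometric_to_real_line d L)"

definition metric_point_reflection ::
    "'a set \<Rightarrow> ('a \<Rightarrow> 'a \<Rightarrow> real) \<Rightarrow> 'a \<Rightarrow> ('a \<Rightarrow> 'a) \<Rightarrow> bool" where
  "metric_point_reflection M d p \<phi> \<longleftrightarrow>
     \<phi> ` M = M \<and> (\<forall>x\<in>M. \<forall>y\<in>M. d (\<phi> x) (\<phi> y) = d x y) \<and>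
     (\<exists>x\<in>M. \<phi> x \<noteq> x) \<and> (\<forall>x\<in>M. \<phi> (\<phi> x) = x) \<and>
     \<phi> p = p \<and> (\<forall>L. geodesic_line M d L \<and> p \<in> L \<longrightarrow> \<phi> ` L = L)"

definition centers :: "'a set \<Rightarrow> ('a \<Rightarrow> 'a \<Rightarrow> real) \<Rightarrow> 'a set" where
  "centers M d = {p \<in> M. \<exists>\<phi>. metric_point_reflection M d p \<phi>}"

definition affine_ratio :: "'a::real_vector \<Rightarrow> 'a \<Rightarrow> 'a \<Rightarrow> real" where
  "affine_ratio A B C = (THE r. r *\<^sub>R (C - B) = C - A)"

definition cross_ratio :: "'a::real_vector \<Rightarrow> 'a \<Rightarrow> 'a \<Rightarrow> 'a \<Rightarrow> real" where
  "cross_ratio A B C D = affine_ratio A B C / affine_ratio A B D"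

text \<open>The endpoints \<^term>\<open>C\<close> and \<^term>\<open>D\<close> are determined only up to order; exchanging them inverts
  the cross ratio and leaves the value unchanged.\<close>

definition hilbert_dist :: "'a::euclidean_space set \<Rightarrow> 'a \<Rightarrow> 'a \<Rightarrow> real" where
  "hilbert_dist I A B =
     (if A = B then 0
      else (THE r. \<exists>C D. open_segment C D = I \<inter> affine hull {A, B} \<and>
                         r = 1/2 * \<bar>ln (cross_ratio A B C D)\<bar>))"

definition open_ellipsoid :: "'a::euclidean_space set \<Rightarrow> bool" where
  "open_ellipsoid I \<longleftrightarrow> (\<exists>a T. linear T \<and> bij T \<and> I = (\<lambda>x. a + T x) ` ball (0 :: 'a) 1)"

text \<open>Being the hyperbolic geometry is understood up to isometry and up to the unit of length (that
  is, the curvature \<open>- 1 / c\<^sup>2\<close>). Literal equality with a Hilbert metric on an ellipsoid is not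
  intended: it would exclude \<open>2 * hilbert_dist I\<close>, and also the projective images of the ellipsoid
  model in the interior of a paraboloid, although all their points are centers.
  Since isometries preserve geodesic lines, the map \<open>f\<close> below takes chords of \<open>M\<close> to chords
  of \<open>I\<close> whenever the geodesic lines of \<open>M\<close> are its chords.\<close>

definition is_hyperbolic_geometry :: "'a::euclidean_space set \<Rightarrow> ('a \<Rightarrow> 'a \<Rightarrow> real) \<Rightarrow> bool" where
  "is_hyperbolic_geometry M d \<longleftrightarrow>
     (\<exists>I c f. open_ellipsoid (I :: 'a set) \<and> c > 0 \<and> bij_betw f M I \<and>
        (\<forall>x\<in>M. \<forall>y\<in>M. d x y = c * hilbert_dist I (f x) (f y)))"

end

theory Submission
  imports Defs
begin

text \<open>
  A point reflection at \<open>p\<close> preserves the chords through \<open>p\<close>, so it has the form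
  \<open>x \<mapsto> p - (x - p) / \<mu> p x\<close> with \<open>\<mu> p > 0\<close>; since it maps segments to segments, \<open>\<mu> p\<close> is
  affine, i.e. the reflection is a harmonic homology. Reflecting centers in centers along chords
  makes every point of \<open>M\<close> a center. The linear lifts of the reflections are involutions, hence have
  determinant \<open>\<plusminus>1\<close>; as isometries fixing a point have bounded iterates, products of three
  lifts fixing a ray fix it pointwise. This gives a density \<open>f\<close> with \<open>f (s q x) = \<mu> q x * f x\<close>, and
  \<open>H p q = f q * (1 + \<mu> p q) / (2 * f p)\<close> is a symmetric invariant kernel satisfying
  \<open>H (s p q) r + H q r = 2 * H p q * H p r\<close>, so \<open>H = cosh (c * d)\<close> on each chord, with \<open>c\<close> depending on
  the chord. By symmetry \<open>H p q / (f p * f q)\<close> is biaffine, i.e. comes from a symmetric bilinear form in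
  homogeneous coordinates. Its signature is Lorentzian: a null direction would yield isometries
  fixing a point and moving another one arbitrarily far, or else \<open>M = UNIV\<close>. So \<open>H\<close> is the kernel
  \<open>cosh\<close> of the Hilbert distance in a ball, and comparing asymptotic chords shows that \<open>c\<close> is the same
  for all chords. In dimension one both sides hold whenever \<open>M\<close> is non-empty. Conversely, the ball model
  has reflections at all points.
\<close>

section \<open>The Hilbert metric of an ellipsoid\<close>

text \<open>Nothing is given of \<open>d\<close> but a continuous metric with straight geodesics: no
  differentiable structure and no inner product, so the form must come from the reflections
  themselves. The guide is the hyperboloid, where the reflection at \<open>P\<close> is
  \<open>X \<mapsto> 2 <X, P> P - X\<close> and the coefficient of \<open>P\<close> is the product
  sought. Reading it off requires one lift for every point, scaled so that the reflections permute
  the lifts. The density \<open>f\<close> is this scaling; that it is well defined is a statement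
  about closed loops, hence the interest in products of three reflections with a fixed point.
  Reflections in midpoints act transitively, so whatever is known about distances from one base
  point \<open>b\<close> holds for all pairs. The kernel alone does not determine \<open>d\<close>:
  on each chord \<open>d\<close> is proportional to the hyperbolic distance, but the unit could vary
  with the direction, as in a Finsler metric. It cannot, since points approaching a common ideal
  endpoint along two chords can be paired at bounded distance, and the chord joining two boundary
  points of the ball links the radii to these points.\<close>

definition hyp :: "'a::real_inner \<Rightarrow> 'a \<Rightarrow> real" where
  "hyp x y = (1 - x \<bullet> y) / sqrt ((1 - x \<bullet> x) * (1 - y \<bullet> y))"

lemma affine_ratio_line:
  assumes "v \<noteq> 0" "t \<noteq> (1::real)"
  shows "affine_ratio A (A + v) (A + t *\<^sub>R v) = t / (t - 1)"
proof -
  have "r *\<^sub>R (A + t *\<^sub>R v - (A + v)) = A + t *\<^sub>R v - A \<longleftrightarrow> r = t / (t - 1)" for r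
  proof -
    have "r *\<^sub>R (A + t *\<^sub>R v - (A + v)) = (r * (t - 1)) *\<^sub>R v"
      by (simp add: algebra_simps)
    then have "r *\<^sub>R (A + t *\<^sub>R v - (A + v)) = A + t *\<^sub>R v - A \<longleftrightarrow> r * (t - 1) = t"
      using assms by simp
    also have "\<dots> \<longleftrightarrow> r = t / (t - 1)" using assms by (auto simp: field_simps)
    finally show ?thesis .
  qed
  then show ?thesis unfolding affine_ratio_def by simp
qed

lemma open_segment_line:
  fixes A v :: "'a::euclidean_space"
  assumes "v \<noteq> 0" "t1 < t2"
  shows "open_segment (A + t1 *\<^sub>R v) (A + t2 *\<^sub>R v) = {A + t *\<^sub>R v | t. t1 < t \<and> t < t2}"
proof -
  have inj: "inj (\<lambda>t::real. A + t *\<^sub>R v)" using assms by (auto simp: inj_on_def)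
  have "{A + t *\<^sub>R v | t. t1 < t \<and> t < t2} = (\<lambda>t. A + t *\<^sub>R v) ` open_segment t1 t2"
    using assms by (auto simp: open_segment_eq_real_ivl)
  also have "(\<lambda>t. A + t *\<^sub>R v) ` open_segment t1 t2 = (+) A ` ((\<lambda>t. t *\<^sub>R v) ` open_segment t1 t2)"
    by (simp add: image_image)
  also have "(\<lambda>t. t *\<^sub>R v) ` open_segment t1 t2 = open_segment (t1 *\<^sub>R v) (t2 *\<^sub>R v)"
    by (rule open_segment_linear_image[symmetric]) (use assms in \<open>auto simp: inj_on_def intro: linear_scale_left\<close>)
  also have "(+) A ` open_segment (t1 *\<^sub>R v) (t2 *\<^sub>R v) = open_segment (A + t1 *\<^sub>R v) (A + t2 *\<^sub>R v)"
    by (rule open_segment_translation[symmetric])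
  finally show ?thesis by simp
qed

text \<open>The description in \<open>hilbert_dist\<close> is definite: an open segment determines
  its endpoints up to order, and the order changes only the sign of the logarithm. Here
  \<open>t1\<close> and \<open>t2\<close> are the parameters of the endpoints when \<open>A\<close>
  has parameter 0 and \<open>B\<close> parameter 1.\<close>

lemma hilbert_dist_chord:
  fixes A B :: "'a::euclidean_space"
  assumes "A \<noteq> B" "t1 < 0" "1 < t2"
    and chord: "I \<inter> affine hull {A, B} = {A + t *\<^sub>R (B - A) | t. t1 < t \<and> t < t2}"
  shows "hilbert_dist I A B = 1/2 * \<bar>ln (t1 * (t2 - 1) / (t2 * (t1 - 1)))\<bar>"
proof -
  define v where "v = B - A"
  have v: "v \<noteq> 0" "B = A + v" using assms by (auto simp: v_def)
  define C0 D0 where "C0 = A + t1 *\<^sub>R v" and "D0 = A + t2 *\<^sub>R v"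
  define R where "R = t1 * (t2 - 1) / (t2 * (t1 - 1))"
  have seg: "I \<inter> affine hull {A, B} = open_segment C0 D0"
    unfolding chord C0_def D0_def v_def[symmetric]
    using open_segment_line[OF v(1), of t1 t2 A] assms by simp
  have CD: "C0 \<noteq> D0" using assms v by (auto simp: C0_def D0_def)
  have r1: "cross_ratio A B C0 D0 = R"
    unfolding cross_ratio_def C0_def D0_def v(2) R_def using v assms
    by (simp add: affine_ratio_line)
  have r2: "cross_ratio A B D0 C0 = inverse R"
    unfolding cross_ratio_def C0_def D0_def v(2) R_def using v assms
    by (simp add: affine_ratio_line field_simps)
  have Rpos: "R > 0"
    unfolding R_def using assms
    by (intro divide_neg_neg mult_neg_pos mult_pos_neg) auto
  have "(\<exists>C D. open_segment C D = I \<inter> affine hull {A, B} \<and>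
      r = 1/2 * \<bar>ln (cross_ratio A B C D)\<bar>) \<longleftrightarrow> r = 1/2 * \<bar>ln R\<bar>" for r
  proof
    assume "\<exists>C D. open_segment C D = I \<inter> affine hull {A, B} \<and> r = 1/2 * \<bar>ln (cross_ratio A B C D)\<bar>"
    then obtain C D where *: "open_segment C D = open_segment C0 D0"
        "r = 1/2 * \<bar>ln (cross_ratio A B C D)\<bar>" using seg by auto
    then have "{C, D} = {C0, D0}" using CD by (simp add: open_segment_eq)
    then have "C = C0 \<and> D = D0 \<or> C = D0 \<and> D = C0" by (auto simp: doubleton_eq_iff)
    then show "r = 1/2 * \<bar>ln R\<bar>" using * r1 r2 Rpos by (auto simp: ln_inverse)
  next
    assume "r = 1/2 * \<bar>ln R\<bar>"
    then show "\<exists>C D. open_segment C D = I \<inter> affine hull {A, B} \<and> r = 1/2 * \<bar>ln (cross_ratio A B C D)\<bar>"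
      using seg r1 by (intro exI[of _ C0] exI[of _ D0]) auto
  qed
  then have "(THE r. \<exists>C D. open_segment C D = I \<inter> affine hull {A, B} \<and>
      r = 1/2 * \<bar>ln (cross_ratio A B C D)\<bar>) = 1/2 * \<bar>ln R\<bar>" by (simp only: the_eq_trivial)
  then show ?thesis unfolding hilbert_dist_def R_def[symmetric] using assms(1) by (simp only: if_False)
qed

lemma cosh_half_ln:
  fixes R :: real
  assumes "R > 0"
  shows "cosh (1/2 * \<bar>ln R\<bar>) = (R + 1) / (2 * sqrt R)"
proof -
  have "cosh (1/2 * \<bar>ln R\<bar>) = cosh (ln (sqrt R))"
    using assms by (simp add: ln_sqrt abs_if)
  also have "\<dots> = (sqrt R + inverse (sqrt R)) / 2" using assms by (simp add: cosh_ln_real)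
  also have "\<dots> = (R + 1) / (2 * sqrt R)" using assms by (simp add: field_simps)
  finally show ?thesis .
qed

text \<open>\<open>hyp\<close> is the Lorentz product of \<open>(1, x)\<close> and
  \<open>(1, y)\<close>, both scaled onto the hyperboloid. An affine map keeps parameters on lines,
  so the computation takes place on a chord of the unit ball; there \<open>cosh\<close> of half the
  logarithm is symmetric in numerator and denominator of the cross ratio, and Vieta's formulas
  suffice.\<close>

lemma hilbert_dist_nonneg_cosh:
  fixes T :: "'a::euclidean_space \<Rightarrow> 'a" and a :: 'a
  assumes T: "linear T" "inj T" and x: "norm x < 1" and y: "norm y < 1"
  defines "I \<equiv> (\<lambda>x. a + T x) ` ball 0 1"
  shows "hilbert_dist I (a + T x) (a + T y) \<ge> 0"
    "cosh (hilbert_dist I (a + T x) (a + T y)) = hyp x y"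
proof -
  have xx: "x \<bullet> x < 1" "y \<bullet> y < 1"
    using x y by (simp_all add: norm_lt_square[of 1, simplified] power2_norm_eq_inner[symmetric] abs_square_less_1)
  have "hilbert_dist I (a + T x) (a + T y) \<ge> 0 \<and> cosh (hilbert_dist I (a + T x) (a + T y)) = hyp x y"
  proof (cases "x = y")
    case True
    then show ?thesis using xx by (simp add: hilbert_dist_def hyp_def)
  next
    case False
    define v where "v = y - x"
    have v: "v \<noteq> 0" "y = x + v" using False by (auto simp: v_def)
    define A B where "A = a + T x" and "B = a + T y"
    have AB: "A \<noteq> B" using False T by (auto simp: A_def B_def inj_on_def)
    define \<alpha> \<beta> e where "\<alpha> = v \<bullet> v" and "\<beta> = x \<bullet> v" and "e = 1 - x \<bullet> x"
    have pos: "\<alpha> > 0" "e > 0" using v xx by (auto simp: \<alpha>_def e_def)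
    define D where "D = sqrt (\<beta>\<^sup>2 + \<alpha> * e)"
    have D2: "D\<^sup>2 = \<beta>\<^sup>2 + \<alpha> * e" unfolding D_def using pos by simp
    have D0: "D > \<bar>\<beta>\<bar>"
      unfolding D_def using pos by (intro real_less_rsqrt) simp
    \<comment> \<open>The parameters at which the line through \<open>x\<close> and \<open>y\<close>
      meets the unit sphere, as roots of the quadratic with coefficients \<open>\<alpha>\<close>,
      \<open>2 * \<beta>\<close> and \<open>- e\<close>.\<close>
    define t1 t2 where "t1 = (- \<beta> - D) / \<alpha>" and "t2 = (- \<beta> + D) / \<alpha>"
    have quad: "\<alpha> * (t - t1) * (t - t2) = \<alpha> * t\<^sup>2 + 2 * \<beta> * t - e" for t
    proof -
      have "\<alpha> * (\<alpha> * (t - t1) * (t - t2)) = (\<alpha> * t + \<beta> + D) * (\<alpha> * t + \<beta> - D)"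
        using pos unfolding t1_def t2_def by (simp add: field_simps)
      also have "\<dots> = \<alpha> * (\<alpha> * t\<^sup>2 + 2 * \<beta> * t - e)"
        using D2 by (simp add: algebra_simps power2_eq_square)
      finally show ?thesis using pos by simp
    qed
    have norm: "(x + t *\<^sub>R v) \<bullet> (x + t *\<^sub>R v) - 1 = \<alpha> * t\<^sup>2 + 2 * \<beta> * t - e" for t
      unfolding \<alpha>_def \<beta>_def e_def by (simp add: inner_add inner_commute algebra_simps power2_eq_square)
    have t1: "t1 < 0" unfolding t1_def using D0 pos by (simp add: divide_neg_pos)
    have t20: "t2 > 0" unfolding t2_def using D0 pos by simp
    have "\<alpha> * (1 - t1) * (1 - t2) < 0"
      unfolding quad norm[symmetric] using xx v by simp
    then have t2: "1 < t2" using pos t1 by (simp add: mult_less_0_iff not_less[symmetric])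
    have t12: "t1 < t2" using t1 t2 by simp
    have in_iff: "norm (x + t *\<^sub>R v) < 1 \<longleftrightarrow> t1 < t \<and> t < t2" for t
    proof -
      have "norm (x + t *\<^sub>R v) < 1 \<longleftrightarrow> (x + t *\<^sub>R v) \<bullet> (x + t *\<^sub>R v) < 1"
        by (metis norm_eq_sqrt_inner real_sqrt_lt_1_iff)
      also have "\<dots> \<longleftrightarrow> \<alpha> * (t - t1) * (t - t2) < 0" using norm[of t] quad[of t] by auto
      also have "\<dots> \<longleftrightarrow> t1 < t \<and> t < t2" using pos t12 by (auto simp: mult_less_0_iff zero_less_mult_iff)
      finally show ?thesis .
    qed
    have line: "A + t *\<^sub>R (B - A) = a + T (x + t *\<^sub>R v)" for t
      unfolding A_def B_def v(2) using T(1) by (simp add: linear_add linear_cmul)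
    have "I \<inter> affine hull {A, B} = {A + t *\<^sub>R (B - A) | t. t1 < t \<and> t < t2}"
    proof -
      have "affine hull {A, B} = {A + t *\<^sub>R (B - A) | t. True}"
        unfolding affine_hull_2_alt by auto
      moreover have "A + t *\<^sub>R (B - A) \<in> I \<longleftrightarrow> t1 < t \<and> t < t2" for t
      proof -
        have "A + t *\<^sub>R (B - A) \<in> I \<longleftrightarrow> (\<exists>z. norm z < 1 \<and> a + T (x + t *\<^sub>R v) = a + T z)"
          unfolding line I_def by (auto simp: image_iff Bex_def)
        also have "\<dots> \<longleftrightarrow> norm (x + t *\<^sub>R v) < 1"
          using T(2) by (auto dest: injD)
        finally show ?thesis using in_iff by simp
      qed
      ultimately show ?thesis by auto
    qed
    then have h: "hilbert_dist I A B = 1/2 * \<bar>ln (t1 * (t2 - 1) / (t2 * (t1 - 1)))\<bar>"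
      using hilbert_dist_chord[OF AB t1 t2] by blast
    \<comment> \<open>Numerator and denominator of the cross ratio, both made positive; only
      \<open>P + N\<close> and \<open>P * N\<close> will be needed.\<close>
    define P N where "P = (- t1) * (t2 - 1)" and "N = t2 * (1 - t1)"
    have PN: "P > 0" "N > 0" using t1 t2 unfolding P_def N_def by (intro mult_pos_pos; simp)+
    have R: "t1 * (t2 - 1) / (t2 * (t1 - 1)) = P / N"
      unfolding P_def N_def using t1 t2 by (simp add: field_simps)
    have "cosh (1/2 * \<bar>ln (P / N)\<bar>) = (P / N + 1) / (2 * sqrt (P / N))"
      using cosh_half_ln PN by simp
    also have "\<dots> = (P + N) / (2 * sqrt (P * N))"
    proof -
      have "sqrt (P / N) * N = sqrt (P * N)"
        using PN by (simp add: real_sqrt_divide real_sqrt_mult field_simps)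
      then show ?thesis using PN by (simp add: divide_simps) (simp add: algebra_simps)
    qed
    also have "\<dots> = (e - \<beta>) / sqrt (e * (1 - y \<bullet> y))"
    proof -
      have s: "t1 + t2 = - 2 * \<beta> / \<alpha>" unfolding t1_def t2_def using pos by (simp add: field_simps)
      have p: "t1 * t2 = - e / \<alpha>" using quad[of 0] pos by (simp add: field_simps)
      have 1: "P + N = 2 * (e - \<beta>) / \<alpha>"
      proof -
        have "P + N = (t1 + t2) - 2 * (t1 * t2)" unfolding P_def N_def by (simp add: algebra_simps)
        then show ?thesis unfolding s p using pos by (simp add: field_simps)
      qed
      have 2: "P * N = e * (1 - y \<bullet> y) / \<alpha>\<^sup>2"
      proof -
        have "P * N = - (t1 * t2) * (- ((1 - t1) * (1 - t2)))"
          unfolding P_def N_def by (simp add: algebra_simps)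
        also have "(1 - t1) * (1 - t2) = (\<alpha> + 2 * \<beta> - e) / \<alpha>"
          using quad[of 1] pos by (simp add: field_simps)
        also have "\<alpha> + 2 * \<beta> - e = y \<bullet> y - 1" using norm[of 1] v by simp
        finally show ?thesis unfolding p using pos by (simp add: power2_eq_square divide_simps) (simp add: algebra_simps)
      qed
      show ?thesis unfolding 1 2 using pos by (simp add: real_sqrt_divide del: right_diff_distrib_numeral)
    qed
    also have "\<dots> = hyp x y"
      unfolding hyp_def e_def \<beta>_def v_def by (simp add: algebra_simps)
    finally have "cosh (1/2 * \<bar>ln (P / N)\<bar>) = hyp x y" .
    moreover have "hilbert_dist I (a + T x) (a + T y) = 1/2 * \<bar>ln (P / N)\<bar>"
      using h unfolding R A_def B_def .
    ultimately show ?thesis by (simp only:) simp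
  qed
  then show "hilbert_dist I (a + T x) (a + T y) \<ge> 0"
    "cosh (hilbert_dist I (a + T x) (a + T y)) = hyp x y" by auto
qed

section \<open>Chords and isometries\<close>

lemma open_scaled_in:
  fixes S :: "'a::real_normed_vector set"
  assumes "open S" "p \<in> S"
  shows "\<exists>t>0. \<forall>r. \<bar>r\<bar> \<le> t \<longrightarrow> p + r *\<^sub>R v \<in> S"
proof -
  obtain e where e: "e > 0" "cball p e \<subseteq> S" using assms open_contains_cball by blast
  define t where "t = e / (norm v + 1)"
  have t: "t > 0" "t * norm v \<le> e" unfolding t_def using e by (simp_all add: add_nonneg_pos divide_simps)
  have "p + r *\<^sub>R v \<in> S" if "\<bar>r\<bar> \<le> t" for r
  proof -
    have "\<bar>r\<bar> * norm v \<le> t * norm v" using that by (intro mult_right_mono) auto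
    then show ?thesis using t e(2) by (auto simp: dist_norm subset_eq)
  qed
  then show ?thesis using t by blast
qed

locale projective_metric =
  fixes M :: "'a::euclidean_space set" and d :: "'a \<Rightarrow> 'a \<Rightarrow> real"
  assumes hyperbolic_type: "projective_metric_hyperbolic_type M d"
begin

lemma open_M: "open M" and convex_M: "convex M" and M_ne_UNIV: "M \<noteq> UNIV"
  and cont_d: "continuous_on (M \<times> M) (\<lambda>(x, y). d x y)"
  and geodesic_lines: "{L. geodesic_line M d L} = {M \<inter> L |L. straight_line L \<and> M \<inter> L \<noteq> {}}"
  and geodesic_isometric: "geodesic_line M d L \<Longrightarrow> isometric_to_real_line d L"
  using hyperbolic_type unfolding projective_metric_hyperbolic_type_def by auto

sublocale Metric_space M d
  using hyperbolic_type unfolding projective_metric_hyperbolic_type_def by auto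

lemma geodesic_line_chord:
  assumes "p \<in> M" "v \<noteq> 0"
  shows "geodesic_line M d (M \<inter> range (\<lambda>u. p + u *\<^sub>R v))"
proof -
  have "affine hull {p, p + v} = range (\<lambda>u. p + u *\<^sub>R v)"
    unfolding affine_hull_2_alt by simp
  moreover have "straight_line (affine hull {p, p + v})"
    unfolding straight_line_def using assms by (simp add: aff_dim_2)
  moreover have "p \<in> range (\<lambda>u. p + u *\<^sub>R v)" by (rule image_eqI[of _ _ 0]) auto
  ultimately have "M \<inter> range (\<lambda>u. p + u *\<^sub>R v) \<in> {M \<inter> L |L. straight_line L \<and> M \<inter> L \<noteq> {}}"
    using assms by (intro CollectI exI[of _ "range (\<lambda>u. p + u *\<^sub>R v)"]) auto
  then show ?thesis unfolding geodesic_lines[symmetric] by simp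
qed

lemma geodesic_line_eq_chord:
  assumes "geodesic_line M d L" "p \<in> L" "q \<in> L" "p \<noteq> q"
  shows "p \<in> M" "L = M \<inter> range (\<lambda>u. p + u *\<^sub>R (q - p))"
proof -
  have "L \<in> {L. geodesic_line M d L}" using assms(1) by simp
  then obtain L' where L': "L = M \<inter> L'" "straight_line L'"
    unfolding geodesic_lines by blast
  then show "p \<in> M" using assms by auto
  have "affine hull {p, q} = L'"
  proof (rule affine_dim_equal)
    show "affine L'" "aff_dim (affine hull {p, q}) = aff_dim L'"
      using L' assms unfolding straight_line_def by (auto simp: aff_dim_2)
    show "affine hull {p, q} \<subseteq> L'"
      using L' assms unfolding straight_line_def by (intro hull_minimal) auto
  qed auto
  then show "L = M \<inter> range (\<lambda>u. p + u *\<^sub>R (q - p))"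
    unfolding L' affine_hull_2_alt by simp
qed

text \<open>An isometry of the line onto the chord, read in the affine parameter, is a continuous
  injection on an interval and hence monotone; a shift and possibly a reversal make it increasing
  with value 0 at 0. From here on, order and distance along a chord are read off the same
  parameter.\<close>

lemma chord_param:
  assumes p: "p \<in> M" and v: "v \<noteq> 0"
  shows "\<exists>\<sigma> :: real \<Rightarrow> real. strict_mono \<sigma> \<and> continuous_on UNIV \<sigma> \<and> \<sigma> 0 = 0 \<and>
    range \<sigma> = {u. p + u *\<^sub>R v \<in> M} \<and> (\<forall>r s. d (p + \<sigma> r *\<^sub>R v) (p + \<sigma> s *\<^sub>R v) = \<bar>r - s\<bar>)"
proof -
  define J where "J = {u. p + u *\<^sub>R v \<in> M}"
  define L where "L = M \<inter> range (\<lambda>u. p + u *\<^sub>R v)"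
  have "isometric_to_real_line d L"
    using geodesic_isometric geodesic_line_chord[OF assms] L_def by simp
  then obtain F where F: "bij_betw F UNIV L" "\<And>r s :: real. d (F r) (F s) = \<bar>r - s\<bar>"
    unfolding isometric_to_real_line_def by blast
  \<comment> \<open>Arc length as a function of the affine parameter; \<open>\<sigma>\<close> will
    be its inverse with orientation and origin corrected.\<close>
  define \<tau> where "\<tau> u = inv_into UNIV F (p + u *\<^sub>R v)" for u
  have F\<tau>: "F (\<tau> u) = p + u *\<^sub>R v" if "u \<in> J" for u
    unfolding \<tau>_def using that F(1) by (intro f_inv_into_f) (auto simp: bij_betw_def J_def L_def)
  have \<tau>d: "\<bar>\<tau> u - \<tau> w\<bar> = d (p + u *\<^sub>R v) (p + w *\<^sub>R v)" if "u \<in> J" "w \<in> J" for u w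
    using that F\<tau> F(2) by metis
  have \<tau>surj: "\<tau> ` J = UNIV"
  proof -
    have "t \<in> \<tau> ` J" for t
    proof -
      have "F t \<in> L" using F(1) by (auto simp: bij_betw_def)
      then obtain u where u: "F t = p + u *\<^sub>R v" "u \<in> J" unfolding L_def J_def by (metis (no_types, lifting) IntE imageE mem_Collect_eq)
      then have "F (\<tau> u) = F t" using F\<tau> by simp
      then have "\<tau> u = t" using F(1) by (auto simp: bij_betw_def dest: injD)
      then show ?thesis using u by blast
    qed
    then show ?thesis by blast
  qed
  have inj: "inj_on \<tau> J"
  proof (rule inj_onI)
    fix u w assume "u \<in> J" "w \<in> J" "\<tau> u = \<tau> w"
    then have "p + u *\<^sub>R v = p + w *\<^sub>R v" using F\<tau> by metis
    then show "u = w" using v by simp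
  qed
  have J: "J = (\<lambda>u. p + u *\<^sub>R v) -` M" unfolding J_def by auto
  have openJ: "open J" unfolding J
    by (intro continuous_open_vimage continuous_intros open_M) 
  have intJ: "is_interval J"
  proof -
    have "convex J" unfolding J_def convex_alt
    proof clarsimp
      fix x y u :: real
      assume *: "p + x *\<^sub>R v \<in> M" "p + y *\<^sub>R v \<in> M" "0 \<le> u" "u \<le> 1"
      have "(1 - u) *\<^sub>R (p + x *\<^sub>R v) + u *\<^sub>R (p + y *\<^sub>R v) \<in> M"
        using * convex_M unfolding convex_alt by blast
      then show "p + ((1 - u) * x + u * y) *\<^sub>R v \<in> M" by (simp add: algebra_simps)
    qed
    then show ?thesis by (simp add: is_interval_convex_1)
  qed
  have cont: "continuous_on J \<tau>"
  proof (rule continuous_onI)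
    fix x and e :: real assume x: "x \<in> J" "e > 0"
    have "continuous_on J (\<lambda>u. (\<lambda>(x, y). d x y) (p + u *\<^sub>R v, p + x *\<^sub>R v))"
      by (rule continuous_on_compose2[OF cont_d])
        (use x in \<open>auto intro!: continuous_intros simp: J_def\<close>)
    then have "\<exists>\<delta>>0. \<forall>y\<in>J. dist y x < \<delta> \<longrightarrow>
        dist (d (p + y *\<^sub>R v) (p + x *\<^sub>R v)) (d (p + x *\<^sub>R v) (p + x *\<^sub>R v)) < e"
      using x unfolding continuous_on_iff by simp
    then obtain \<delta> where \<delta>: "\<delta> > 0" "\<And>y. y \<in> J \<Longrightarrow> dist y x < \<delta> \<Longrightarrow>
        dist (d (p + y *\<^sub>R v) (p + x *\<^sub>R v)) (d (p + x *\<^sub>R v) (p + x *\<^sub>R v)) < e"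
      by blast
    have "dist (\<tau> y) (\<tau> x) \<le> e" if "y \<in> J" "dist y x < \<delta>" for y
    proof -
      have "d (p + x *\<^sub>R v) (p + x *\<^sub>R v) = 0" using x J_def by auto
      then show ?thesis using \<delta>(2)[OF that] \<tau>d[OF that(1) x(1)] by (simp add: dist_real_def)
    qed
    then show "\<exists>d>0. \<forall>x'\<in>J. dist x' x < d \<longrightarrow> dist (\<tau> x') (\<tau> x) \<le> e" using \<delta>(1) by blast
  qed
  have "strict_mono_on J \<tau> \<or> strict_antimono_on J \<tau>"
    using injective_eq_monotone_map[OF intJ cont] inj by simp
  then obtain e :: real where e: "e = 1 \<or> e = -1"
    and mono: "\<And>u w. u \<in> J \<Longrightarrow> w \<in> J \<Longrightarrow> u < w \<Longrightarrow> e * \<tau> u < e * \<tau> w"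
  proof
    assume "strict_mono_on J \<tau>"
    then show ?thesis by (intro that[of 1]) (auto simp: monotone_on_def)
  next
    assume "strict_antimono_on J \<tau>"
    then show ?thesis by (intro that[of "-1"]) (auto simp: monotone_on_def)
  qed
  define \<sigma> where "\<sigma> t = inv_into J \<tau> (e * t + \<tau> 0)" for t
  have \<sigma>J: "\<sigma> t \<in> J" for t unfolding \<sigma>_def by (rule inv_into_into) (simp add: \<tau>surj)
  have \<tau>\<sigma>: "\<tau> (\<sigma> t) = e * t + \<tau> 0" for t unfolding \<sigma>_def by (rule f_inv_into_f) (simp add: \<tau>surj)
  have 0: "0 \<in> J" using p J_def by simp
  have mono\<sigma>: "strict_mono \<sigma>"
  proof (rule strict_monoI)
    fix r s :: real assume "r < s"
    then have "e * \<tau> (\<sigma> r) < e * \<tau> (\<sigma> s)" using e by (auto simp: \<tau>\<sigma>)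
    then show "\<sigma> r < \<sigma> s" using mono[OF \<sigma>J \<sigma>J, of s r] by (metis linorder_neqE_linordered_idom order_less_asym)
  qed
  have range: "range \<sigma> = J"
  proof -
    have "u \<in> range \<sigma>" if "u \<in> J" for u
    proof -
      have "\<tau> (\<sigma> (e * (\<tau> u - \<tau> 0))) = \<tau> u" unfolding \<tau>\<sigma> using e by auto
      then have "\<sigma> (e * (\<tau> u - \<tau> 0)) = u" using inj \<sigma>J that by (auto dest: inj_onD)
      then show ?thesis by (metis rangeI)
    qed
    then show ?thesis using \<sigma>J by blast
  qed
  have "\<tau> (\<sigma> 0) = \<tau> 0" by (simp add: \<tau>\<sigma>)
  then have "\<sigma> 0 = 0" using inj \<sigma>J 0 by (auto dest: inj_onD)
  moreover have "continuous_on UNIV \<sigma>"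
    by (rule continuous_onI_mono) (use range openJ mono\<sigma> in \<open>auto simp: strict_mono_less_eq\<close>)
  moreover have "d (p + \<sigma> r *\<^sub>R v) (p + \<sigma> s *\<^sub>R v) = \<bar>r - s\<bar>" for r s
  proof -
    have "\<bar>\<tau> (\<sigma> r) - \<tau> (\<sigma> s)\<bar> = \<bar>r - s\<bar>" unfolding \<tau>\<sigma> using e by (elim disjE) auto
    then show ?thesis using \<tau>d[OF \<sigma>J \<sigma>J, of r s] by simp
  qed
  ultimately show ?thesis using mono\<sigma> range unfolding J_def by blast
qed

text \<open>The increasing arc-length parameter reduces this to betweenness of reals. Betweenness on
  a chord is thereby a matter of \<open>d\<close> alone, which is what lets isometries preserve
  segments.\<close>

lemma between_iff:
  assumes "x \<in> M" "y \<in> M" "x \<noteq> y" "x + w *\<^sub>R (y - x) \<in> M"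
  shows "0 \<le> w \<and> w \<le> 1 \<longleftrightarrow> d x (x + w *\<^sub>R (y - x)) + d (x + w *\<^sub>R (y - x)) y = d x y"
proof -
  obtain \<sigma> where \<sigma>: "strict_mono \<sigma>" "\<sigma> 0 = 0"
    "range \<sigma> = {u. x + u *\<^sub>R (y - x) \<in> M}"
    "\<And>r s. d (x + \<sigma> r *\<^sub>R (y - x)) (x + \<sigma> s *\<^sub>R (y - x)) = \<bar>r - s\<bar>"
    using chord_param[of x "y - x"] assms by auto
  have "w \<in> range \<sigma>" "1 \<in> range \<sigma>" using \<sigma>(3) assms by auto
  then obtain a b where ab: "\<sigma> a = w" "\<sigma> b = 1" by fastforce
  have "0 < b" using ab \<sigma>(1,2) strict_mono_less[of \<sigma> 0 b] by simp
  have "0 \<le> w \<and> w \<le> 1 \<longleftrightarrow> 0 \<le> a \<and> a \<le> b"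
    using strict_mono_less_eq[OF \<sigma>(1)] ab \<sigma>(2) by metis
  also have "\<dots> \<longleftrightarrow> \<bar>0 - a\<bar> + \<bar>a - b\<bar> = \<bar>0 - b\<bar>" using \<open>0 < b\<close> by auto
  finally show ?thesis using \<sigma>(4)[of 0 a] \<sigma>(4)[of a b] \<sigma>(4)[of 0 b] ab \<sigma>(2) by simp
qed

lemma same_ray_eq:
  assumes "p \<in> M" "p + u *\<^sub>R v \<in> M" "p + w *\<^sub>R v \<in> M" "v \<noteq> 0" "u * w > 0"
    "d p (p + u *\<^sub>R v) = d p (p + w *\<^sub>R v)"
  shows "u = w"
proof -
  obtain \<sigma> where \<sigma>: "strict_mono \<sigma>" "\<sigma> 0 = 0" "range \<sigma> = {u. p + u *\<^sub>R v \<in> M}"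
    "\<And>r s. d (p + \<sigma> r *\<^sub>R v) (p + \<sigma> s *\<^sub>R v) = \<bar>r - s\<bar>"
    using chord_param[of p v] assms by auto
  have "w \<in> range \<sigma>" "u \<in> range \<sigma>" using \<sigma>(3) assms by auto
  then obtain a b where ab: "\<sigma> a = w" "\<sigma> b = u" by fastforce
  have "\<bar>a\<bar> = \<bar>b\<bar>" using \<sigma>(4)[of 0 a] \<sigma>(4)[of 0 b] ab \<sigma>(2) assms by simp
  moreover have "a < 0 \<longleftrightarrow> b < 0"
    using ab \<sigma>(2) strict_mono_less[OF \<sigma>(1), of a 0] strict_mono_less[OF \<sigma>(1), of b 0] assms(5)
    by (auto simp: zero_less_mult_iff)
  ultimately have "a = b" by (auto simp: abs_if split: if_splits)
  then show ?thesis using ab by simp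
qed

lemma isometry_geodesic_line:
  assumes "\<phi> ` M = M" "\<And>x y. x \<in> M \<Longrightarrow> y \<in> M \<Longrightarrow> d (\<phi> x) (\<phi> y) = d x y" "geodesic_line M d L"
  shows "geodesic_line M d (\<phi> ` L)"
proof -
  obtain \<gamma> :: "real \<Rightarrow> 'a" where \<gamma>: "range \<gamma> = L" "range \<gamma> \<subseteq> M"
    "\<And>t. \<exists>e>0. \<forall>r\<in>{t - e<..<t + e}. \<forall>s\<in>{t - e<..<t + e}. d (\<gamma> r) (\<gamma> s) = \<bar>r - s\<bar>"
    using assms(3) unfolding geodesic_line_def by blast
  have "d (\<phi> (\<gamma> r)) (\<phi> (\<gamma> s)) = d (\<gamma> r) (\<gamma> s)" for r s using \<gamma>(2) assms(2) by blast
  moreover have "range (\<phi> \<circ> \<gamma>) \<subseteq> M" using \<gamma>(2) assms(1) by (auto simp: image_comp[symmetric])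
  ultimately show ?thesis unfolding geodesic_line_def using \<gamma>(1,3)
    by (intro exI[of _ "\<phi> \<circ> \<gamma>"]) (auto simp: image_comp[symmetric])
qed

text \<open>The image of a chord is a geodesic line, hence again a chord, and equality in the
  triangle inequality keeps the image point between the image endpoints.\<close>

lemma isometry_segment:
  assumes \<phi>: "\<phi> ` M = M" "\<And>x y. x \<in> M \<Longrightarrow> y \<in> M \<Longrightarrow> d (\<phi> x) (\<phi> y) = d x y"
    and x: "x \<in> M" "y \<in> M" "z \<in> closed_segment x y"
  shows "\<phi> z \<in> closed_segment (\<phi> x) (\<phi> y)"
proof (cases "x = y")
  case True then show ?thesis using x by simp
next
  case False
  obtain w where w: "z = x + w *\<^sub>R (y - x)" "0 \<le> w" "w \<le> 1"
    using x(3) unfolding in_segment by (auto simp: algebra_simps)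
  have z: "z \<in> M" using x convex_M by (meson convex_contains_segment subsetD)
  have \<phi>M: "\<phi> x \<in> M" "\<phi> y \<in> M" "\<phi> z \<in> M" using \<phi>(1) x z by auto
  have neq: "\<phi> x \<noteq> \<phi> y" using \<phi>(2)[of x y] x False \<phi>M by (metis zero)
  define L where "L = M \<inter> range (\<lambda>u. x + u *\<^sub>R (y - x))"
  have "geodesic_line M d (\<phi> ` L)"
    unfolding L_def by (intro isometry_geodesic_line \<phi> geodesic_line_chord) (use x False in auto)
  moreover have "x \<in> L" unfolding L_def using x by (auto intro: image_eqI[of _ _ 0])
  moreover have "y \<in> L" unfolding L_def using x by (auto intro: image_eqI[of _ _ 1])
  moreover have "z \<in> L" unfolding L_def using z w by auto
  ultimately have "\<phi> z \<in> range (\<lambda>u. \<phi> x + u *\<^sub>R (\<phi> y - \<phi> x))"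
    using geodesic_line_eq_chord(2)[of "\<phi> ` L" "\<phi> x" "\<phi> y"] neq by blast
  then obtain t where t: "\<phi> z = \<phi> x + t *\<^sub>R (\<phi> y - \<phi> x)" by blast
  have "d x z + d z y = d x y" using between_iff[of x y w] x z w False by auto
  then have "d (\<phi> x) (\<phi> z) + d (\<phi> z) (\<phi> y) = d (\<phi> x) (\<phi> y)" using \<phi>(2) x z by simp
  then have "0 \<le> t \<and> t \<le> 1" using between_iff[of "\<phi> x" "\<phi> y" t] \<phi>M neq t by simp
  then show ?thesis unfolding in_segment t by (intro exI[of _ t]) (auto simp: algebra_simps)
qed

lemma exists_midpoint:
  assumes "p \<in> M" "q \<in> M" "p \<noteq> q"
  shows "\<exists>w\<in>{0<..<1}. p + w *\<^sub>R (q - p) \<in> M \<and>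
     d p (p + w *\<^sub>R (q - p)) = d p q / 2 \<and> d (p + w *\<^sub>R (q - p)) q = d p q / 2"
proof -
  obtain \<sigma> where \<sigma>: "strict_mono \<sigma>" "\<sigma> 0 = 0"
    "range \<sigma> = {u. p + u *\<^sub>R (q - p) \<in> M}"
    "\<And>r s. d (p + \<sigma> r *\<^sub>R (q - p)) (p + \<sigma> s *\<^sub>R (q - p)) = \<bar>r - s\<bar>"
    using chord_param[of p "q - p"] assms by auto
  have "1 \<in> range \<sigma>" using \<sigma>(3) assms by auto
  then obtain b where b: "\<sigma> b = 1" by fastforce
  have bp: "0 < b" using b \<sigma>(1,2) strict_mono_less[of \<sigma> 0 b] by simp
  have "\<sigma> (b / 2) \<in> {0<..<1}"
    using b bp \<sigma>(2) strict_mono_less[OF \<sigma>(1), of 0 "b/2"] strict_mono_less[OF \<sigma>(1), of "b/2" b] by simp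
  moreover have "\<sigma> (b / 2) \<in> range \<sigma>" by simp
  ultimately show ?thesis
    using \<sigma>(3) \<sigma>(4)[of 0 "b/2"] \<sigma>(4)[of "b/2" b] \<sigma>(4)[of 0 b] b bp \<sigma>(2)
    by (intro bexI[of _ "\<sigma> (b / 2)"]) auto
qed

text \<open>\<open>d p\<close> has a positive minimum on a small Euclidean sphere about
  \<open>p\<close> and grows along rays from \<open>p\<close>, so no point beyond the sphere is
  closer than this minimum. The bound matters because \<open>M\<close> may be unbounded.\<close>

lemma small_ball_bounded:
  assumes p: "p \<in> M"
  obtains \<delta> R where "\<delta> > 0" "\<And>x. x \<in> M \<Longrightarrow> d p x < \<delta> \<Longrightarrow> norm (x - p) \<le> R"
proof -
  obtain r where r: "r > 0" "cball p r \<subseteq> M" using open_M p open_contains_cball by blast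
  have "continuous_on (sphere p r) (\<lambda>x. (\<lambda>(x, y). d x y) (p, x))"
    by (rule continuous_on_compose2[OF cont_d]) (use p r in \<open>auto intro!: continuous_intros\<close>)
  then have cont: "continuous_on (sphere p r) (d p)" by simp
  have "sphere p r \<noteq> {}" using r by simp
  then obtain y0 where y0: "y0 \<in> sphere p r" "\<And>y. y \<in> sphere p r \<Longrightarrow> d p y0 \<le> d p y"
    using continuous_attains_inf[OF compact_sphere _ cont] by blast
  have y0M: "y0 \<in> M" "y0 \<noteq> p" using y0 r by auto
  then have "d p y0 > 0" using mdist_pos_eq p by blast
  moreover have "norm (x - p) \<le> r" if x: "x \<in> M" "d p x < d p y0" for x
  proof (rule ccontr)
    assume "\<not> norm (x - p) \<le> r"
    then have n: "norm (x - p) > r" by simp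
    then have "x \<noteq> p" using r by auto
    define w where "w = r / norm (x - p)"
    have w: "0 < w" "w < 1" using n r by (auto simp: w_def divide_simps)
    have "p + w *\<^sub>R (x - p) \<in> sphere p r" using n r \<open>x \<noteq> p\<close> by (simp add: dist_norm w_def)
    then have "d p y0 \<le> d p (p + w *\<^sub>R (x - p))" "p + w *\<^sub>R (x - p) \<in> M" using y0 r by auto
    moreover have "d p (p + w *\<^sub>R (x - p)) \<le> d p x"
      using between_iff[of p x w] w p x calculation(2) n r
      by (smt (verit) nonneg norm_eq_zero right_minus_eq)
    ultimately show False using x by simp
  qed
  ultimately show ?thesis using that by blast
qed

end

section \<open>Point reflections are harmonic homologies\<close>

lemma metric_point_reflectionD:
  assumes "metric_point_reflection M d p \<phi>"
  shows "\<phi> ` M = M" "x \<in> M \<Longrightarrow> y \<in> M \<Longrightarrow> d (\<phi> x) (\<phi> y) = d x y" "\<exists>x\<in>M. \<phi> x \<noteq> x"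
    "x \<in> M \<Longrightarrow> \<phi> (\<phi> x) = x" "\<phi> p = p" "geodesic_line M d L \<Longrightarrow> p \<in> L \<Longrightarrow> \<phi> ` L = L"
proof -
  note D = assms[unfolded metric_point_reflection_def]
  note D2 = D[THEN conjunct2] note D3 = D2[THEN conjunct2] note D4 = D3[THEN conjunct2]
  note D5 = D4[THEN conjunct2]
  show "\<phi> ` M = M" by (rule D[THEN conjunct1])
  show "x \<in> M \<Longrightarrow> y \<in> M \<Longrightarrow> d (\<phi> x) (\<phi> y) = d x y" using D2[THEN conjunct1] by simp
  show "\<exists>x\<in>M. \<phi> x \<noteq> x" by (rule D3[THEN conjunct1])
  show "x \<in> M \<Longrightarrow> \<phi> (\<phi> x) = x" using D4[THEN conjunct1] by simp
  show "\<phi> p = p" by (rule D5[THEN conjunct1])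
  show "geodesic_line M d L \<Longrightarrow> p \<in> L \<Longrightarrow> \<phi> ` L = L" using D5[THEN conjunct2] by simp
qed

context projective_metric
begin

text \<open>The chord through \<open>p\<close> and \<open>x\<close> is mapped to itself with the
  distance from \<open>p\<close> kept, and a ray contains only one point at a given distance; hence
  \<open>x\<close> is either fixed or moved to the other side of \<open>p\<close>.\<close>

lemma reflection_on_chord:
  assumes \<phi>: "metric_point_reflection M d p \<phi>" and p: "p \<in> M" and x: "x \<in> M" "x \<noteq> p"
  shows "\<exists>u. \<phi> x = p + u *\<^sub>R (x - p) \<and> (u = 1 \<or> u < 0)" "d p (\<phi> x) = d p x"
proof -
  note iso = metric_point_reflectionD(2)[OF \<phi>] and fix_p = metric_point_reflectionD(5)[OF \<phi>]
    and lines = metric_point_reflectionD(6)[OF \<phi>]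
  show dist: "d p (\<phi> x) = d p x" using iso[OF p x(1)] fix_p by simp
  define L where "L = M \<inter> range (\<lambda>u. p + u *\<^sub>R (x - p))"
  have pL: "p \<in> L" unfolding L_def using p by (auto intro: image_eqI[of _ _ 0])
  have xL: "x \<in> L" unfolding L_def using x by (auto intro: image_eqI[of _ _ 1])
  have "geodesic_line M d L" unfolding L_def using p x by (intro geodesic_line_chord) simp_all
  then have "\<phi> ` L = L" using pL by (rule lines)
  then have "\<phi> x \<in> L" using xL by (metis imageI)
  then have \<phi>x: "\<phi> x \<in> M" "\<phi> x \<in> range (\<lambda>u. p + u *\<^sub>R (x - p))" unfolding L_def by blast+
  from \<phi>x(2) obtain u where u: "\<phi> x = p + u *\<^sub>R (x - p)" by (rule rangeE)
  have "u \<noteq> 0"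
  proof
    assume "u = 0"
    then have "d p x = 0" using dist u p by simp
    then show False using p x by simp
  qed
  moreover have "u = 1" if "u > 0"
    using same_ray_eq[of p u "x - p" 1] that p x u \<phi>x dist by simp
  ultimately show "\<exists>u. \<phi> x = p + u *\<^sub>R (x - p) \<and> (u = 1 \<or> u < 0)" using u
    by (intro exI[of _ u]) linarith
qed

end

text \<open>Independence of the pair rather than of the set \<open>{a, b}\<close>, so that
  \<open>a = b\<close> counts as dependent.\<close>

definition indep2 :: "'a::real_vector \<Rightarrow> 'a \<Rightarrow> bool" where
  "indep2 a b \<longleftrightarrow> (\<forall>s t. s *\<^sub>R a + t *\<^sub>R b = 0 \<longrightarrow> s = 0 \<and> t = 0)"

lemma indep2D:
  assumes "indep2 a b" "s *\<^sub>R a + t *\<^sub>R b = s' *\<^sub>R a + t' *\<^sub>R b"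
  shows "s = s' \<and> t = t'"
proof -
  have "(s - s') *\<^sub>R a + (t - t') *\<^sub>R b = 0" using assms(2) by (simp add: algebra_simps)
  then have "s - s' = 0 \<and> t - t' = 0" using assms(1) unfolding indep2_def by blast
  then show ?thesis by simp
qed

lemma indep2_comb:
  assumes "indep2 a b" "p * s \<noteq> q * (r::real)"
  shows "indep2 (p *\<^sub>R a + q *\<^sub>R b) (r *\<^sub>R a + s *\<^sub>R b)"
  unfolding indep2_def
proof (intro allI impI)
  fix x y :: real assume "x *\<^sub>R (p *\<^sub>R a + q *\<^sub>R b) + y *\<^sub>R (r *\<^sub>R a + s *\<^sub>R b) = 0"
  then have "(x * p + y * r) *\<^sub>R a + (x * q + y * s) *\<^sub>R b = 0" by (simp add: algebra_simps)
  then have *: "x * p + y * r = 0" "x * q + y * s = 0" using assms(1) unfolding indep2_def by blast+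
  have "x * (p * s - q * r) = (x * p + y * r) * s - (x * q + y * s) * r" by (simp add: algebra_simps)
  then have x: "x = 0" using * assms(2) by simp
  have "y * (p * s - q * r) = (x * q + y * s) * p - (x * p + y * r) * q" by (simp add: algebra_simps)
  then have "y * (p * s - q * r) = 0" unfolding * by simp
  then show "x = 0 \<and> y = 0" using x assms(2) by simp
qed

lemma not_indep2:
  assumes "\<not> indep2 a b" "a \<noteq> 0"
  shows "\<exists>t. b = t *\<^sub>R a"
proof -
  obtain s t where st: "s *\<^sub>R a + t *\<^sub>R b = 0" "s \<noteq> 0 \<or> t \<noteq> 0" using assms unfolding indep2_def by blast
  then have "t \<noteq> 0" using assms(2) by auto
  have "t *\<^sub>R b = (- s) *\<^sub>R a" using st by (simp add: algebra_simps add_eq_0_iff2)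
  then have "(1/t) *\<^sub>R (t *\<^sub>R b) = (1/t) *\<^sub>R ((- s) *\<^sub>R a)" by simp
  then have "b = (- s / t) *\<^sub>R a" using \<open>t \<noteq> 0\<close> by simp
  then show ?thesis by blast
qed

lemma exists_indep2:
  fixes a :: "'a::euclidean_space"
  assumes "DIM('a) \<ge> 2" "a \<noteq> 0"
  shows "\<exists>b. indep2 a b"
proof (rule ccontr)
  assume "\<nexists>b. indep2 a b"
  then have "\<forall>b. \<exists>t. b = t *\<^sub>R a" using not_indep2 assms(2) by blast
  then have "UNIV \<subseteq> span {a}" by (auto simp: span_singleton)
  then have "DIM('a) \<le> card {a}" by (intro span_card_ge_dim[THEN order_trans[rotated]]) (auto simp: dim_UNIV)
  then show False using assms(1) by simp
qed

text \<open>Collinear triples \<open>x, w, y\<close> are handled by moving \<open>y\<close> off their line to \<open>y + r b\<close> and \<open>y + 2 r b\<close> and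
  extrapolating back to \<open>y\<close>.\<close>

lemma affine_off_rays_imp_affine:
  fixes S :: "'a::euclidean_space set" and g :: "'a \<Rightarrow> real"
  assumes dim: "DIM('a) \<ge> 2" and S: "open S" "convex S"
    and aff: "\<And>x y t. x \<in> S \<Longrightarrow> y \<in> S \<Longrightarrow> indep2 x y \<Longrightarrow> 0 \<le> t \<Longrightarrow> t \<le> 1 \<Longrightarrow>
        g ((1 - t) *\<^sub>R x + t *\<^sub>R y) = (1 - t) * g x + t * g y"
    and x: "x \<in> S" "x \<noteq> 0" and y: "y \<in> S" "y \<noteq> 0" and t: "0 \<le> t" "t \<le> 1"
    and nz: "(1 - t) *\<^sub>R x + t *\<^sub>R y \<noteq> 0"
  shows "g ((1 - t) *\<^sub>R x + t *\<^sub>R y) = (1 - t) * g x + t * g y"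
proof (cases "indep2 x y \<or> t = 0")
  case True then show ?thesis using aff x y t by auto
next
  case False
  then obtain k where k: "y = k *\<^sub>R x" using not_indep2 x by blast
  define w where "w = (1 - t) *\<^sub>R x + t *\<^sub>R y"
  have w: "w = (1 - t + t * k) *\<^sub>R x" unfolding w_def k by (simp add: algebra_simps)
  have k0: "k \<noteq> 0" "1 - t + t * k \<noteq> 0" using y k nz w w_def by auto
  obtain b where b: "indep2 x b" using exists_indep2 dim x by blast
  obtain r where r: "r > 0" "\<And>s. \<bar>s\<bar> \<le> r \<Longrightarrow> y + s *\<^sub>R b \<in> S" using open_scaled_in[OF S(1) y(1)] by blast
  have inS: "(1 - t) *\<^sub>R u + t *\<^sub>R v \<in> S" if "u \<in> S" "v \<in> S" for u v
    using that S(2) t unfolding convex_alt by blast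
  have shift: "g (w + (t * s) *\<^sub>R b) = (1 - t) * g x + t * g (y + s *\<^sub>R b)" if s: "0 < s" "s \<le> r" for s
  proof -
    have "indep2 x (y + s *\<^sub>R b)" using indep2_comb[OF b, of 1 s 0 k] s unfolding k by simp
    then have "g ((1 - t) *\<^sub>R x + t *\<^sub>R (y + s *\<^sub>R b)) = (1 - t) * g x + t * g (y + s *\<^sub>R b)"
      using aff x(1) r(2) s t by simp
    then show ?thesis unfolding w_def by (simp add: scaleR_add_right add.assoc)
  qed
  have extrapolate: "g z = 2 * g (z + s *\<^sub>R b) - g (z + (2 * s) *\<^sub>R b)"
    if "z \<in> S" "z + (2 * s) *\<^sub>R b \<in> S" "z = l *\<^sub>R x" "l \<noteq> 0" "s > 0" for z l s
  proof -
    have "indep2 z (z + (2 * s) *\<^sub>R b)"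
      using indep2_comb[OF b, of l "2 * s" 0 l] that(4,5) unfolding that(3) by simp
    then have "g ((1 - 1/2) *\<^sub>R z + (1/2) *\<^sub>R (z + (2 * s) *\<^sub>R b)) = (1 - 1/2) * g z + 1/2 * g (z + (2 * s) *\<^sub>R b)"
      using that by (intro aff) auto
    moreover have "(1 - 1/2) *\<^sub>R z + (1/2) *\<^sub>R (z + (2 * s) *\<^sub>R b) = z + s *\<^sub>R b"
      using scaleR_half_double[of z] by (simp add: scaleR_add_right add.assoc[symmetric] scaleR_2)
    ultimately show ?thesis by simp
  qed
  have "w + (2 * (t * (r / 2))) *\<^sub>R b = (1 - t) *\<^sub>R x + t *\<^sub>R (y + r *\<^sub>R b)"
    unfolding w_def by (simp add: scaleR_add_right add.assoc)
  then have "g w = 2 * g (w + (t * (r / 2)) *\<^sub>R b) - g (w + (2 * (t * (r / 2))) *\<^sub>R b)"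
    using inS[OF x(1) y(1)] inS[OF x(1) r(2)[of r]] w k0 t r(1) False
    by (intro extrapolate[of _ _ "1 - t + t * k"]) (auto simp: w_def[symmetric])
  also have "w + (2 * (t * (r / 2))) *\<^sub>R b = w + (t * r) *\<^sub>R b" by simp
  also have "2 * g (w + (t * (r / 2)) *\<^sub>R b) - g (w + (t * r) *\<^sub>R b)
      = (1 - t) * g x + t * (2 * g (y + (r / 2) *\<^sub>R b) - g (y + (2 * (r / 2)) *\<^sub>R b))"
    using shift[of "r / 2"] shift[of r] r(1) by (simp add: algebra_simps)
  also have "2 * g (y + (r / 2) *\<^sub>R b) - g (y + (2 * (r / 2)) *\<^sub>R b) = g y"
    using y(1) k k0 r by (intro extrapolate[symmetric, of _ _ k]) auto
  finally show ?thesis unfolding w_def .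
qed

text \<open>The linear part is a difference quotient at \<open>p\<close> whose step
  \<open>T v\<close> depends on the direction. Affinity on segments from \<open>p\<close> makes the
  quotient independent of the step, and affinity at a midpoint makes it additive in the
  direction.\<close>

lemma affine_function_linear:
  fixes S :: "'a::euclidean_space set" and g :: "'a \<Rightarrow> real"
  assumes S: "open S" "convex S" "p \<in> S"
    and aff: "\<And>x y t. x \<in> S \<Longrightarrow> y \<in> S \<Longrightarrow> 0 \<le> t \<Longrightarrow> t \<le> 1 \<Longrightarrow>
        g ((1 - t) *\<^sub>R x + t *\<^sub>R y) = (1 - t) * g x + t * g y"
  shows "\<exists>K. linear K \<and> (\<forall>x\<in>S. g x = g p + K (x - p))"
proof -
  obtain T where T: "\<And>v. T v > 0" and TS: "\<And>s v. \<bar>s\<bar> \<le> T v \<Longrightarrow> p + s *\<^sub>R v \<in> S"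
    using open_scaled_in[OF S(1,3)] by metis
  define K where "K v = (g (p + T v *\<^sub>R v) - g p) / T v" for v
  have scale: "g (p + (c * s) *\<^sub>R v) - g p = c * (g (p + s *\<^sub>R v) - g p)"
    if "p + s *\<^sub>R v \<in> S" "0 \<le> c" "c \<le> 1" for c s v
  proof -
    have "g ((1 - c) *\<^sub>R p + c *\<^sub>R (p + s *\<^sub>R v)) = (1 - c) * g p + c * g (p + s *\<^sub>R v)"
      using aff S that by blast
    moreover have "(1 - c) *\<^sub>R p + c *\<^sub>R (p + s *\<^sub>R v) = p + (c * s) *\<^sub>R v" by (simp add: algebra_simps)
    ultimately show ?thesis by (simp add: algebra_simps)
  qed
  have Kpos: "g (p + s *\<^sub>R v) - g p = s * K v" if s: "p + s *\<^sub>R v \<in> S" "s > 0" for s v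
  proof -
    have "(g (p + s *\<^sub>R v) - g p) / s = (g (p + r *\<^sub>R v) - g p) / r"
      if "p + s *\<^sub>R v \<in> S" "p + r *\<^sub>R v \<in> S" "0 < s" "s \<le> r" for r s
      using scale[of r v "s / r"] that by (simp add: field_simps)
    then have "(g (p + s *\<^sub>R v) - g p) / s = (g (p + T v *\<^sub>R v) - g p) / T v"
      using s T[of v] TS[of "T v" v] by (smt (verit, best))
    then show ?thesis unfolding K_def using s by (simp add: field_simps)
  qed
  have Khom: "K (c *\<^sub>R v) = c * K v" if "c > 0" for c v
  proof -
    have e: "p + T (c *\<^sub>R v) *\<^sub>R (c *\<^sub>R v) = p + (T (c *\<^sub>R v) * c) *\<^sub>R v" by simp
    have "p + (T (c *\<^sub>R v) * c) *\<^sub>R v \<in> S" using TS[of "T (c *\<^sub>R v)" "c *\<^sub>R v"] T[of "c *\<^sub>R v"] by simp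
    then have "g (p + (T (c *\<^sub>R v) * c) *\<^sub>R v) - g p = T (c *\<^sub>R v) * c * K v"
      using Kpos T[of "c *\<^sub>R v"] that by simp
    then show ?thesis unfolding K_def[of "c *\<^sub>R v"] using T[of "c *\<^sub>R v"] by (simp add: field_simps)
  qed
  have Kadd: "K (v + w) = K v + K w" for v w
  proof -
    \<comment> \<open>One step length that keeps \<open>p + s v\<close>, \<open>p + s w\<close> and
      their midpoint in \<open>S\<close>, although \<open>T\<close> varies with the
      direction.\<close>
    define s where "s = min (T v) (min (T w) (T (v + w)))"
    have s: "s > 0" "p + s *\<^sub>R v \<in> S" "p + s *\<^sub>R w \<in> S" "p + (s/2) *\<^sub>R (v + w) \<in> S"
      unfolding s_def using T[of v] T[of w] T[of "v + w"] by (auto intro!: TS)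
    have m: "(1 - 1/2) *\<^sub>R (p + s *\<^sub>R v) + (1/2) *\<^sub>R (p + s *\<^sub>R w) = p + (s/2) *\<^sub>R (v + w)"
    proof -
      have "(1/2) *\<^sub>R p + (1/2) *\<^sub>R p = p" by (simp add: scaleR_add_left[symmetric])
      then show ?thesis by (simp add: scaleR_add_right add.assoc add.left_commute)
    qed
    have "g ((1 - 1/2) *\<^sub>R (p + s *\<^sub>R v) + (1/2) *\<^sub>R (p + s *\<^sub>R w))
        = (1 - 1/2) * g (p + s *\<^sub>R v) + (1/2) * g (p + s *\<^sub>R w)"
      by (rule aff) (use s in auto)
    then have "g (p + (s/2) *\<^sub>R (v + w)) = g (p + s *\<^sub>R v) / 2 + g (p + s *\<^sub>R w) / 2"
      unfolding m by simp
    moreover have "g (p + (s/2) *\<^sub>R (v + w)) - g p = s/2 * K (v + w)" using Kpos s by simp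
    moreover have "g (p + s *\<^sub>R v) - g p = s * K v" "g (p + s *\<^sub>R w) - g p = s * K w" using Kpos s by auto
    ultimately have "s/2 * K (v + w) = s/2 * (K v + K w)" by argo
    then show ?thesis using s by simp
  qed
  have K0: "K 0 = 0" unfolding K_def by simp
  have Kneg: "K (- v) = - K v" for v using Kadd[of v "- v"] K0 by simp
  have "linear K"
  proof (rule linearI)
    fix c v show "K (c *\<^sub>R v) = c *\<^sub>R K v"
      using Khom[of c v] Khom[of "- c" v] Kneg[of "c *\<^sub>R v"] K0
      by (cases c "0::real" rule: linorder_cases) auto
  qed (rule Kadd)
  moreover have "g x = g p + K (x - p)" if "x \<in> S" for x using Kpos[of 1 "x - p"] that by simp
  ultimately show ?thesis by blast
qed

section \<open>Reversal of all chords and the affine denominator of a reflection\<close>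

context projective_metric
begin

text \<open>If one chord were reversed and an independent one fixed, the midpoint \<open>z\<close>
  of \<open>x\<close> and \<open>y\<close> would go between a point opposite to \<open>x\<close> and
  the point \<open>y\<close>. But its image lies on the line through \<open>p\<close> and
  \<open>z\<close>, where both coordinates are equal: one is nonpositive, the other nonnegative, so
  the image would be \<open>p\<close>.\<close>

lemma reflection_opposite_indep:
  assumes \<phi>: "metric_point_reflection M d p \<phi>" and p: "p \<in> M" and x: "x \<in> M" and y: "y \<in> M"
    and ind: "indep2 (x - p) (y - p)" and nonfix: "\<phi> x \<noteq> x"
  shows "\<phi> y \<noteq> y"
proof
  assume fix_y: "\<phi> y = y"
  define z where "z = p + ((1/2) *\<^sub>R (x - p) + (1/2) *\<^sub>R (y - p))"
  have neq: "x \<noteq> p" "z \<noteq> p"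
    using ind unfolding indep2_def z_def
    by (auto dest: spec[of _ "1::real"] spec[of _ "1/2::real"] spec[of _ "0::real"])
  have zseg: "z \<in> closed_segment x y"
  proof -
    have "z = (1 - 1/2) *\<^sub>R x + (1/2) *\<^sub>R y" unfolding z_def
      using scaleR_half_double[of p] by (simp add: algebra_simps)
    then show ?thesis unfolding in_segment by (intro exI[of _ "1/2"]) simp
  qed
  have zM: "z \<in> M" using zseg x y convex_M by (meson convex_contains_segment subsetD)
  obtain u where u: "\<phi> x = p + u *\<^sub>R (x - p)" "u < 0"
    using reflection_on_chord(1)[OF \<phi> p x neq(1)] nonfix by auto
  obtain v where v: "\<phi> z = p + v *\<^sub>R (z - p)" "v = 1 \<or> v < 0"
    using reflection_on_chord(1)[OF \<phi> p zM neq(2)] by auto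
  have "\<phi> z \<in> closed_segment (\<phi> x) (\<phi> y)"
    using isometry_segment[OF metric_point_reflectionD(1,2)[OF \<phi>] x y zseg] by blast
  then obtain \<tau> where \<tau>: "\<phi> z = (1 - \<tau>) *\<^sub>R \<phi> x + \<tau> *\<^sub>R \<phi> y" "0 \<le> \<tau>" "\<tau> \<le> 1"
    unfolding in_segment by blast
  have "(v/2) *\<^sub>R (x - p) + (v/2) *\<^sub>R (y - p) = \<phi> z - p"
    unfolding v(1) by (simp add: z_def scaleR_add_right)
  also have "\<dots> = ((1 - \<tau>) * u) *\<^sub>R (x - p) + \<tau> *\<^sub>R (y - p)"
    unfolding \<tau>(1) u(1) fix_y by (simp add: algebra_simps)
  finally have e: "v/2 = (1 - \<tau>) * u" "v/2 = \<tau>" using indep2D[OF ind] by blast+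
  have "(1 - \<tau>) * u \<le> 0" using \<tau>(3) u(2) by (simp add: mult_nonneg_nonpos)
  then show False using e v(2) \<tau>(2) by linarith
qed

text \<open>Some point is moved, so its chord is reversed, and with it every independent chord. A
  point collinear with \<open>p\<close> and the moved one is reached through a third direction,
  which is where dimension two enters.\<close>

lemma reflection_opposite:
  assumes dim: "DIM('a) \<ge> 2" and \<phi>: "metric_point_reflection M d p \<phi>" and p: "p \<in> M"
    and x: "x \<in> M" "x \<noteq> p"
  shows "\<exists>u>0. \<phi> x = p - u *\<^sub>R (x - p)"
proof -
  obtain x0 where x0: "x0 \<in> M" "\<phi> x0 \<noteq> x0" using metric_point_reflectionD(3)[OF \<phi>] by blast
  then have x0p: "x0 \<noteq> p" using metric_point_reflectionD(5)[OF \<phi>] by blast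
  have "\<phi> x \<noteq> x"
  proof (cases "indep2 (x0 - p) (x - p)")
    case True
    then show ?thesis using reflection_opposite_indep[OF \<phi> p x0(1) x(1)] x0 by blast
  next
    case False
    then obtain k where k: "x - p = k *\<^sub>R (x0 - p)" using not_indep2 x0p by (metis eq_iff_diff_eq_0)
    then have k0: "k \<noteq> 0" using x by auto
    obtain b where b: "indep2 (x0 - p) b" using exists_indep2 dim x0p by (metis eq_iff_diff_eq_0)
    obtain e where e: "e > 0" "\<And>r. \<bar>r\<bar> \<le> e \<Longrightarrow> p + r *\<^sub>R b \<in> M" using open_scaled_in[OF open_M p] by blast
    have zM: "p + e *\<^sub>R b \<in> M" using e by simp
    have "indep2 (x0 - p) ((p + e *\<^sub>R b) - p)"
      using indep2_comb[OF b, of 1 e 0 0] e by simp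
    then have z: "\<phi> (p + e *\<^sub>R b) \<noteq> p + e *\<^sub>R b"
      using reflection_opposite_indep[OF \<phi> p x0(1) zM] x0 by blast
    have "indep2 ((p + e *\<^sub>R b) - p) (x - p)"
      using indep2_comb[OF b, of 0 0 e k] e k0 unfolding k by simp
    then show ?thesis using reflection_opposite_indep[OF \<phi> p zM x(1)] z by blast
  qed
  then obtain u where "\<phi> x = p + u *\<^sub>R (x - p)" "u < 0"
    using reflection_on_chord(1)[OF \<phi> p x] by auto
  then show ?thesis by (intro exI[of _ "- u"]) simp
qed

text \<open>If \<open>\<phi> x = p - (x - p) / g x\<close> then \<open>g\<close> is affine, because \<open>\<phi>\<close> maps segments to segments.\<close>

lemma reflection_formula:
  assumes dim: "DIM('a) \<ge> 2" and \<phi>: "metric_point_reflection M d p \<phi>" and p: "p \<in> M"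
  shows "\<exists>K. linear K \<and> (\<forall>x\<in>M. 1 + K (x - p) > 0 \<and> \<phi> x = p - (1 / (1 + K (x - p))) *\<^sub>R (x - p))"
proof -
  define S where "S = (\<lambda>x. x - p) ` M"
  have S_iff: "x \<in> S \<longleftrightarrow> p + x \<in> M" for x unfolding S_def by (force simp: image_iff)
  have S: "open S" "convex S" "0 \<in> S"
    unfolding S_def using open_M convex_M p by (auto simp: open_translation_subtract convex_translation_subtract)
  \<comment> \<open>The value 1 at 0 is a convention: there the defining equation holds for every
    positive \<open>l\<close>.\<close>
  define g where "g x = (if x = 0 then 1 else (THE l. l > 0 \<and> \<phi> (p + x) = p - (1 / l) *\<^sub>R x))" for x
  have g: "g x > 0 \<and> \<phi> (p + x) = p - (1 / g x) *\<^sub>R x" if x: "x \<in> S" for x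
  proof (cases "x = 0")
    case True then show ?thesis using metric_point_reflectionD(5)[OF \<phi>] by (simp add: g_def)
  next
    case False
    obtain u where u: "u > 0" "\<phi> (p + x) = p - u *\<^sub>R x"
      using reflection_opposite[OF dim \<phi> p, of "p + x"] x False S_iff by auto
    have "(THE l. l > 0 \<and> \<phi> (p + x) = p - (1 / l) *\<^sub>R x) = 1 / u"
      by (rule the_equality) (use u False in \<open>auto simp: field_simps\<close>)
    then show ?thesis using u False by (simp add: g_def)
  qed
  have g0: "g 0 = 1" by (simp add: g_def)
  have aff_ind: "g ((1 - t) *\<^sub>R x + t *\<^sub>R y) = (1 - t) * g x + t * g y"
    if xy: "x \<in> S" "y \<in> S" "indep2 x y" "0 \<le> t" "t \<le> 1" for x y t
  proof -
    define z where "z = (1 - t) *\<^sub>R x + t *\<^sub>R y"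
    have zS: "z \<in> S" unfolding z_def using S(2) xy unfolding convex_alt by blast
    have "p + z \<in> closed_segment (p + x) (p + y)"
      unfolding in_segment z_def using xy by (intro exI[of _ t]) (simp add: algebra_simps)
    then have "\<phi> (p + z) \<in> closed_segment (\<phi> (p + x)) (\<phi> (p + y))"
      using isometry_segment[OF metric_point_reflectionD(1,2)[OF \<phi>]] xy(1,2) S_iff by blast
    then obtain \<tau> where \<tau>: "\<phi> (p + z) = (1 - \<tau>) *\<^sub>R \<phi> (p + x) + \<tau> *\<^sub>R \<phi> (p + y)"
      unfolding in_segment by blast
    have "p - (1 / g z) *\<^sub>R z = (1 - \<tau>) *\<^sub>R (p - (1 / g x) *\<^sub>R x) + \<tau> *\<^sub>R (p - (1 / g y) *\<^sub>R y)"
      using \<tau> g zS xy by metis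
    also have "\<dots> = p - (((1 - \<tau>) / g x) *\<^sub>R x + (\<tau> / g y) *\<^sub>R y)"
      by (simp add: algebra_simps)
    finally have "p - (p - (1 / g z) *\<^sub>R z) = p - (p - (((1 - \<tau>) / g x) *\<^sub>R x + (\<tau> / g y) *\<^sub>R y))"
      by (simp only:)
    then have "(1 / g z) *\<^sub>R z = ((1 - \<tau>) / g x) *\<^sub>R x + (\<tau> / g y) *\<^sub>R y"
      by (simp only: diff_diff_eq2 add_diff_cancel_left')
    then have "((1 - t) / g z) *\<^sub>R x + (t / g z) *\<^sub>R y = ((1 - \<tau>) / g x) *\<^sub>R x + (\<tau> / g y) *\<^sub>R y"
      unfolding z_def by (simp add: scaleR_add_right)
    then have "(1 - t) / g z = (1 - \<tau>) / g x \<and> t / g z = \<tau> / g y" by (rule indep2D[OF xy(3)])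
    then have "(1 - t) * g x = g z * (1 - \<tau>)" "t * g y = g z * \<tau>"
      using g[OF xy(1)] g[OF xy(2)] g[OF zS] by (auto simp: field_simps)
    then show ?thesis unfolding z_def[symmetric] by (simp add: algebra_simps)
  qed
  \<comment> \<open>The origin stays excluded, since \<open>g 0\<close> carries no information about
    the reflection. \<open>g\<close> is therefore shown to be affine on a set \<open>N\<close>
    missing the origin and is extended from there.\<close>
  note aff_nz = affine_off_rays_imp_affine[OF dim S(1,2) aff_ind]
  obtain x0 where x0: "x0 \<in> S" "x0 \<noteq> 0"
  proof -
    obtain v :: 'a where v: "v \<noteq> 0" by (metis nonzero_Basis nonempty_Basis ex_in_conv)
    obtain r where r: "r > 0" "0 + r *\<^sub>R v \<in> S" using open_scaled_in[OF S(1,3)] by (metis abs_of_pos order_refl)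
    then show ?thesis using v by (intro that[of "r *\<^sub>R v"]) auto
  qed
  define N where "N = S \<inter> ball x0 (norm x0)"
  have N: "open N" "convex N" "x0 \<in> N" "N \<subseteq> S" "0 \<notin> N"
    unfolding N_def using S x0 by (auto intro: convex_Int)
  obtain K where K: "linear K" "\<And>x. x \<in> N \<Longrightarrow> g x = g x0 + K (x - x0)"
  proof -
    have "g ((1 - t) *\<^sub>R x + t *\<^sub>R y) = (1 - t) * g x + t * g y" if "x \<in> N" "y \<in> N" "0 \<le> t" "t \<le> 1" for x y t
    proof -
      have "(1 - t) *\<^sub>R x + t *\<^sub>R y \<in> N" using N(2) that unfolding convex_alt by blast
      then show ?thesis using N(4,5) that by (intro aff_nz) auto
    qed
    then show ?thesis using affine_function_linear[OF N(1-3)] that by blast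
  qed
  define A where "A = g x0 - K x0"
  have gA: "g y = A + K y" if y: "y \<in> S" "y \<noteq> 0" for y
  proof -
    \<comment> \<open>A short step from \<open>x0\<close> towards \<open>y\<close> stays in
      \<open>N\<close>, where \<open>g\<close> is known; affinity on the segment from
      \<open>x0\<close> to \<open>y\<close> then determines \<open>g y\<close>.\<close>
    obtain t0 where t0: "t0 > 0" "\<And>t. \<bar>t\<bar> \<le> t0 \<Longrightarrow> x0 + t *\<^sub>R (y - x0) \<in> N"
      using open_scaled_in[OF N(1,3)] by blast
    define t where "t = min t0 1"
    have t: "0 < t" "t \<le> 1" unfolding t_def using t0 by auto
    have e: "(1 - t) *\<^sub>R x0 + t *\<^sub>R y = x0 + t *\<^sub>R (y - x0)" by (simp add: algebra_simps)
    have w: "(1 - t) *\<^sub>R x0 + t *\<^sub>R y \<in> N" unfolding e using t0(2)[of t] t unfolding t_def by auto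
    then have "(1 - t) *\<^sub>R x0 + t *\<^sub>R y \<noteq> 0" using N(5) by metis
    then have "(1 - t) * g x0 + t * g y = g ((1 - t) *\<^sub>R x0 + t *\<^sub>R y)"
      using x0 y t by (intro aff_nz[symmetric]) auto
    also have "\<dots> = g x0 + t * K (y - x0)"
      using K(2)[OF w] linear_cmul[OF K(1), of t "y - x0"] unfolding e by simp
    finally have "t * (g y - g x0) = t * K (y - x0)" by (simp add: algebra_simps)
    then show ?thesis unfolding A_def using t linear_diff[OF K(1), of y x0] by simp
  qed
  \<comment> \<open>Applying the reflection twice gives \<open>g z * g y = 1\<close> for the image
    \<open>z\<close>. The alternative to \<open>A = 1\<close> would make \<open>g y\<close> equal to
    \<open>- 1\<close>.\<close>
  have invol: "(A - 1) * (A + 1 + K y) = 0" if y: "y \<in> S" "y \<noteq> 0" for y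
  proof -
    define z where "z = (- 1 / g y) *\<^sub>R y"
    note gy = g[OF y(1)]
    have py: "\<phi> (p + y) = p + z" using gy z_def by simp
    then have "z \<in> S" using metric_point_reflectionD(1)[OF \<phi>] y(1) S_iff by (metis image_eqI)
    moreover have "z \<noteq> 0" unfolding z_def using y(2) gy by simp
    ultimately have z: "z \<in> S" "z \<noteq> 0" by blast+
    have "p + y = p - (1 / g z) *\<^sub>R z"
      using metric_point_reflectionD(4)[OF \<phi>, of "p + y"] y(1) S_iff g[OF z(1)] py by simp
    then have "1 *\<^sub>R y = (1 / (g z * g y)) *\<^sub>R y" unfolding z_def by simp
    then have "g z * g y = 1" using y(2) gy g[OF z(1)] by (simp only: scaleR_cancel_right) simp
    moreover have "g z * g y = A * g y - K y"
      using gA[OF z] gy linear_cmul[OF K(1), of "- 1 / g y" y] unfolding z_def by (simp add: field_simps)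
    ultimately have "A * (A + K y) - K y = 1" using gA[OF y] by simp
    then show ?thesis by (simp add: algebra_simps)
  qed
  have "A = 1"
  proof (rule ccontr)
    assume "A \<noteq> 1"
    then have "A + 1 + K x0 = 0" using invol[OF x0] by simp
    then show False using g[OF x0(1)] gA[OF x0] \<open>A \<noteq> 1\<close> by simp
  qed
  then have K1: "g x = 1 + K x" if "x \<in> S" for x using gA that g0 linear_0[OF K(1)] by (cases "x = 0") auto
  have "1 + K (x - p) > 0 \<and> \<phi> x = p - (1 / (1 + K (x - p))) *\<^sub>R (x - p)" if "x \<in> M" for x
  proof -
    have "x - p \<in> S" using that S_iff by simp
    then show ?thesis using g[of "x - p"] K1[of "x - p"] by simp
  qed
  then show ?thesis using K(1) by blast
qed

section \<open>From an open set of centers to all points\<close>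

lemma reflection_conj:
  assumes \<phi>: "metric_point_reflection M d p \<phi>" and \<psi>: "metric_point_reflection M d q \<psi>"
    and q: "q \<in> M"
  shows "metric_point_reflection M d (\<phi> q) (\<lambda>x. \<phi> (\<psi> (\<phi> x)))"
proof -
  note F = metric_point_reflectionD[OF \<phi>] and P = metric_point_reflectionD[OF \<psi>]
  have FM: "\<phi> x \<in> M" if "x \<in> M" for x using F(1) that by (metis imageI)
  have PM: "\<psi> x \<in> M" if "x \<in> M" for x using P(1) that by (metis imageI)
  have "(\<lambda>x. \<phi> (\<psi> (\<phi> x))) ` M = \<phi> ` (\<psi> ` (\<phi> ` M))" by (simp add: image_image)
  also have "\<dots> = M" by (simp only: F(1) P(1))
  finally have 1: "(\<lambda>x. \<phi> (\<psi> (\<phi> x))) ` M = M" .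
  have 2: "\<forall>x\<in>M. \<forall>y\<in>M. d (\<phi> (\<psi> (\<phi> x))) (\<phi> (\<psi> (\<phi> y))) = d x y"
    by (simp add: F(2) P(2) FM PM)
  obtain x where x: "x \<in> M" "\<psi> x \<noteq> x" using P(3) by blast
  have "\<phi> (\<psi> (\<phi> (\<phi> x))) \<noteq> \<phi> x"
  proof
    assume "\<phi> (\<psi> (\<phi> (\<phi> x))) = \<phi> x"
    then have "\<phi> (\<phi> (\<psi> x)) = \<phi> (\<phi> x)" by (simp add: F(4) x)
    then show False using x by (simp add: F(4) PM)
  qed
  then have 3: "\<exists>x\<in>M. \<phi> (\<psi> (\<phi> x)) \<noteq> x" using FM x by blast
  have 4: "\<forall>x\<in>M. \<phi> (\<psi> (\<phi> (\<phi> (\<psi> (\<phi> x))))) = x" by (simp add: F(4) P(4) FM PM)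
  have 5: "\<phi> (\<psi> (\<phi> (\<phi> q))) = \<phi> q" by (simp add: F(4) P(5) q)
  have 6: "(\<lambda>x. \<phi> (\<psi> (\<phi> x))) ` L = L" if L: "geodesic_line M d L" "\<phi> q \<in> L" for L
  proof -
    have LM: "L \<subseteq> M" using L unfolding geodesic_line_def by blast
    have "geodesic_line M d (\<phi> ` L)" by (rule isometry_geodesic_line[OF F(1,2) L(1)])
    moreover have "q \<in> \<phi> ` L" using L(2) F(4)[OF q] by (metis imageI)
    ultimately have "\<psi> ` (\<phi> ` L) = \<phi> ` L" by (rule P(6))
    then have "(\<lambda>x. \<phi> (\<psi> (\<phi> x))) ` L = \<phi> ` (\<phi> ` L)" by (metis image_image)
    also have "\<dots> = (\<lambda>x. x) ` L" unfolding image_image using LM F(4) by (intro image_cong) auto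
    finally show ?thesis by simp
  qed
  show ?thesis unfolding metric_point_reflection_def using 1 2 3 4 5 6 by blast
qed

text \<open>On a chord parametrized by arc length, reflecting the center at \<open>b\<close> in the
  center at \<open>a\<close> gives one at \<open>2 * a - b\<close>, because conjugates of point
  reflections are point reflections. Doubling from a base point in \<open>U\<close> spreads an
  interval of centers over the whole chord.\<close>

lemma all_centers:
  assumes dim: "DIM('a) \<ge> 2" and U: "open U" "U \<noteq> {}" "U \<subseteq> centers M d"
  shows "centers M d = M"
proof -
  have "x \<in> centers M d" if x: "x \<in> M" for x
  proof -
    obtain p where pU: "p \<in> U" using U by blast
    then have p: "p \<in> centers M d" "p \<in> M" using U unfolding centers_def by auto
    show ?thesis
    proof (cases "x = p")
      case False
      define v where "v = x - p"
      have v: "v \<noteq> 0" using False v_def by simp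
      obtain \<sigma> where \<sigma>: "strict_mono \<sigma>" "continuous_on UNIV \<sigma>" "\<sigma> 0 = 0"
        "range \<sigma> = {u. p + u *\<^sub>R v \<in> M}"
        "\<And>r s. d (p + \<sigma> r *\<^sub>R v) (p + \<sigma> s *\<^sub>R v) = \<bar>r - s\<bar>"
        using chord_param[of p v] p v by auto
      define \<gamma> where "\<gamma> t = p + \<sigma> t *\<^sub>R v" for t
      have \<gamma>M: "\<gamma> t \<in> M" for t using \<sigma>(4) unfolding \<gamma>_def by blast
      have refl: "\<gamma> (2 * a - b) \<in> centers M d"
        if a: "\<gamma> a \<in> centers M d" and b: "\<gamma> b \<in> centers M d" for a b
      proof (cases "a = b")
        case True then show ?thesis using a by simp
      next
        case False
        obtain \<phi> where \<phi>: "metric_point_reflection M d (\<gamma> a) \<phi>" using a unfolding centers_def by blast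
        obtain \<psi> where \<psi>: "metric_point_reflection M d (\<gamma> b) \<psi>" using b unfolding centers_def by blast
        have ne: "\<gamma> b \<noteq> \<gamma> a"
          using False strict_mono_eq[OF \<sigma>(1)] v unfolding \<gamma>_def by simp
        obtain u where u: "u > 0" "\<phi> (\<gamma> b) = \<gamma> a - u *\<^sub>R (\<gamma> b - \<gamma> a)"
          using reflection_opposite[OF dim \<phi> \<gamma>M \<gamma>M ne] by blast
        have \<phi>M: "\<phi> (\<gamma> b) \<in> M" using metric_point_reflectionD(1)[OF \<phi>] \<gamma>M by (metis imageI)
        have e: "\<phi> (\<gamma> b) = p + (\<sigma> a - u * (\<sigma> b - \<sigma> a)) *\<^sub>R v"
          unfolding u(2) unfolding \<gamma>_def by (simp add: algebra_simps)
        then obtain c where c: "\<sigma> c = \<sigma> a - u * (\<sigma> b - \<sigma> a)" using \<phi>M \<sigma>(4) by (metis (mono_tags, lifting) imageE mem_Collect_eq)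
        have "d (\<gamma> a) (\<phi> (\<gamma> b)) = d (\<gamma> a) (\<gamma> b)"
          using reflection_on_chord(2)[OF \<phi> \<gamma>M \<gamma>M ne] .
        then have "\<bar>a - c\<bar> = \<bar>a - b\<bar>" using \<sigma>(5)[of a c] \<sigma>(5)[of a b] e c by (simp add: \<gamma>_def)
        moreover have "c > a \<longleftrightarrow> b < a"
        proof -
          have "c > a \<longleftrightarrow> 0 < u * (\<sigma> a - \<sigma> b)" using strict_mono_less[OF \<sigma>(1), of a c] c by (simp add: algebra_simps)
          also have "\<dots> \<longleftrightarrow> b < a" using u strict_mono_less[OF \<sigma>(1), of b a] by (simp add: zero_less_mult_iff)
          finally show ?thesis .
        qed
        ultimately have "c = 2 * a - b" using False by argo
        then have "\<phi> (\<gamma> b) = \<gamma> (2 * a - b)" using e c by (simp add: \<gamma>_def)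
        then show ?thesis using reflection_conj[OF \<phi> \<psi> \<gamma>M] \<gamma>M unfolding centers_def by auto
      qed
      have "open (\<gamma> -` U)"
        unfolding \<gamma>_def by (intro continuous_open_vimage U) (auto intro!: continuous_intros continuous_on_interior[OF \<sigma>(2)])
      moreover have "0 \<in> \<gamma> -` U" using pU \<sigma>(3) by (simp add: \<gamma>_def)
      ultimately obtain \<epsilon> where \<epsilon>: "\<epsilon> > 0" "ball 0 \<epsilon> \<subseteq> \<gamma> -` U" using open_contains_ball by blast
      \<comment> \<open>The point at \<open>t\<close> is the reflection of \<open>\<gamma> 0\<close>
        in the center at \<open>t / 2\<close>.\<close>
      have step: "\<gamma> t \<in> centers M d" if "\<bar>t\<bar> < 2 ^ n * \<epsilon>" for t n using that
      proof (induction n arbitrary: t)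
        case 0
        then have "t \<in> ball 0 \<epsilon>" by (simp add: dist_real_def)
        then show ?case using \<epsilon> U by blast
      next
        case (Suc n)
        have "\<gamma> (t/2) \<in> centers M d" "\<gamma> 0 \<in> centers M d" using Suc p \<sigma>(3) by (auto simp: \<gamma>_def)
        from refl[OF this] show ?case by simp
      qed
      have "1 \<in> range \<sigma>" using \<sigma>(4) x v_def by simp
      then obtain b where "\<sigma> b = 1" by fastforce
      then have b: "\<gamma> b = x" by (simp add: \<gamma>_def v_def)
      obtain n where "\<bar>b\<bar> / \<epsilon> < 2 ^ n" using real_arch_pow[of 2 "\<bar>b\<bar> / \<epsilon>"] by auto
      then have "\<bar>b\<bar> < 2 ^ n * \<epsilon>" using \<epsilon> by (simp add: field_simps)
      then show ?thesis using step b by blast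
    qed (use p in simp)
  qed
  then show ?thesis unfolding centers_def by blast
qed

end

section \<open>Linear lifts and the invariant density\<close>

text \<open>\<open>1 + K p (x - p)\<close> is the denominator of the reflection at \<open>p\<close>.
  Its zeros are the points sent to infinity, and positivity keeps them out of
  \<open>M\<close>.\<close>

locale symmetric_domain = projective_metric M d
  for M :: "(real ^ 'n) set" and d :: "real ^ 'n \<Rightarrow> real ^ 'n \<Rightarrow> real" +
  fixes K :: "real ^ 'n \<Rightarrow> real ^ 'n \<Rightarrow> real"
  assumes linear_K: "p \<in> M \<Longrightarrow> linear (K p)"
    and pos_K: "p \<in> M \<Longrightarrow> x \<in> M \<Longrightarrow> 1 + K p (x - p) > 0"
    and refl_K: "p \<in> M \<Longrightarrow>
      metric_point_reflection M d p (\<lambda>x. p - (1 / (1 + K p (x - p))) *\<^sub>R (x - p))"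
begin

definition \<mu> :: "real ^ 'n \<Rightarrow> real ^ 'n \<Rightarrow> real" where "\<mu> p x = 1 + K p (x - p)"

definition s :: "real ^ 'n \<Rightarrow> real ^ 'n \<Rightarrow> real ^ 'n" where "s p x = p - (1 / \<mu> p x) *\<^sub>R (x - p)"

lemma \<mu>_pos: "p \<in> M \<Longrightarrow> x \<in> M \<Longrightarrow> \<mu> p x > 0"
  using pos_K \<mu>_def by simp

lemma reflection_s: "p \<in> M \<Longrightarrow> metric_point_reflection M d p (s p)"
  using refl_K[of p] unfolding s_def \<mu>_def .

lemma s_in: "p \<in> M \<Longrightarrow> x \<in> M \<Longrightarrow> s p x \<in> M"
  using metric_point_reflectionD(1)[OF reflection_s] by (metis imageI)

lemma s_isometry: "p \<in> M \<Longrightarrow> x \<in> M \<Longrightarrow> y \<in> M \<Longrightarrow> d (s p x) (s p y) = d x y"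
  using metric_point_reflectionD(2)[OF reflection_s] .

lemma s_involution: "p \<in> M \<Longrightarrow> x \<in> M \<Longrightarrow> s p (s p x) = x"
  using metric_point_reflectionD(4)[OF reflection_s] .

lemma \<mu>_self: "p \<in> M \<Longrightarrow> \<mu> p p = 1"
  unfolding \<mu>_def using linear_0[OF linear_K] by simp

lemma s_self: "s p p = p"
  unfolding s_def by simp

text \<open>The point \<open>p\<close> is the mean of \<open>x\<close> and \<open>s p x\<close> with
  weights 1 and \<open>\<mu> p x\<close>. Clearing the denominator turns identities between
  reflections into linear algebra.\<close>

lemma s_relation: "p \<in> M \<Longrightarrow> x \<in> M \<Longrightarrow> \<mu> p x *\<^sub>R s p x = (1 + \<mu> p x) *\<^sub>R p - x"
  unfolding s_def using \<mu>_pos[of p x] by (simp add: algebra_simps)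

lemma \<mu>_s: assumes "p \<in> M" "x \<in> M" shows "\<mu> p (s p x) = 1 / \<mu> p x"
proof -
  have e: "s p x - p = (- 1 / \<mu> p x) *\<^sub>R (x - p)" unfolding s_def by simp
  have "\<mu> p (s p x) = 1 + (- 1 / \<mu> p x) * K p (x - p)"
    unfolding \<mu>_def[of p "s p x"] e linear_scale[OF linear_K[OF assms(1)]] by simp
  also have "K p (x - p) = \<mu> p x - 1" unfolding \<mu>_def by simp
  finally show ?thesis using \<mu>_pos[OF assms] by (simp add: field_simps)
qed

lemma \<mu>_combination:
  assumes "p \<in> M" "a + b = 1"
  shows "\<mu> p (a *\<^sub>R x + b *\<^sub>R y) = a * \<mu> p x + b * \<mu> p y"
proof -
  have b: "b = 1 - a" using assms(2) by simp
  have "a *\<^sub>R x + b *\<^sub>R y - p = a *\<^sub>R (x - p) + b *\<^sub>R (y - p)" unfolding b by (simp add: algebra_simps)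
  then have "\<mu> p (a *\<^sub>R x + b *\<^sub>R y) = 1 + (a * K p (x - p) + b * K p (y - p))"
    unfolding \<mu>_def using linear_K[OF assms(1)] by (simp add: linear_add linear_scale)
  then show ?thesis unfolding \<mu>_def b by (simp add: algebra_simps)
qed

lemma \<mu>_at_s:
  assumes "p \<in> M" "q \<in> M" "x \<in> M"
  shows "\<mu> p x * \<mu> q (s p x) = (1 + \<mu> p x) * \<mu> q p - \<mu> q x"
proof -
  note pos = \<mu>_pos[OF assms(1,3)]
  have e: "s p x = (1 + 1 / \<mu> p x) *\<^sub>R p + (- 1 / \<mu> p x) *\<^sub>R x" unfolding s_def by (simp add: algebra_simps)
  have "\<mu> q (s p x) = (1 + 1 / \<mu> p x) * \<mu> q p + (- 1 / \<mu> p x) * \<mu> q x"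
    unfolding e by (rule \<mu>_combination[OF assms(2)]) simp
  then show ?thesis using pos by (simp only:) (simp add: field_simps)
qed

lemma s_inj: "p \<in> M \<Longrightarrow> x \<in> M \<Longrightarrow> y \<in> M \<Longrightarrow> s p x = s p y \<Longrightarrow> x = y"
  using s_involution by metis

lemma s_in_segment:
  assumes "p \<in> M" "x \<in> M"
  shows "p \<in> closed_segment x (s p x)"
proof -
  note pos = \<mu>_pos[OF assms]
  define t where "t = \<mu> p x / (1 + \<mu> p x)"
  have t: "0 \<le> t" "t \<le> 1" "1 - t = 1 / (1 + \<mu> p x)" unfolding t_def using pos by (auto simp: field_simps)
  have "t *\<^sub>R s p x = (1 / (1 + \<mu> p x)) *\<^sub>R (\<mu> p x *\<^sub>R s p x)" unfolding t_def by simp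
  also have "\<dots> = p - (1 / (1 + \<mu> p x)) *\<^sub>R x"
    unfolding s_relation[OF assms] using pos by (simp add: scaleR_diff_right)
  finally have "p = (1 - t) *\<^sub>R x + t *\<^sub>R s p x" unfolding t(3) by simp
  then show ?thesis unfolding in_segment using t by blast
qed

text \<open>On the ray from \<open>p\<close> opposite to \<open>x\<close> only one point has the
  right distance. This describes \<open>s p x\<close> by segments and distances only, which
  isometries preserve; hence the conjugation law.\<close>

lemma s_unique:
  assumes p: "p \<in> M" and x: "x \<in> M" and y: "y \<in> M" and seg: "p \<in> closed_segment x y"
    and dist: "d p y = d p x"
  shows "y = s p x"
proof (cases "x = p")
  case True
  then have "d p y = 0" using dist p by simp
  then have "y = p" using p y zero by auto
  then show ?thesis using True s_self by simp
next
  case False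
  obtain t where t: "p = (1 - t) *\<^sub>R x + t *\<^sub>R y" "0 \<le> t" "t \<le> 1" using seg unfolding in_segment by blast
  have t0: "t \<noteq> 0" using t(1) False by auto
  have "t \<noteq> 1"
  proof
    assume "t = 1"
    then have "y = p" using t by simp
    then show False using dist p x False zero[of p x] by auto
  qed
  define k where "k = (1 - t) / t"
  have k: "k > 0" unfolding k_def using t t0 \<open>t \<noteq> 1\<close> by simp
  have "t *\<^sub>R (y - p) = t *\<^sub>R y - t *\<^sub>R p" by (simp add: scaleR_diff_right)
  also have "t *\<^sub>R y = p - (1 - t) *\<^sub>R x" using t(1) by (metis add_diff_cancel_left')
  also have "p - (1 - t) *\<^sub>R x - t *\<^sub>R p = (- (1 - t)) *\<^sub>R (x - p)" by (simp add: algebra_simps)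
  finally have "(1/t) *\<^sub>R (t *\<^sub>R (y - p)) = (1/t) *\<^sub>R ((- (1 - t)) *\<^sub>R (x - p))" by (simp only:)
  then have "y - p = ((1/t) * (- (1 - t))) *\<^sub>R (x - p)" using t0 by simp
  also have "(1/t) * (- (1 - t)) = - k" unfolding k_def by (simp add: diff_divide_distrib)
  finally have "y - p = (- k) *\<^sub>R (x - p)" .
  then have y': "y = p + (- k) *\<^sub>R (x - p)" by (metis add_diff_cancel_left' diff_add_cancel add.commute)
  have s': "s p x = p + (- 1 / \<mu> p x) *\<^sub>R (x - p)" unfolding s_def by simp
  have "d p (s p x) = d p x" using s_isometry[OF p p x] s_self by simp
  then have "- k = - 1 / \<mu> p x"
    using same_ray_eq[of p "- k" "x - p" "- 1 / \<mu> p x"] p y s_in[OF p x] dist False \<mu>_pos[OF p x] k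
    unfolding y' s' by (simp add: divide_neg_pos)
  then show ?thesis unfolding y' s' by simp
qed

lemma s_conj:
  assumes "q \<in> M" "p \<in> M" "x \<in> M"
  shows "s (s q p) (s q x) = s q (s p x)"
proof -
  have "s q p \<in> closed_segment (s q x) (s q (s p x))"
    using isometry_segment[OF metric_point_reflectionD(1,2)[OF reflection_s[OF assms(1)]]
        assms(3) s_in[OF assms(2,3)] s_in_segment[OF assms(2,3)]] by blast
  moreover have "d (s q p) (s q (s p x)) = d (s q p) (s q x)"
    using assms s_isometry[OF assms(1)] s_in s_isometry[OF assms(2) assms(2) assms(3)] s_self by simp
  ultimately show ?thesis using s_unique assms s_in by metis
qed

lemma exists_s_midpoint:
  assumes "p \<in> M" "q \<in> M"
  shows "\<exists>m\<in>M. s m p = q"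
proof (cases "p = q")
  case True then show ?thesis using assms s_self by blast
next
  case False
  obtain w where w: "0 < w" "w < 1" "p + w *\<^sub>R (q - p) \<in> M" "d p (p + w *\<^sub>R (q - p)) = d p q / 2"
    "d (p + w *\<^sub>R (q - p)) q = d p q / 2" using exists_midpoint[OF assms False] by auto
  define m where "m = p + w *\<^sub>R (q - p)"
  have "m \<in> closed_segment p q"
    unfolding in_segment m_def using w by (intro exI[of _ w]) (simp add: algebra_simps)
  moreover have "d m q = d m p" using w commute unfolding m_def by metis
  moreover have m: "m \<in> M" using w(3) unfolding m_def .
  ultimately have "q = s m p" using s_unique assms by blast
  then show ?thesis using m by blast
qed

text \<open>The reflection at \<open>s q p\<close> is the conjugate of the one at \<open>p\<close>
  by \<open>s q\<close>. Both descriptions of the point \<open>z\<close> expand linearly, and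
  comparing the vectors from \<open>p'\<close> identifies the total factors:
  \<open>D = \<mu> q x * \<mu> p' y\<close>. This law will make the kernel \<open>H\<close>
  invariant.\<close>

lemma \<mu>_equivariant:
  assumes q: "q \<in> M" and p: "p \<in> M" and x: "x \<in> M"
  shows "(1 + \<mu> (s q p) (s q x)) * \<mu> q x = \<mu> q p * (1 + \<mu> p x)"
proof (cases "x = p")
  case True
  then show ?thesis using \<mu>_self s_in q p by simp
next
  case False
  define p' y w z where "p' = s q p" and "y = s q x" and "w = s p x" and "z = s q w"
  have M: "p' \<in> M" "y \<in> M" "w \<in> M" "z \<in> M" unfolding p'_def y_def w_def z_def using assms s_in by auto
  have z: "s p' y = z" unfolding p'_def y_def w_def z_def using s_conj assms by simp
  \<comment> \<open>The factor that the linear lifts of \<open>s p\<close> and \<open>s q\<close>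
    accumulate on \<open>x\<close>.\<close>
  define D where "D = \<mu> p x * \<mu> q w"
  have D: "D = (1 + \<mu> p x) * \<mu> q p - \<mu> q x" unfolding D_def w_def by (rule \<mu>_at_s) (use assms in auto)
  have "D *\<^sub>R z = \<mu> p x *\<^sub>R (\<mu> q w *\<^sub>R s q w)" unfolding D_def z_def by simp
  also have "\<dots> = (\<mu> p x + D) *\<^sub>R q - \<mu> p x *\<^sub>R s p x"
    unfolding s_relation[OF q M(3)] D_def w_def[symmetric] by (simp add: algebra_simps)
  also have "\<dots> = (\<mu> p x + D) *\<^sub>R q - ((1 + \<mu> p x) *\<^sub>R p - x)" unfolding s_relation[OF p x] ..
  also have "\<dots> = (1 + \<mu> p x) *\<^sub>R ((1 + \<mu> q p) *\<^sub>R q - p) - ((1 + \<mu> q x) *\<^sub>R q - x)"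
    unfolding D by (simp add: algebra_simps)
  also have "\<dots> = ((1 + \<mu> p x) * \<mu> q p) *\<^sub>R p' - \<mu> q x *\<^sub>R y"
    unfolding s_relation[OF q p, symmetric] s_relation[OF q x, symmetric] p'_def y_def by simp
  also have "(1 + \<mu> p x) * \<mu> q p = D + \<mu> q x" unfolding D by simp
  finally have 1: "D *\<^sub>R (z - p') = - (\<mu> q x *\<^sub>R (y - p'))" by (simp add: algebra_simps)
  have "\<mu> p' y *\<^sub>R z = (1 + \<mu> p' y) *\<^sub>R p' - y" using s_relation[OF M(1,2)] unfolding z .
  then have 2: "\<mu> p' y *\<^sub>R (z - p') = - (y - p')" by (simp add: algebra_simps)
  have "D *\<^sub>R (z - p') = (\<mu> q x * \<mu> p' y) *\<^sub>R (z - p')"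
    unfolding 1 scaleR_scaleR[symmetric] 2 by (simp only: scaleR_minus_right)
  moreover have "z \<noteq> p'"
  proof
    assume "z = p'"
    then have "w = p" unfolding z_def p'_def using s_inj q p M by blast
    then have "s p x = s p p" unfolding w_def using s_self by simp
    then show False using s_inj p x False by blast
  qed
  ultimately have "D = \<mu> q x * \<mu> p' y" by simp
  then show ?thesis unfolding D p'_def y_def by (simp add: algebra_simps)
qed

text \<open>Homogeneous coordinates: \<open>h x = (1, x)\<close>, and \<open>S p\<close> is the linear involution inducing \<open>s p\<close>.\<close>

definition h :: "real ^ 'n \<Rightarrow> real ^ 'n option" where
  "h x = (\<chi> i. case i of None \<Rightarrow> 1 | Some j \<Rightarrow> x $ j)"

definition S :: "real ^ 'n \<Rightarrow> real ^ 'n option \<Rightarrow> real ^ 'n option" where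
  "S p X = (2 * X $ None + K p ((\<chi> j. X $ Some j) - X $ None *\<^sub>R p)) *\<^sub>R h p - X"

lemma h_nth [simp]: "h x $ None = 1" "h x $ Some j = x $ j"
  by (simp_all add: h_def)

lemma vec_option_eqI: "X $ None = Y $ None \<Longrightarrow> (\<And>j. X $ Some j = Y $ Some j) \<Longrightarrow> X = (Y :: real ^ 'n option)"
  unfolding vec_eq_iff by (metis option.exhaust)

lemma h_rest: "(\<chi> j. h x $ Some j) = x"
  by (simp add: vec_eq_iff)

lemma linear_S: assumes "p \<in> M" shows "linear (S p)"
proof -
  have "linear (\<lambda>X :: real ^ 'n option. (\<chi> j. X $ Some j) - X $ None *\<^sub>R p)"
    by (rule linearI) (simp_all add: vec_eq_iff algebra_simps)
  then have "linear (K p \<circ> (\<lambda>X. (\<chi> j. X $ Some j) - X $ None *\<^sub>R p))"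
    by (rule linear_compose) (rule linear_K[OF assms])
  then have lin: "linear (\<lambda>X. K p ((\<chi> j. X $ Some j) - X $ None *\<^sub>R p))" by (simp add: o_def)
  define L where "L = (\<lambda>X :: real ^ 'n option. 2 * X $ None + K p ((\<chi> j. X $ Some j) - X $ None *\<^sub>R p))"
  have L: "linear L" unfolding L_def
    by (intro linear_compose_add lin) (simp add: linearI)
  have S: "S p = (\<lambda>X. L X *\<^sub>R h p - X)" by (rule ext) (simp add: S_def L_def)
  show ?thesis unfolding S
    by (intro linearI) (simp_all add: linear_add[OF L] linear_cmul[OF L] algebra_simps)
qed

lemma S_h: assumes "p \<in> M" "x \<in> M" shows "S p (h x) = \<mu> p x *\<^sub>R h (s p x)"
proof (rule vec_option_eqI)
  have c: "2 * h x $ None + K p ((\<chi> j. h x $ Some j) - h x $ None *\<^sub>R p) = 1 + \<mu> p x"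
    unfolding h_rest \<mu>_def by simp
  show "S p (h x) $ None = (\<mu> p x *\<^sub>R h (s p x)) $ None" unfolding S_def c by simp
  show "S p (h x) $ Some j = (\<mu> p x *\<^sub>R h (s p x)) $ Some j" for j
  proof -
    have "(\<mu> p x *\<^sub>R s p x) $ j = ((1 + \<mu> p x) *\<^sub>R p - x) $ j" unfolding s_relation[OF assms] ..
    then show ?thesis unfolding S_def c by simp
  qed
qed

lemma S_involution: assumes "p \<in> M" shows "S p (S p X) = X"
proof -
  define L where "L X = 2 * X $ None + K p ((\<chi> j. X $ Some j) - X $ None *\<^sub>R p)" for X :: "real ^ 'n option"
  have S: "S p X = L X *\<^sub>R h p - X" for X unfolding S_def L_def ..
  have "L (c *\<^sub>R h p - X) = c * 2 - L X" for c
  proof -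
    have e: "(\<chi> j. (c *\<^sub>R h p - X) $ Some j) - (c *\<^sub>R h p - X) $ None *\<^sub>R p
      = - ((\<chi> j. X $ Some j) - X $ None *\<^sub>R p)" by (simp add: vec_eq_iff algebra_simps)
    show ?thesis unfolding L_def e linear_neg[OF linear_K[OF assms]] by simp
  qed
  then have "L (S p X) = L X" unfolding S by simp
  then show ?thesis unfolding S[of "S p X"] by (simp add: S)
qed

lemma abs_det_S: assumes "p \<in> M" shows "\<bar>det (matrix (S p))\<bar> = 1"
proof -
  have "matrix (S p) ** matrix (S p) = matrix (S p \<circ> S p)"
    by (rule matrix_compose[OF linear_S linear_S, symmetric]) fact+
  also have "S p \<circ> S p = id" using S_involution[OF assms] by auto
  finally have "det (matrix (S p)) * det (matrix (S p)) = 1"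
    by (metis det_mul det_I matrix_id_mat_1)
  then show ?thesis by (metis abs_1 abs_mult abs_mult_self_eq abs_square_eq_1 power2_eq_square)
qed

text \<open>If an isometry fixing \<open>o\<close> is induced by a linear map of determinant \<open>\<plusminus>1\<close> that scales \<open>h o\<close> by
  \<open>\<nu> < 1\<close>, then its powers tend to \<open>0\<close>, since the iterates of a small ball around \<open>o\<close> stay bounded.\<close>

lemma holonomy_ge_1:
  assumes M: "a \<in> M" "b \<in> M" "c \<in> M" "o' \<in> M" and fixed: "s c (s b (s a o')) = o'"
  shows "\<mu> a o' * \<mu> b (s a o') * \<mu> c (s b (s a o')) \<ge> 1"
proof (rule ccontr)
  define \<nu> where "\<nu> = \<mu> a o' * \<mu> b (s a o') * \<mu> c (s b (s a o'))"
  assume "\<not> \<mu> a o' * \<mu> b (s a o') * \<mu> c (s b (s a o')) \<ge> 1"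
  then have \<nu>1: "\<nu> < 1" by (simp add: \<nu>_def)
  have \<nu>0: "\<nu> > 0" unfolding \<nu>_def using M s_in \<mu>_pos by simp
  define g where "g = (\<lambda>x. s c (s b (s a x)))"
  define G where "G = (\<lambda>X. S c (S b (S a X)))"
  have gM: "g x \<in> M" if "x \<in> M" for x unfolding g_def using that M s_in by simp
  have gd: "d o' (g x) = d o' x" if "x \<in> M" for x
  proof -
    have "d (g o') (g x) = d o' x" unfolding g_def using that M s_in s_isometry by simp
    then show ?thesis using fixed unfolding g_def by simp
  qed
  have linG: "linear G"
  proof -
    have "linear (S c \<circ> (S b \<circ> S a))" using M linear_S by (intro linear_compose) auto
    then show ?thesis unfolding G_def o_def .
  qed
  have Gh: "G (h x) = (\<mu> a x * \<mu> b (s a x) * \<mu> c (s b (s a x))) *\<^sub>R h (g x)" if "x \<in> M" for x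
    unfolding G_def g_def using that M s_in
    by (simp add: S_h linear_cmul[OF linear_S] mult_ac)
  have iter: "\<exists>w>0. (G ^^ k) (h x) = w *\<^sub>R h ((g ^^ k) x) \<and> (g ^^ k) x \<in> M \<and> d o' ((g ^^ k) x) = d o' x"
    if "x \<in> M" for k x
  proof (induction k)
    case 0 then show ?case using that by (intro exI[of _ 1]) simp
  next
    case (Suc k)
    then obtain w where w: "w > 0" "(G ^^ k) (h x) = w *\<^sub>R h ((g ^^ k) x)" "(g ^^ k) x \<in> M"
      "d o' ((g ^^ k) x) = d o' x" by blast
    define y where "y = (g ^^ k) x"
    have "\<mu> a y * \<mu> b (s a y) * \<mu> c (s b (s a y)) > 0" using w(3) M s_in \<mu>_pos y_def by simp
    then show ?case using w Gh[OF w(3)] gM[OF w(3)] gd[OF w(3)] linear_cmul[OF linG]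
      by (intro exI[of _ "w * (\<mu> a y * \<mu> b (s a y) * \<mu> c (s b (s a y)))"]) (simp add: y_def)
  qed
  have linGk: "linear (G ^^ k)" for k
  proof (induction k)
    case 0 then show ?case by (simp add: linear_id[unfolded id_def] id_def)
  next
    case (Suc k) then show ?case using linear_compose[OF Suc linG] by (simp add: o_def)
  qed
  have Gko: "(G ^^ k) (h o') = \<nu> ^ k *\<^sub>R h o'" for k
  proof (induction k)
    case (Suc k)
    have "G (h o') = \<nu> *\<^sub>R h o'" using Gh[OF M(4)] fixed unfolding \<nu>_def g_def by simp
    then show ?case using Suc linear_cmul[OF linG] by simp
  qed simp
  obtain \<delta> R where \<delta>: "\<delta> > 0" "\<And>x. x \<in> M \<Longrightarrow> d o' x < \<delta> \<Longrightarrow> norm (x - o') \<le> R"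
    using small_ball_bounded[OF M(4)] by blast
  have "continuous_on M (\<lambda>x. (\<lambda>(x, y). d x y) (o', x))"
    by (rule continuous_on_compose2[OF cont_d]) (use M in \<open>auto intro!: continuous_intros\<close>)
  then have "open (M \<inter> d o' -` {..<\<delta>})"
    using continuous_on_open_vimage[OF open_M, of "d o'"] by (simp add: Int_commute)
  moreover have "o' \<in> M \<inter> d o' -` {..<\<delta>}" using M \<delta> by simp
  ultimately obtain r where r: "r > 0" "cball o' r \<subseteq> M \<inter> d o' -` {..<\<delta>}"
    using open_contains_cball by blast
  \<comment> \<open>The 2 comes from the weights \<open>w + w' = 2 * \<nu> ^ k\<close> below; the
    bracket bounds the norm of \<open>h ((g ^^ k) x)\<close>.\<close>
  define C where "C = 2 * (1 + norm o' + R)"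
  have norm_h: "norm (h x) \<le> 1 + norm x" for x
  proof -
    have "(norm (h x))\<^sup>2 = 1 + (norm x)\<^sup>2"
      unfolding norm_vec_def L2_set_def
      by (simp add: sum_nonneg UNIV_option_conv sum.reindex)
    also have "\<dots> \<le> (1 + norm x)\<^sup>2" by (simp add: power2_eq_square algebra_simps)
    finally show ?thesis by (rule power2_le_imp_le) simp
  qed
  have bound: "norm ((G ^^ k) (h x)) \<le> C * \<nu> ^ k" if x: "x \<in> cball o' r" for x k
  proof -
    \<comment> \<open>The Euclidean mirror image of \<open>x\<close> in \<open>o'\<close>. The lifts
      of both points add up to twice \<open>h o'\<close>, whose iterates are known, and positivity
      of the two weights bounds each of them.\<close>
    define x' where "x' = 2 *\<^sub>R o' - x"
    have "x' - o' = - (x - o')" unfolding x'_def by (simp add: scaleR_2)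
    then have x': "x' \<in> cball o' r" using x by (metis dist_norm mem_cball norm_minus_cancel dist_commute)
    have xM: "x \<in> M" "x' \<in> M" "d o' x < \<delta>" using x x' r by auto
    obtain w where w: "w > 0" "(G ^^ k) (h x) = w *\<^sub>R h ((g ^^ k) x)" "(g ^^ k) x \<in> M"
      "d o' ((g ^^ k) x) = d o' x" using iter[OF xM(1)] by blast
    obtain w' where w': "w' > 0" "(G ^^ k) (h x') = w' *\<^sub>R h ((g ^^ k) x')" using iter[OF xM(2)] by blast
    have "h x + h x' = 2 *\<^sub>R h o'"
      by (rule vec_option_eqI) (simp_all add: x'_def)
    then have "(G ^^ k) (h x) + (G ^^ k) (h x') = 2 *\<^sub>R (\<nu> ^ k *\<^sub>R h o')"
      by (metis Gko linear_add[OF linGk] linear_cmul[OF linGk])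
    then have "(w *\<^sub>R h ((g ^^ k) x) + w' *\<^sub>R h ((g ^^ k) x')) $ None = (2 *\<^sub>R (\<nu> ^ k *\<^sub>R h o')) $ None"
      unfolding w w' by simp
    then have "w \<le> 2 * \<nu> ^ k" using w' by simp
    moreover have "norm (h ((g ^^ k) x)) \<le> 1 + norm o' + R"
    proof -
      have "norm ((g ^^ k) x - o') \<le> R" using \<delta>(2) w xM by simp
      then show ?thesis using norm_h[of "(g ^^ k) x"] norm_triangle_sub[of "(g ^^ k) x" o'] by simp
    qed
    ultimately have "w * norm (h ((g ^^ k) x)) \<le> (2 * \<nu> ^ k) * (1 + norm o' + R)"
      using w(1) \<nu>0 by (intro mult_mono) auto
    then show ?thesis unfolding w(2) C_def using w(1) by (simp add: algebra_simps)
  qed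
  \<comment> \<open>A vector with zero first coordinate is a multiple of a difference of lifts of
    points near \<open>o'\<close>.\<close>
  have bound0: "\<exists>B. \<forall>k. norm ((G ^^ k) Y) \<le> B * \<nu> ^ k" if Y: "Y $ None = 0" for Y
  proof -
    define y where "y = (\<chi> j. Y $ Some j)"
    define t where "t = r / (norm y + 1)"
    have t: "t > 0" "t * norm y \<le> r" unfolding t_def using r by (simp_all add: add_nonneg_pos divide_simps)
    have "h (o' + t *\<^sub>R y) - h o' = t *\<^sub>R Y"
      by (rule vec_option_eqI) (simp_all add: Y y_def)
    then have e: "Y = (1/t) *\<^sub>R (h (o' + t *\<^sub>R y) - h o')" using t by simp
    have "norm ((G ^^ k) Y) \<le> (2 * C / t) * \<nu> ^ k" for k
    proof -
      have le: "norm ((G ^^ k) (h (o' + t *\<^sub>R y)) - (G ^^ k) (h o')) \<le> C * \<nu> ^ k + C * \<nu> ^ k"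
        by (rule norm_triangle_le_diff[OF add_mono[OF bound bound]]) (use t r in \<open>auto simp: dist_norm\<close>)
      have "(G ^^ k) Y = (1/t) *\<^sub>R ((G ^^ k) (h (o' + t *\<^sub>R y)) - (G ^^ k) (h o'))"
        by (subst e) (simp only: linear_cmul[OF linGk] linear_diff[OF linGk])
      then have "norm ((G ^^ k) Y) = norm ((G ^^ k) (h (o' + t *\<^sub>R y)) - (G ^^ k) (h o')) / t"
        using t by (simp only: norm_scaleR) simp
      also have "\<dots> \<le> (C * \<nu> ^ k + C * \<nu> ^ k) / t" using le t by (intro divide_right_mono) auto
      finally show ?thesis by (simp add: field_simps)
    qed
    then show ?thesis by blast
  qed
  have bounded: "\<exists>B. \<forall>k. norm ((G ^^ k) X) \<le> B * \<nu> ^ k" for X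
  proof -
    define Y where "Y = X - X $ None *\<^sub>R h o'"
    obtain B where B: "\<And>k. norm ((G ^^ k) Y) \<le> B * \<nu> ^ k" using bound0[of Y] unfolding Y_def by auto
    have "norm ((G ^^ k) X) \<le> (\<bar>X $ None\<bar> * norm (h o') + B) * \<nu> ^ k" for k
    proof -
      have "(G ^^ k) X = X $ None *\<^sub>R (\<nu> ^ k *\<^sub>R h o') + (G ^^ k) Y"
        unfolding Y_def linear_diff[OF linGk] linear_cmul[OF linGk] Gko by simp
      then have "norm ((G ^^ k) X) \<le> norm (X $ None *\<^sub>R (\<nu> ^ k *\<^sub>R h o')) + norm ((G ^^ k) Y)"
        by (metis norm_triangle_ineq)
      also have "\<dots> \<le> \<bar>X $ None\<bar> * norm (h o') * \<nu> ^ k + B * \<nu> ^ k"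
        using B \<nu>0 by (intro add_mono) (auto simp: abs_mult mult_ac)
      finally show ?thesis by (simp add: algebra_simps)
    qed
    then show ?thesis by blast
  qed
  \<comment> \<open>All entries tend to 0 and so does the determinant, although its modulus is 1
    throughout.\<close>
  have lim: "(\<lambda>k. matrix (G ^^ k) $ i $ j) \<longlonglongrightarrow> 0" for i j
  proof -
    obtain B where B: "\<And>k. norm ((G ^^ k) (axis j 1)) \<le> B * \<nu> ^ k" using bounded by blast
    have "(\<lambda>k. B * \<nu> ^ k) \<longlonglongrightarrow> B * 0" using \<nu>0 \<nu>1 by (intro tendsto_intros LIMSEQ_power_zero) simp
    then have 0: "(\<lambda>k. B * \<nu> ^ k) \<longlonglongrightarrow> 0" by simp
    have "norm (matrix (G ^^ k) $ i $ j) \<le> B * \<nu> ^ k" for k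
      using order_trans[OF component_le_norm_cart B] unfolding matrix_def by simp
    then show ?thesis by (intro Lim_null_comparison[OF always_eventually 0]) blast
  qed
  have "(\<lambda>k. det (matrix (G ^^ k))) \<longlonglongrightarrow>
      (\<Sum>p | p permutes (UNIV :: 'n option set). of_int (sign p) * (\<Prod>i\<in>(UNIV :: 'n option set). 0))"
    unfolding det_def by (intro tendsto_sum tendsto_mult tendsto_const tendsto_prod lim)
  then have "(\<lambda>k. det (matrix (G ^^ k))) \<longlonglongrightarrow> 0" by (simp add: power_0_left)
  then have "(\<lambda>k. \<bar>det (matrix (G ^^ k))\<bar>) \<longlonglongrightarrow> 0" by (rule tendsto_rabs_zero)
  moreover have "\<bar>det (matrix (G ^^ k))\<bar> = 1" for k
  proof (induction k)
    case 0 then show ?case by (simp add: matrix_id_mat_1[unfolded id_def] id_def)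
  next
    case (Suc k)
    have "G = S c \<circ> (S b \<circ> S a)" unfolding G_def by auto
    then have "matrix G = matrix (S c) ** (matrix (S b) ** matrix (S a))"
      using M linear_S by (simp add: matrix_compose linear_compose)
    then have "\<bar>det (matrix G)\<bar> = 1" using abs_det_S M by (simp add: det_mul abs_mult)
    moreover have e: "matrix (G ^^ Suc k) = matrix G ** matrix (G ^^ k)"
      using matrix_compose[OF linGk linG] by simp
    ultimately show ?case unfolding e det_mul abs_mult using Suc by simp
  qed
  ultimately have "(\<lambda>k::nat. 1::real) \<longlonglongrightarrow> 0" by simp
  then show False by (simp add: LIMSEQ_const_iff)
qed

text \<open>Running through the loop backwards inverts every factor, so the lower bound applies to
  the product and to its inverse.\<close>

lemma holonomy_eq_1:
  assumes M: "a \<in> M" "b \<in> M" "c \<in> M" "p \<in> M" and fixed: "s c (s b (s a p)) = p"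
  shows "\<mu> a p * \<mu> b (s a p) * \<mu> c (s b (s a p)) = 1"
proof -
  define q r where "q = s a p" and "r = s b q"
  have qr: "q \<in> M" "r \<in> M" unfolding q_def r_def using M s_in by auto
  have rc: "s c p = r" using fixed s_involution[of c r] M qr unfolding r_def q_def by simp
  have qb: "s b r = q" unfolding r_def using s_involution M qr by simp
  have pa: "s a q = p" unfolding q_def using s_involution M by simp
  have "\<mu> a p * \<mu> b q * \<mu> c r \<ge> 1"
    using holonomy_ge_1[OF M fixed] unfolding q_def r_def .
  moreover have "\<mu> c p * \<mu> b r * \<mu> a q \<ge> 1"
    using holonomy_ge_1[OF M(3,2,1,4)] unfolding rc qb pa by simp
  moreover have "\<mu> c p = 1 / \<mu> c r" using \<mu>_s[OF M(3) qr(2)] rc s_involution M by metis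
  moreover have "\<mu> b r = 1 / \<mu> b q" unfolding r_def by (rule \<mu>_s) (use M qr in auto)
  moreover have "\<mu> a q = 1 / \<mu> a p" unfolding q_def by (rule \<mu>_s) (use M in auto)
  ultimately have "\<mu> a p * \<mu> b q * \<mu> c r \<ge> 1" "1 / (\<mu> a p * \<mu> b q * \<mu> c r) \<ge> 1" by (simp_all add: mult_ac)
  then have "\<mu> a p * \<mu> b q * \<mu> c r = 1" by (simp add: le_divide_eq_1)
  then show ?thesis unfolding q_def r_def .
qed

text \<open>The value at \<open>x\<close> is the factor of a reflection that carries
  \<open>p\<close> to \<open>x\<close>, made 1 at \<open>p\<close> by dividing by \<open>c\<close>.
  Going from \<open>p\<close> to \<open>x\<close>, on to \<open>s q x\<close> and back to
  \<open>p\<close> takes three reflections and closes a loop, so the factors multiply to 1; this is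
  the required law.\<close>

lemma exists_density:
  assumes p: "p \<in> M"
  shows "\<exists>f. f p = 1 \<and> (\<forall>x\<in>M. f x > 0) \<and> (\<forall>q\<in>M. \<forall>x\<in>M. f (s q x) = \<mu> q x * f x)"
proof -
  obtain m where m: "\<And>x. x \<in> M \<Longrightarrow> m x \<in> M \<and> s (m x) p = x"
    using exists_s_midpoint[OF p] by metis
  define c where "c = \<mu> (m p) p"
  have c: "c > 0" unfolding c_def using m p \<mu>_pos by blast
  define f where "f x = \<mu> (m x) p / c" for x
  have fpos: "f x > 0" if "x \<in> M" for x unfolding f_def using that m p \<mu>_pos c by simp
  have "f p = 1" unfolding f_def using c c_def by simp
  moreover have "f (s q x) = \<mu> q x * f x" if q: "q \<in> M" and x: "x \<in> M" for q x
  proof -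
    have y: "s q x \<in> M" using s_in q x by simp
    note mx = m[OF x] and my = m[OF y]
    have "s (m (s q x)) (s q (s (m x) p)) = p"
      using mx my s_involution p by metis
    then have "\<mu> (m x) p * \<mu> q (s (m x) p) * \<mu> (m (s q x)) (s q (s (m x) p)) = 1"
      using holonomy_eq_1 mx my q p by blast
    moreover have "s (m x) p = x" using mx by simp
    moreover have "\<mu> (m (s q x)) (s q x) = 1 / \<mu> (m (s q x)) p"
      using \<mu>_s[of "m (s q x)" p] my p by simp
    ultimately have "\<mu> (m x) p * \<mu> q x * (1 / \<mu> (m (s q x)) p) = 1" by metis
    moreover have "\<mu> (m (s q x)) p > 0" using my p \<mu>_pos by blast
    ultimately show ?thesis unfolding f_def by (simp add: field_simps)
  qed
  ultimately show ?thesis using fpos by blast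
qed

end

text \<open>A reflection is arbitrary outside \<open>M\<close>. Replacing it by its formula changes
  nothing that the definition sees, and a choice for each \<open>p\<close> gives
  \<open>K\<close>.\<close>

lemma (in projective_metric) exists_symmetric_domain:
  assumes "DIM('a) \<ge> 2" "centers M d = M"
  shows "\<exists>K. \<forall>p\<in>M. linear (K p) \<and> (\<forall>x\<in>M. 1 + K p (x - p) > 0) \<and>
      metric_point_reflection M d p (\<lambda>x. p - (1 / (1 + K p (x - p))) *\<^sub>R (x - p))"
proof -
  have "\<exists>K. linear K \<and> (\<forall>x\<in>M. 1 + K (x - p) > 0) \<and>
      metric_point_reflection M d p (\<lambda>x. p - (1 / (1 + K (x - p))) *\<^sub>R (x - p))" if p: "p \<in> M" for p
  proof -
    obtain \<phi> where \<phi>: "metric_point_reflection M d p \<phi>" using assms(2) p unfolding centers_def by blast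
    obtain K where K: "linear K" "\<And>x. x \<in> M \<Longrightarrow> 1 + K (x - p) > 0"
      "\<And>x. x \<in> M \<Longrightarrow> \<phi> x = p - (1 / (1 + K (x - p))) *\<^sub>R (x - p)"
      using reflection_formula[OF assms(1) \<phi> p] by blast
    define \<psi> where "\<psi> x = p - (1 / (1 + K (x - p))) *\<^sub>R (x - p)" for x
    have eq: "\<psi> x = \<phi> x" if "x \<in> M" for x using K(3)[OF that] \<psi>_def by simp
    note F = metric_point_reflectionD[OF \<phi>]
    have FM: "\<phi> x \<in> M" if "x \<in> M" for x using F(1) that by (metis imageI)
    have "\<psi> ` L = \<phi> ` L" if "L \<subseteq> M" for L using eq that by (intro image_cong) auto
    moreover have "L \<subseteq> M" if "geodesic_line M d L" for L using that unfolding geodesic_line_def by blast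
    ultimately have "metric_point_reflection M d p \<psi>"
      unfolding metric_point_reflection_def using F p
      by (intro conjI) (simp_all add: eq FM)
    then show ?thesis using K(1,2) unfolding \<psi>_def[abs_def] by blast
  qed
  then show ?thesis by metis
qed

section \<open>The invariant kernel and its quadratic form\<close>

text \<open>Positivity excludes the cosine solutions: where \<open>u < 1\<close>, each doubling of
  the argument at least doubles \<open>1 - u\<close>, which cannot go on. Then \<open>c\<close> is
  fixed by \<open>u 1\<close>, and the identity spreads by halving, integer multiples and
  continuity.\<close>

lemma dalembert_cosh:
  fixes u :: "real \<Rightarrow> real"
  assumes cont: "continuous_on UNIV u" and u0: "u 0 = 1" and pos: "\<And>t. u t > 0"
    and eq: "\<And>a t. u (a + t) + u (a - t) = 2 * u a * u t"
  shows "\<exists>c\<ge>0. \<forall>t. u t = cosh (c * t)"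
proof -
  have even: "u (- t) = u t" for t using eq[of 0 t] u0 by simp
  have double: "u (2 * t) = 2 * (u t)\<^sup>2 - 1" for t
    using eq[of t t] u0 by (simp add: power2_eq_square)
  have ge1: "u t \<ge> 1" for t
  proof (rule ccontr)
    assume "\<not> u t \<ge> 1"
    then have lt: "1 - u t > 0" by simp
    have grow: "1 - u (2 ^ k * t) \<ge> 2 ^ k * (1 - u t)" for k
    proof (induction k)
      case (Suc k)
      define y where "y = u (2 ^ k * t)"
      have y: "0 < y" "y < 1"
      proof -
        have "0 < 2 ^ k * (1 - u t)" using lt by simp
        then show "0 < y" "y < 1" using Suc pos unfolding y_def by auto
      qed
      have "1 - u (2 ^ Suc k * t) = 2 * (1 - y) * (1 + y)"
        using double[of "2 ^ k * t"] unfolding y_def by (simp add: algebra_simps power2_eq_square)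
      also have "\<dots> \<ge> 2 * (1 - y) * 1" using y by (intro mult_left_mono) auto
      finally show ?case using Suc unfolding y_def by simp
    qed simp
    obtain k where "1 / (1 - u t) < 2 ^ k" using real_arch_pow[of 2 "1 / (1 - u t)"] by auto
    then have "1 < 2 ^ k * (1 - u t)" using lt by (simp add: field_simps)
    then show False using grow[of k] pos[of "2 ^ k * t"] by linarith
  qed
  define c where "c = arcosh (u 1)"
  have c0: "c \<ge> 0" unfolding c_def using ge1 by simp
  have half: "u (1 / 2 ^ k) = cosh (c * (1 / 2 ^ k))" for k
  proof (induction k)
    case 0 then show ?case unfolding c_def using ge1 by simp
  next
    case (Suc k)
    have "2 * (u (1 / 2 ^ Suc k))\<^sup>2 - 1 = cosh (2 * (c * (1 / 2 ^ Suc k)))"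
      using double[of "1 / 2 ^ Suc k"] Suc by simp
    also have "\<dots> = 2 * (cosh (c * (1 / 2 ^ Suc k)))\<^sup>2 - 1" by (rule cosh_double_cosh)
    finally have "(u (1 / 2 ^ Suc k))\<^sup>2 = (cosh (c * (1 / 2 ^ Suc k)))\<^sup>2" by simp
    then show ?case using pos[of "1 / 2 ^ Suc k"] cosh_real_nonneg by (metis less_imp_le power2_eq_imp_eq)
  qed
  \<comment> \<open>Two consecutive multiples are carried along because the recurrence is of second
    order.\<close>
  have mult: "u (real m * s) = cosh (c * (real m * s)) \<and> u (real (Suc m) * s) = cosh (c * (real (Suc m) * s))"
    if s: "u s = cosh (c * s)" for m s
  proof (induction m)
    case 0 then show ?case using s u0 by simp
  next
    case (Suc m)
    define a where "a = real (Suc m) * s"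
    have a: "a + s = real (Suc (Suc m)) * s" "a - s = real m * s" unfolding a_def by (simp_all add: algebra_simps)
    have ua: "u a = cosh (c * a)" using Suc unfolding a_def by blast
    have um: "u (a - s) = cosh (c * (a - s))" using Suc unfolding a(2) by blast
    have "u (a + s) = 2 * u a * u s - u (a - s)" using eq[of a s] by simp
    also have "\<dots> = 2 * cosh (c * a) * cosh (c * s) - cosh (c * (a - s))" unfolding ua um s ..
    also have "\<dots> = cosh (c * (a + s))"
      using cosh_add[of "c * a" "c * s"] cosh_diff[of "c * a" "c * s"] by (simp add: algebra_simps)
    finally have "u (real (Suc (Suc m)) * s) = cosh (c * (real (Suc (Suc m)) * s))" unfolding a(1) .
    then show ?case using Suc by blast
  qed
  have nonneg: "u t = cosh (c * t)" if "t \<ge> 0" for t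
  proof -
    \<comment> \<open>Dyadic approximation of \<open>t\<close> from below.\<close>
    define x where "x k = real (nat \<lfloor>t * 2 ^ k\<rfloor>) * (1 / 2 ^ k)" for k :: nat
    have ux: "u (x k) = cosh (c * x k)" for k unfolding x_def using mult[OF half] by blast
    have "\<bar>x k - t\<bar> \<le> (1 / 2) ^ k" for k
    proof -
      have n: "real (nat \<lfloor>t * 2 ^ k\<rfloor>) = of_int \<lfloor>t * 2 ^ k\<rfloor>" using that by simp
      have "\<bar>real (nat \<lfloor>t * 2 ^ k\<rfloor>) - t * 2 ^ k\<bar> \<le> 1" unfolding n by linarith
      then have "\<bar>real (nat \<lfloor>t * 2 ^ k\<rfloor>) - t * 2 ^ k\<bar> / 2 ^ k \<le> 1 / 2 ^ k" by (simp add: divide_right_mono)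
      moreover have "x k - t = (real (nat \<lfloor>t * 2 ^ k\<rfloor>) - t * 2 ^ k) / 2 ^ k" unfolding x_def by (simp add: field_simps)
      ultimately show ?thesis by (simp add: power_one_over)
    qed
    then have "(\<lambda>k. x k - t) \<longlonglongrightarrow> 0"
      by (intro Lim_null_comparison[OF always_eventually LIMSEQ_power_zero[of "1/2::real"]]) auto
    then have x: "x \<longlonglongrightarrow> t" by (simp add: LIM_zero_iff)
    have "(\<lambda>k. u (x k)) \<longlonglongrightarrow> u t"
      using cont x by (metis UNIV_I continuous_on_eq_continuous_at isCont_tendsto_compose open_UNIV)
    moreover have "(\<lambda>k. cosh (c * x k)) \<longlonglongrightarrow> cosh (c * t)" by (intro tendsto_intros x)
    ultimately show ?thesis using LIMSEQ_unique unfolding ux by blast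
  qed
  have "u t = cosh (c * t)" for t
    using nonneg[of t] nonneg[of "- t"] even[of t] by (cases "t \<ge> 0") auto
  then show ?thesis using c0 by blast
qed

lemma closed_segment_on_line:
  fixes p v :: "'a::real_vector"
  assumes "x \<le> u \<and> u \<le> y \<or> y \<le> u \<and> u \<le> (x::real)"
  shows "p + u *\<^sub>R v \<in> closed_segment (p + x *\<^sub>R v) (p + y *\<^sub>R v)"
proof -
  have "u \<in> closed_segment x y" using assms by (auto simp: closed_segment_eq_real_ivl)
  then obtain t where t: "u = (1 - t) * x + t * y" "0 \<le> t" "t \<le> 1" unfolding in_segment by auto
  have "p + u *\<^sub>R v = (1 - t) *\<^sub>R (p + x *\<^sub>R v) + t *\<^sub>R (p + y *\<^sub>R v)"
    unfolding t(1) by (simp add: algebra_simps)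
  then show ?thesis unfolding in_segment using t by blast
qed

locale based_domain = symmetric_domain M d K
  for M :: "(real ^ 'n) set" and d :: "real ^ 'n \<Rightarrow> real ^ 'n \<Rightarrow> real" and K +
  fixes b :: "real ^ 'n" and f :: "real ^ 'n \<Rightarrow> real"
  assumes b: "b \<in> M" and f_b: "f b = 1" and f_pos: "x \<in> M \<Longrightarrow> f x > 0"
    and f_s: "q \<in> M \<Longrightarrow> x \<in> M \<Longrightarrow> f (s q x) = \<mu> q x * f x"
begin

text \<open>The scaled lifts \<open>f q *\<^sub>R h q\<close> are permuted by the reflections, and
  \<open>S p\<close> takes the lift of \<open>q\<close> to \<open>2 * H p q\<close> times the lift
  of \<open>p\<close> minus the lift of \<open>q\<close>. Comparison with a reflection of the
  hyperboloid shows that \<open>H\<close> plays the role of the Lorentz product.\<close>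

definition H :: "real ^ 'n \<Rightarrow> real ^ 'n \<Rightarrow> real" where
  "H p q = f q * (1 + \<mu> p q) / (2 * f p)"

lemma H_self: "p \<in> M \<Longrightarrow> H p p = 1"
  unfolding H_def using \<mu>_self f_pos[of p] by simp

lemma H_pos: "p \<in> M \<Longrightarrow> q \<in> M \<Longrightarrow> H p q > 0"
  unfolding H_def using \<mu>_pos[of p q] f_pos[of p] f_pos[of q] by simp

lemma H_s:
  assumes "m \<in> M" "p \<in> M" "q \<in> M"
  shows "H (s m p) (s m q) = H p q"
proof -
  note pos = \<mu>_pos[OF assms(1,2)] \<mu>_pos[OF assms(1,3)] f_pos[OF assms(2)] f_pos[OF assms(3)]
  have "1 + \<mu> (s m p) (s m q) = \<mu> m p * (1 + \<mu> p q) / \<mu> m q"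
    using \<mu>_equivariant[OF assms] pos by (simp add: field_simps)
  then show ?thesis unfolding H_def using pos f_s assms by (simp add: field_simps)
qed

text \<open>The reflection in a midpoint exchanges \<open>p\<close> and \<open>q\<close> and leaves
  \<open>H\<close> unchanged.\<close>

lemma H_sym: assumes "p \<in> M" "q \<in> M" shows "H p q = H q p"
proof -
  obtain m where "m \<in> M" "s m p = q" using exists_s_midpoint[OF assms] by blast
  moreover from this have "s m q = p" using s_involution assms by blast
  ultimately show ?thesis using H_s[of m q p] assms by simp
qed

text \<open>In scaled lifts this is the linear relation between \<open>q\<close>, \<open>p\<close>
  and \<open>s p q\<close>, paired with \<open>r\<close>; in coordinates it is the affinity of
  \<open>\<mu> r\<close> along the chord through \<open>p\<close> and \<open>q\<close>.\<close>

lemma H_dalembert: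
  assumes "p \<in> M" "q \<in> M" "r \<in> M"
  shows "H (s p q) r + H q r = 2 * H p q * H p r"
proof -
  note pos = f_pos[OF assms(1)] f_pos[OF assms(3)]
  have "H (s p q) r + H q r = H r (s p q) + H r q" using H_sym s_in assms by simp
  also have "\<dots> = f q * (\<mu> p q + \<mu> p q * \<mu> r (s p q) + (1 + \<mu> r q)) / (2 * f r)"
    unfolding H_def f_s[OF assms(1,2)] by (simp add: add_divide_distrib[symmetric] algebra_simps)
  also have "\<mu> p q + \<mu> p q * \<mu> r (s p q) + (1 + \<mu> r q) = (1 + \<mu> p q) * (1 + \<mu> r p)"
    unfolding \<mu>_at_s[OF assms(1,3,2)] by (simp add: algebra_simps)
  also have "f q * ((1 + \<mu> p q) * (1 + \<mu> r p)) / (2 * f r) = 2 * H p q * H r p"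
    unfolding H_def using pos by (simp add: field_simps)
  finally show ?thesis using H_sym assms by simp
qed

text \<open>Dropping a positive term leaves a substitute for the triangle inequality, as in
  \<open>cosh (a + b) \<le> 2 * cosh a * cosh b\<close>. It compares values of \<open>H\<close>
  while the constants of different chords are still unrelated.\<close>

lemma H_triangle: "p \<in> M \<Longrightarrow> q \<in> M \<Longrightarrow> r \<in> M \<Longrightarrow> H q r \<le> 2 * H p q * H p r"
  using H_dalembert[of p q r] H_pos[of "s p q" r] s_in by simp

text \<open>The same product on the unscaled lifts \<open>h p\<close> and \<open>h q\<close>, so
  that it is affine in \<open>q\<close>.\<close>

definition \<beta> :: "real ^ 'n \<Rightarrow> real ^ 'n \<Rightarrow> real" where "\<beta> p q = (1 + \<mu> p q) / (2 * (f p)\<^sup>2)"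

lemma H_eq_\<beta>: "p \<in> M \<Longrightarrow> H p q = f p * f q * \<beta> p q"
  unfolding H_def \<beta>_def using f_pos[of p] by (simp add: power2_eq_square)

lemma \<beta>_sym: assumes "p \<in> M" "q \<in> M" shows "\<beta> p q = \<beta> q p"
  using H_sym[OF assms] assms f_pos[OF assms(1)] f_pos[OF assms(2)] by (simp add: H_eq_\<beta>)

lemma \<beta>_self: "p \<in> M \<Longrightarrow> \<beta> p p = 1 / (f p)\<^sup>2"
  unfolding \<beta>_def using \<mu>_self by simp

text \<open>The product with the lift of \<open>b\<close>. It vanishes on the polar of
  \<open>b\<close>, which the ball model will send to infinity.\<close>

definition B :: "real ^ 'n \<Rightarrow> real" where "B x = 1 + K b x / 2"

lemma \<beta>_base: "\<beta> b q = B (q - b)"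
  unfolding \<beta>_def B_def \<mu>_def f_b by simp

lemma B_pos: "q \<in> M \<Longrightarrow> B (q - b) > 0"
  unfolding \<beta>_base[symmetric] \<beta>_def using f_b \<mu>_pos[OF b] by (simp add: add_pos_pos)

text \<open>\<open>\<beta>\<close> is symmetric and affine in its second argument, hence biaffine; \<open>Q\<close> is minus its
  restriction to the polar of \<open>b\<close>.\<close>

lemma exists_form:
  "\<exists>Q. bilinear Q \<and> (\<forall>x y. Q x y = Q y x) \<and>
    (\<forall>p\<in>M. \<forall>q\<in>M. \<beta> p q = B (p - b) * B (q - b) - Q (p - b) (q - b))"
proof -
  define D where "D p v = K p v / (2 * (f p)\<^sup>2)" for p v
  have linD: "linear (D p)" if "p \<in> M" for p
    unfolding D_def using linear_K[OF that]
    by (intro linearI) (simp_all add: linear_add linear_cmul add_divide_distrib)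
  have \<beta>D: "\<beta> p q = \<beta> p r + D p (q - r)" if "p \<in> M" for p q r
  proof -
    have "K p (q - p) = K p (r - p) + K p (q - r)"
      using linear_add[OF linear_K[OF that], of "r - p" "q - r"] by simp
    then show ?thesis unfolding \<beta>_def D_def \<mu>_def by (simp add: add_divide_distrib)
  qed
  obtain t where t: "\<And>v. t v > 0" "\<And>v. b + t v *\<^sub>R v \<in> M"
    using open_scaled_in[OF open_M b] by (metis abs_of_pos order_refl)
  \<comment> \<open>The change of the linear part \<open>D\<close> from \<open>b\<close> to a point
    in direction \<open>v\<close>, per unit step. Symmetry of \<open>\<beta>\<close> exchanges the
    two arguments, so linearity in one slot yields it in the other.\<close>
  define C where "C x v = (D (b + t v *\<^sub>R v) x - D b x) / t v" for x v
  have lin1: "linear (\<lambda>x. C x v)" for v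
    unfolding C_def using linD[OF t(2)] linD[OF b]
    by (intro linearI) (simp_all add: linear_add linear_cmul divide_simps algebra_simps)
  have CD: "C (p - b) v = D p v - D b v" if p: "p \<in> M" for p v
  proof -
    define y where "y = b + t v *\<^sub>R v"
    have y: "y \<in> M" using t y_def by simp
    have 1: "\<beta> y p = \<beta> y b + D y (p - b)" "\<beta> b p = \<beta> b b + D b (p - b)"
      "\<beta> p y = \<beta> p b + D p (y - b)" "\<beta> b y = \<beta> b b + D b (y - b)"
      using \<beta>D y p b by blast+
    have 2: "\<beta> y p = \<beta> p y" "\<beta> y b = \<beta> b y" "\<beta> p b = \<beta> b p" using \<beta>_sym y p b by blast+
    have "D p (y - b) = t v * D p v" "D b (y - b) = t v * D b v"
      unfolding y_def using linear_cmul[OF linD] p b by simp_all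
    then have "D y (p - b) - D b (p - b) = t v * (D p v - D b v)"
      using 1 2 by (simp add: algebra_simps)
    then show ?thesis unfolding C_def y_def[symmetric] using t(1)[of v] by simp
  qed
  have C: "C x v = (D (b + t x *\<^sub>R x) v - D b v) / t x" for x v
    using CD[OF t(2)[of x], of v] linear_cmul[OF lin1, of "t x" x] t(1)[of x] by (simp add: field_simps)
  have lin2: "linear (C x)" for x
    unfolding C[abs_def] using linD[OF t(2)] linD[OF b]
    by (intro linearI) (simp_all add: linear_add linear_cmul divide_simps algebra_simps)
  have form: "\<beta> p q = 1 + K b (p - b) / 2 + K b (q - b) / 2 + C (p - b) (q - b)" if "p \<in> M" "q \<in> M" for p q
  proof -
    have "\<beta> p q = \<beta> p b + D p (q - b)" using \<beta>D that by blast
    also have "\<beta> p b = 1 + K b (p - b) / 2" using \<beta>_sym[OF that(1) b] \<beta>_base B_def by simp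
    also have "D p (q - b) = D b (q - b) + C (p - b) (q - b)" using CD[OF that(1)] by simp
    also have "D b (q - b) = K b (q - b) / 2" unfolding D_def f_b by simp
    finally show ?thesis by simp
  qed
  have symC: "C x y = C y x" for x y
  proof -
    have "C (t x *\<^sub>R x) (t y *\<^sub>R y) = C (t y *\<^sub>R y) (t x *\<^sub>R x)"
      using form[OF t(2) t(2), of x y] form[OF t(2) t(2), of y x] \<beta>_sym[OF t(2) t(2), of x y] by simp
    then have "t x * (t y * C x y) = t y * (t x * C y x)"
      using linear_cmul[OF lin1] linear_cmul[OF lin2] by auto
    then show ?thesis using t(1)[of x] t(1)[of y] by simp
  qed
  \<comment> \<open>The product \<open>B x * B y\<close> contains the additional term
    \<open>K b x * K b y / 4\<close>, which is compensated here.\<close>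
  define Q where "Q x y = K b x * K b y / 4 - C x y" for x y
  have "bilinear Q"
    unfolding bilinear_def Q_def using linear_K[OF b] lin1 lin2
    by (auto intro!: linearI simp: linear_add linear_cmul algebra_simps add_divide_distrib
        linear_add[OF lin1] linear_cmul[OF lin1])
  moreover have "\<forall>x y. Q x y = Q y x" unfolding Q_def using symC by (simp add: mult.commute)
  moreover have "\<forall>p\<in>M. \<forall>q\<in>M. \<beta> p q = B (p - b) * B (q - b) - Q (p - b) (q - b)"
  proof (intro ballI)
    fix p q assume "p \<in> M" "q \<in> M"
    then show "\<beta> p q = B (p - b) * B (q - b) - Q (p - b) (q - b)"
      unfolding form[OF \<open>p \<in> M\<close> \<open>q \<in> M\<close>] Q_def B_def by (simp add: field_simps)
  qed
  ultimately show ?thesis by blast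
qed

end

text \<open>Along the multiples of \<open>t\<close> the values form an arithmetic progression, so a
  decrease would lead below 0. Neither \<open>t\<close> nor \<open>- t\<close> can lower the value,
  and the two values average to the one at 0.\<close>

lemma positive_midpoint_affine_const:
  fixes \<phi> :: "real \<Rightarrow> real"
  assumes pos: "\<And>t. \<phi> t > 0" and mid: "\<And>a t. \<phi> (a + t) + \<phi> (a - t) = 2 * \<phi> a"
  shows "\<phi> t = \<phi> 0"
proof -
  have ge: "\<phi> t \<ge> \<phi> 0" for t
  proof (rule ccontr)
    assume "\<not> \<phi> t \<ge> \<phi> 0"
    then have lt: "\<phi> 0 - \<phi> t > 0" by simp
    have step: "\<phi> (real n * t) = \<phi> 0 - real n * (\<phi> 0 - \<phi> t) \<and>
        \<phi> (real (Suc n) * t) = \<phi> 0 - real (Suc n) * (\<phi> 0 - \<phi> t)" for n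
    proof (induction n)
      case (Suc n)
      have "\<phi> (real (Suc n) * t + t) + \<phi> (real (Suc n) * t - t) = 2 * \<phi> (real (Suc n) * t)" by (rule mid)
      moreover have "real (Suc n) * t + t = real (Suc (Suc n)) * t" "real (Suc n) * t - t = real n * t"
        by (simp_all add: algebra_simps)
      ultimately show ?case using Suc by (simp add: algebra_simps)
    qed simp
    obtain n where "\<phi> 0 < real n * (\<phi> 0 - \<phi> t)" using ex_less_of_nat_mult[OF lt] by blast
    then show False using step[of n] pos[of "real n * t"] by simp
  qed
  have "\<phi> (0 + t) + \<phi> (0 - t) = 2 * \<phi> 0" by (rule mid)
  then show ?thesis using ge[of t] ge[of "- t"] by simp
qed

section \<open>Chord constants and definiteness of the form\<close>

locale form_domain = based_domain M d K b f
  for M :: "(real ^ 'n) set" and d :: "real ^ 'n \<Rightarrow> real ^ 'n \<Rightarrow> real" and K b f +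
  fixes Q :: "real ^ 'n \<Rightarrow> real ^ 'n \<Rightarrow> real"
  assumes bilinear_Q: "bilinear Q" and Q_sym: "Q x y = Q y x"
    and \<beta>_Q: "p \<in> M \<Longrightarrow> q \<in> M \<Longrightarrow> \<beta> p q = B (p - b) * B (q - b) - Q (p - b) (q - b)"
begin

lemmas Q_add_left = bilinear_ladd[OF bilinear_Q] and Q_add_right = bilinear_radd[OF bilinear_Q]
  and Q_scale_left = bilinear_lmul[OF bilinear_Q] and Q_scale_right = bilinear_rmul[OF bilinear_Q]

lemma H_formula: "p \<in> M \<Longrightarrow> q \<in> M \<Longrightarrow> H p q = f p * f q * (B (p - b) * B (q - b) - Q (p - b) (q - b))"
  using H_eq_\<beta> \<beta>_Q by simp

lemma f_square: "p \<in> M \<Longrightarrow> 1 / (f p)\<^sup>2 = (B (p - b))\<^sup>2 - Q (p - b) (p - b)"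
  using \<beta>_self \<beta>_Q[of p p] by (simp add: power2_eq_square)

lemma f_formula: assumes "p \<in> M" shows "f p = 1 / sqrt ((B (p - b))\<^sup>2 - Q (p - b) (p - b))"
  unfolding f_square[OF assms, symmetric] using f_pos[OF assms] by (simp add: real_sqrt_divide)

text \<open>The density came from chosen midpoints, with no control on continuity. Expressing it
  through the form makes it continuous, as the functional equation on chords requires.\<close>

lemma continuous_on_H: assumes "p \<in> M" shows "continuous_on M (H p)"
proof -
  have contB: "continuous_on M (\<lambda>x. B (x - b))"
    unfolding B_def by (intro continuous_intros continuous_on_compose2[OF linear_continuous_on[OF linear_conv_bounded_linear[THEN iffD1, OF linear_K[OF b]], of UNIV]]) auto
  have contQ: "continuous_on M (\<lambda>x. Q (x - b) (x - b))"
    by (rule bounded_bilinear.continuous_on[OF bilinear_conv_bounded_bilinear[THEN iffD1, OF bilinear_Q]])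
      (intro continuous_intros)+
  have "continuous_on M f"
  proof (rule continuous_on_eq)
    have "(B (x - b))\<^sup>2 - Q (x - b) (x - b) > 0" if "x \<in> M" for x
      unfolding f_square[OF that, symmetric] using f_pos[OF that] by simp
    then show "continuous_on M (\<lambda>x. 1 / sqrt ((B (x - b))\<^sup>2 - Q (x - b) (x - b)))"
      by (intro continuous_intros contB contQ) (auto simp: less_imp_neq[symmetric])
  qed (simp add: f_formula)
  moreover have "continuous_on M (\<mu> p)"
    unfolding \<mu>_def[abs_def] by (intro continuous_intros continuous_on_compose2[OF linear_continuous_on[OF linear_conv_bounded_linear[THEN iffD1, OF linear_K[OF assms]], of UNIV]]) auto
  ultimately show ?thesis unfolding H_def[abs_def] using f_pos[OF assms]
    by (intro continuous_intros) auto
qed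

text \<open>The reflection at a point with parameter \<open>a\<close> acts on the chord as
  \<open>t \<mapsto> 2 * a - t\<close>. Invariance therefore makes \<open>H\<close> a function of
  the difference of parameters, and its reflection identity becomes d'Alembert's equation.\<close>

lemma chord_cosh:
  assumes p: "p \<in> M" and v: "v \<noteq> 0"
  shows "\<exists>\<sigma> c. strict_mono \<sigma> \<and> \<sigma> 0 = 0 \<and> range \<sigma> = {u. p + u *\<^sub>R v \<in> M} \<and>
    (\<forall>r t. d (p + \<sigma> r *\<^sub>R v) (p + \<sigma> t *\<^sub>R v) = \<bar>r - t\<bar>) \<and>
    (\<forall>a t. s (p + \<sigma> a *\<^sub>R v) (p + \<sigma> t *\<^sub>R v) = p + \<sigma> (2 * a - t) *\<^sub>R v) \<and>
    c \<ge> 0 \<and> (\<forall>r t. H (p + \<sigma> r *\<^sub>R v) (p + \<sigma> t *\<^sub>R v) = cosh (c * (r - t)))"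
proof -
  obtain \<sigma> :: "real \<Rightarrow> real" where \<sigma>: "strict_mono \<sigma>" "continuous_on UNIV \<sigma>" "\<sigma> 0 = 0"
    "range \<sigma> = {u. p + u *\<^sub>R v \<in> M}" "\<And>r t. d (p + \<sigma> r *\<^sub>R v) (p + \<sigma> t *\<^sub>R v) = \<bar>r - t\<bar>"
    using chord_param[OF assms] by blast
  define \<gamma> where "\<gamma> t = p + \<sigma> t *\<^sub>R v" for t
  have \<gamma>M: "\<gamma> t \<in> M" for t using \<sigma>(4) unfolding \<gamma>_def by blast
  have s\<gamma>: "s (\<gamma> a) (\<gamma> t) = \<gamma> (2 * a - t)" for a t
  proof (rule s_unique[symmetric, OF \<gamma>M \<gamma>M \<gamma>M])
    have "t \<le> a \<or> a \<le> t" by linarith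
    then have "\<sigma> t \<le> \<sigma> a \<and> \<sigma> a \<le> \<sigma> (2 * a - t) \<or> \<sigma> (2 * a - t) \<le> \<sigma> a \<and> \<sigma> a \<le> \<sigma> t"
      by (auto simp: strict_mono_less_eq[OF \<sigma>(1)])
    then show "\<gamma> a \<in> closed_segment (\<gamma> t) (\<gamma> (2 * a - t))"
      unfolding \<gamma>_def by (rule closed_segment_on_line)
    show "d (\<gamma> a) (\<gamma> (2 * a - t)) = d (\<gamma> a) (\<gamma> t)" unfolding \<gamma>_def \<sigma>(5) by simp
  qed
  define u where "u t = H (\<gamma> 0) (\<gamma> t)" for t
  have even: "u (- t) = u t" for t
    using H_s[OF \<gamma>M \<gamma>M \<gamma>M, of 0 0 t] unfolding u_def s\<gamma> by simp
  \<comment> \<open>The reflection at \<open>\<gamma> (a/2)\<close> takes the parameters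
    \<open>a\<close> and \<open>t\<close> to 0 and \<open>a - t\<close>.\<close>
  have Hu: "H (\<gamma> a) (\<gamma> t) = u (a - t)" for a t
    using H_s[OF \<gamma>M \<gamma>M \<gamma>M, of "a/2" a t] unfolding u_def s\<gamma> by simp
  have "u (a + t) + u (a - t) = 2 * u a * u t" for a t
  proof -
    have "H (s (\<gamma> a) (\<gamma> (a - t))) (\<gamma> 0) + H (\<gamma> (a - t)) (\<gamma> 0) = 2 * H (\<gamma> a) (\<gamma> (a - t)) * H (\<gamma> a) (\<gamma> 0)"
      by (rule H_dalembert) (rule \<gamma>M)+
    then show ?thesis unfolding s\<gamma> Hu by (simp add: mult_ac)
  qed
  moreover have "continuous_on UNIV u"
    unfolding u_def
  proof (rule continuous_on_compose2[OF continuous_on_H[OF \<gamma>M]])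
    show "continuous_on UNIV \<gamma>" unfolding \<gamma>_def[abs_def] by (intro continuous_intros \<sigma>(2))
  qed (use \<gamma>M in auto)
  moreover have "u 0 = 1" unfolding u_def using H_self \<gamma>M by simp
  moreover have "u t > 0" for t unfolding u_def using H_pos \<gamma>M by simp
  ultimately obtain c where "c \<ge> 0" "\<And>t. u t = cosh (c * t)" using dalembert_cosh[of u] by blast
  then have "c \<ge> 0" "\<And>r t. H (\<gamma> r) (\<gamma> t) = cosh (c * (r - t))" using Hu by auto
  then show ?thesis using \<sigma> s\<gamma> unfolding \<gamma>_def by blast
qed

lemma H_ge_1: assumes "p \<in> M" "q \<in> M" shows "H p q \<ge> 1"
proof (cases "p = q")
  case True then show ?thesis using H_self assms by simp
next
  case False
  then have v: "q - p \<noteq> 0" by simp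
  obtain \<sigma> c where \<sigma>: "\<sigma> 0 = 0" "range \<sigma> = {u. p + u *\<^sub>R (q - p) \<in> M}"
    "\<And>r t. H (p + \<sigma> r *\<^sub>R (q - p)) (p + \<sigma> t *\<^sub>R (q - p)) = cosh (c * (r - t))"
    using chord_cosh[OF assms(1) v] by blast
  have "1 \<in> range \<sigma>" using \<sigma>(2) assms by simp
  then obtain t where t: "\<sigma> t = 1" by fastforce
  have "H p q = cosh (c * (0 - t))" using \<sigma>(3)[of 0 t] t \<sigma>(1) by simp
  then show ?thesis using cosh_real_ge_1[of "c * (0 - t)"] by simp
qed

lemma small_scale: "\<exists>t>0. b + t *\<^sub>R v \<in> M"
  using open_scaled_in[OF open_M b] by (metis abs_of_pos order_refl)

lemma H_base: "q \<in> M \<Longrightarrow> H b q = f q * B (q - b)"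
  using H_eq_\<beta>[OF b] \<beta>_base f_b by simp

text \<open>Divided out, \<open>Q / B\<^sup>2 = 1 - 1 / H\<^sup>2\<close>: in the ball model the
  squared radius is the squared hyperbolic tangent of the distance from the origin.\<close>

lemma H_base_square: assumes "q \<in> M" shows "(B (q - b))\<^sup>2 * ((H b q)\<^sup>2 - 1) = (H b q)\<^sup>2 * Q (q - b) (q - b)"
proof -
  have "1 = (f q)\<^sup>2 * ((B (q - b))\<^sup>2 - Q (q - b) (q - b))"
    unfolding f_square[OF assms, symmetric] using f_pos[OF assms] by simp
  then have "(f q)\<^sup>2 * Q (q - b) (q - b) = (H b q)\<^sup>2 - 1"
    unfolding H_base[OF assms] by (simp add: power_mult_distrib algebra_simps)
  then have "(B (q - b))\<^sup>2 * ((f q)\<^sup>2 * Q (q - b) (q - b)) = (B (q - b))\<^sup>2 * ((H b q)\<^sup>2 - 1)" by simp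
  then show ?thesis unfolding H_base[OF assms] power_mult_distrib by algebra
qed

lemma Q_nonneg: "Q v v \<ge> 0"
proof -
  obtain t where t: "t > 0" "b + t *\<^sub>R v \<in> M" using small_scale by blast
  have "(H b (b + t *\<^sub>R v))\<^sup>2 - 1 \<ge> 0" using H_ge_1[OF b t(2)] by simp
  then have "(H b (b + t *\<^sub>R v))\<^sup>2 * Q (t *\<^sub>R v) (t *\<^sub>R v) \<ge> 0" using H_base_square[OF t(2)] by (metis add_diff_cancel_left' zero_le_mult_iff zero_le_power2)
  moreover have "(H b (b + t *\<^sub>R v))\<^sup>2 > 0" using H_pos[OF b t(2)] by simp
  ultimately have "Q (t *\<^sub>R v) (t *\<^sub>R v) \<ge> 0" by (simp add: zero_le_mult_iff)
  then show ?thesis using t(1) by (simp add: Q_scale_left Q_scale_right zero_le_mult_iff)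
qed

text \<open>A null vector of a semidefinite form lies in its kernel: otherwise \<open>Q\<close> on
  the vectors \<open>w + t v\<close> would be affine and nonconstant in \<open>t\<close>, hence
  somewhere negative.\<close>

lemma Q_null: assumes "Q v v = 0" shows "Q v w = 0"
proof (rule ccontr)
  assume nz: "Q v w \<noteq> 0"
  have "0 \<le> Q (w + t *\<^sub>R v) (w + t *\<^sub>R v)" for t by (rule Q_nonneg)
  moreover have "Q (w + t *\<^sub>R v) (w + t *\<^sub>R v) = Q w w + 2 * t * Q v w" for t
    using assms Q_sym[of w v] by (simp add: Q_add_left Q_add_right Q_scale_left Q_scale_right)
  ultimately have "0 \<le> Q w w + 2 * (- (Q w w + 1) / (2 * Q v w)) * Q v w" by metis
  moreover have "2 * (- (Q w w + 1) / (2 * Q v w)) * Q v w = - (Q w w + 1)" using nz by (simp add: field_simps)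
  ultimately show False by linarith
qed

text \<open>Along a null direction \<open>H\<close> is constantly 1. Then \<open>f\<close> is
  midpoint-affine in the arc length of the chord, hence constant, so all factors are 1 and the
  reflections on the chord are Euclidean. Equal steps in arc length become equal Euclidean steps,
  and the chord is a full line.\<close>

lemma null_line:
  assumes v: "v \<noteq> 0" "Q v v = 0"
  shows "K b v = 0 \<and> b + u *\<^sub>R v \<in> M"
proof -
  obtain \<sigma> c where \<sigma>: "strict_mono \<sigma>" "\<sigma> 0 = 0" "range \<sigma> = {u. b + u *\<^sub>R v \<in> M}"
    "\<And>a t. s (b + \<sigma> a *\<^sub>R v) (b + \<sigma> t *\<^sub>R v) = b + \<sigma> (2 * a - t) *\<^sub>R v"
    "c \<ge> 0" "\<And>r t. H (b + \<sigma> r *\<^sub>R v) (b + \<sigma> t *\<^sub>R v) = cosh (c * (r - t))"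
    using chord_cosh[OF b v(1)] by blast
  define \<gamma> where "\<gamma> t = b + \<sigma> t *\<^sub>R v" for t
  have \<gamma>M: "\<gamma> t \<in> M" for t using \<sigma>(3) unfolding \<gamma>_def by blast
  have Hb: "H b (\<gamma> t) = 1" for t
  proof -
    have "Q (\<gamma> t - b) (\<gamma> t - b) = 0" unfolding \<gamma>_def using v(2) by (simp add: Q_scale_left Q_scale_right)
    then have "(B (\<gamma> t - b))\<^sup>2 * ((H b (\<gamma> t))\<^sup>2 - 1) = 0" using H_base_square[OF \<gamma>M, of t] by simp
    then have "(H b (\<gamma> t))\<^sup>2 = 1" using B_pos[OF \<gamma>M, of t] by simp
    then show ?thesis using H_pos[OF b \<gamma>M, of t] by (simp add: power2_eq_1_iff)
  qed
  have "cosh (c * (0 - 1)) = 1" using Hb[of 1] \<sigma>(6)[of 0 1] \<sigma>(2) unfolding \<gamma>_def by simp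
  then have "c = 0" by simp
  then have H1: "H (\<gamma> r) (\<gamma> t) = 1" for r t using \<sigma>(6) unfolding \<gamma>_def by simp
  have mid: "f (\<gamma> (a + t)) + f (\<gamma> (a - t)) = 2 * f (\<gamma> a)" for a t
  proof -
    have "\<gamma> (a + t) = s (\<gamma> a) (\<gamma> (a - t))" unfolding \<gamma>_def \<sigma>(4) by (simp add: algebra_simps)
    then have "f (\<gamma> (a + t)) = \<mu> (\<gamma> a) (\<gamma> (a - t)) * f (\<gamma> (a - t))" using f_s \<gamma>M by simp
    moreover have "f (\<gamma> (a - t)) * (1 + \<mu> (\<gamma> a) (\<gamma> (a - t))) = 2 * f (\<gamma> a)"
      using H1[of a "a - t"] f_pos[OF \<gamma>M, of a] unfolding H_def by (simp add: field_simps)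
    ultimately show ?thesis by (simp add: algebra_simps)
  qed
  have f1: "f (\<gamma> t) = 1" for t
  proof -
    have "f (\<gamma> t) = f (\<gamma> 0)"
      using positive_midpoint_affine_const[of "\<lambda>t. f (\<gamma> t)"] f_pos[OF \<gamma>M] mid by blast
    then show ?thesis using \<sigma>(2) f_b unfolding \<gamma>_def by simp
  qed
  have \<sigma>1: "\<sigma> 1 > 0" using strict_mono_less[OF \<sigma>(1), of 0 1] \<sigma>(2) by simp
  have "B (\<sigma> 1 *\<^sub>R v) = 1" using Hb[of 1] f1[of 1] H_base[OF \<gamma>M, of 1] unfolding \<gamma>_def by simp
  then have "\<sigma> 1 * K b v = 0" unfolding B_def using linear_cmul[OF linear_K[OF b]] by simp
  then have Kv: "K b v = 0" using \<sigma>1 by simp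
  have \<mu>1: "\<mu> (\<gamma> a) (\<gamma> t) = 1" for a t
    using H1[of a t] f1 unfolding H_def by simp
  have "\<sigma> (2 * a - t) = 2 * \<sigma> a - \<sigma> t" for a t
  proof -
    have "\<gamma> (2 * a - t) = \<gamma> a - (\<gamma> t - \<gamma> a)" using \<sigma>(4)[of a t] \<mu>1[of a t] unfolding s_def \<gamma>_def by simp
    then have "\<sigma> (2 * a - t) *\<^sub>R v = \<sigma> a *\<^sub>R v - (\<sigma> t *\<^sub>R v - \<sigma> a *\<^sub>R v)"
      unfolding \<gamma>_def by (simp add: algebra_simps)
    also have "\<dots> = (\<sigma> a - (\<sigma> t - \<sigma> a)) *\<^sub>R v" by (simp only: scaleR_diff_left)
    finally show ?thesis using v by simp
  qed
  note \<sigma>_refl = this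
  have "\<sigma> (real n) = real n * \<sigma> 1 \<and> \<sigma> (real (Suc n)) = real (Suc n) * \<sigma> 1" for n
  proof (induction n)
    case (Suc n)
    have "\<sigma> (2 * real (Suc n) - real n) = 2 * \<sigma> (real (Suc n)) - \<sigma> (real n)" by (rule \<sigma>_refl)
    moreover have "2 * real (Suc n) - real n = real (Suc (Suc n))" by simp
    ultimately show ?case using Suc by (simp add: algebra_simps)
  qed (simp add: \<sigma>(2))
  then have \<sigma>n: "\<sigma> (real n) = real n * \<sigma> 1" for n by blast
  have \<sigma>neg: "\<sigma> (- t) = - \<sigma> t" for t using \<sigma>_refl[of 0 t] \<sigma>(2) by simp
  obtain n where n: "\<bar>u\<bar> < real n * \<sigma> 1" using ex_less_of_nat_mult[OF \<sigma>1] by blast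
  have "b + u *\<^sub>R v \<in> closed_segment (\<gamma> (- real n)) (\<gamma> (real n))"
    unfolding \<gamma>_def by (rule closed_segment_on_line) (use n \<sigma>n \<sigma>neg in auto)
  then have "b + u *\<^sub>R v \<in> M" using \<gamma>M convex_M by (meson convex_contains_segment subsetD)
  then show ?thesis using Kv by blast
qed

text \<open>A null direction \<open>v\<close> would make the maps \<open>x \<mapsto> x + (1 + \<mu> q x) u v\<close> isometries; combining two of
  them fixes \<open>b\<close> while moving any \<open>q\<close> with \<open>H b q \<noteq> 1\<close> arbitrarily far.\<close>

lemma Q_pos:
  assumes v: "v \<noteq> 0"
  shows "Q v v > 0"
proof (rule ccontr)
  assume "\<not> Q v v > 0"
  then have Qv: "Q v v = 0" using Q_nonneg[of v] by simp
  note Kv = conjunct1[OF null_line[OF v Qv]] and line = conjunct2[OF null_line[OF v Qv]]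
  \<comment> \<open>By convexity: \<open>q + u v\<close> lies between a point slightly beyond
    \<open>q\<close>, seen from \<open>b\<close>, and a point of the full line through
    \<open>b\<close> with direction \<open>v\<close>.\<close>
  have inM: "q + u *\<^sub>R v \<in> M" if q: "q \<in> M" for q u
  proof -
    obtain e where e: "e > 0" and q': "q + e *\<^sub>R (q - b) \<in> M"
      using open_scaled_in[OF open_M q] by (metis abs_of_pos order_refl)
    define t where "t = e / (1 + e)"
    have t: "0 \<le> t" "t \<le> 1" "1 - t = 1 / (1 + e)" "t * ((1 + e) / e) = 1" proof -
      have ne: "1 + e \<noteq> 0" using e by simp
      show "0 \<le> t" "t \<le> 1" unfolding t_def using e by simp_all
      show "1 - t = 1 / (1 + e)" unfolding t_def using ne by (simp add: field_simps)
      show "t * ((1 + e) / e) = 1" unfolding t_def using e ne by simp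
    qed
    have "(1 - t) *\<^sub>R (q + e *\<^sub>R (q - b)) + t *\<^sub>R (b + ((1 + e) / e * u) *\<^sub>R v) \<in> M"
      using q' line[of "(1 + e) / e * u"] convex_M t unfolding convex_alt by blast
    moreover have "(1 - t) *\<^sub>R (q + e *\<^sub>R (q - b)) + t *\<^sub>R (b + ((1 + e) / e * u) *\<^sub>R v) = q + u *\<^sub>R v"
    proof -
      have "(1 - t) * e = 1 / (1 + e) * e" by (simp only: t(3))
      also have "\<dots> = t" by (simp add: t_def)
      finally have "(1 - t) * e = t" .
      moreover have "(1 - t) *\<^sub>R (q + e *\<^sub>R (q - b)) + t *\<^sub>R (b + ((1 + e) / e * u) *\<^sub>R v)
        = (1 - t) *\<^sub>R q + ((1 - t) * e) *\<^sub>R (q - b) + t *\<^sub>R b + (t * ((1 + e) / e) * u) *\<^sub>R v"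
        by (simp only: scaleR_add_right scaleR_scaleR mult.assoc add.assoc)
      ultimately have "(1 - t) *\<^sub>R (q + e *\<^sub>R (q - b)) + t *\<^sub>R (b + ((1 + e) / e * u) *\<^sub>R v)
        = (1 - t) *\<^sub>R q + t *\<^sub>R (q - b) + t *\<^sub>R b + (1 * u) *\<^sub>R v" unfolding t(4) by simp
      also have "\<dots> = q + u *\<^sub>R v" by (simp add: algebra_simps)
      finally show ?thesis .
    qed
    ultimately show ?thesis by simp
  qed
  \<comment> \<open>\<open>v\<close> is in the kernel of both \<open>Q\<close> and
    \<open>K b\<close>, so the form does not see a shift by \<open>v\<close>.\<close>
  have \<beta>_shift: "\<beta> (q + u *\<^sub>R v) r = \<beta> q r" if "q \<in> M" "r \<in> M" for q r u
  proof -
    have e: "q + u *\<^sub>R v - b = (q - b) + u *\<^sub>R v" by simp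
    have "B (q + u *\<^sub>R v - b) = B (q - b)"
      unfolding e B_def using Kv linear_add[OF linear_K[OF b]] linear_cmul[OF linear_K[OF b]] by simp
    moreover have "Q (q + u *\<^sub>R v - b) (r - b) = Q (q - b) (r - b)"
      unfolding e Q_add_left Q_scale_left using Q_null[OF Qv] by simp
    ultimately show ?thesis using \<beta>_Q inM that by simp
  qed
  have f_shift: "f (q + u *\<^sub>R v) = f q" if "q \<in> M" for q u
  proof -
    have "\<beta> (q + u *\<^sub>R v) (q + u *\<^sub>R v) = \<beta> q q"
      using \<beta>_shift[OF that inM[OF that]] \<beta>_sym[OF that inM[OF that]] \<beta>_shift[OF that that] by simp
    then have "(f (q + u *\<^sub>R v))\<^sup>2 = (f q)\<^sup>2" using \<beta>_self that inM by simp
    then show ?thesis using f_pos[OF that] f_pos[OF inM[OF that]] by (simp add: power2_eq_iff_nonneg less_imp_le)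
  qed
  have \<mu>_\<beta>: "\<mu> q r = 2 * (f q)\<^sup>2 * \<beta> q r - 1" if "q \<in> M" for q r
    unfolding \<beta>_def using f_pos[OF that] by simp
  have \<mu>_shift1: "\<mu> (q + u *\<^sub>R v) r = \<mu> q r" if "q \<in> M" "r \<in> M" for q r u
    using \<mu>_\<beta>[OF that(1)] \<mu>_\<beta>[OF inM[OF that(1)]] \<beta>_shift f_shift that by simp
  have \<mu>_shift2: "\<mu> q (r + u *\<^sub>R v) = \<mu> q r" if "q \<in> M" "r \<in> M" for q r u
    using \<mu>_\<beta>[OF that(1)] \<beta>_sym[OF that(1) inM[OF that(2)]] \<beta>_sym[OF that] \<beta>_shift that by simp
  have shear: "s (q + u *\<^sub>R v) (s q x) = x + ((1 + \<mu> q x) * u) *\<^sub>R v" if "q \<in> M" "x \<in> M" for q u x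
  proof -
    note pos = \<mu>_pos[OF that]
    define m where "m = \<mu> q x"
    have m: "\<mu> (q + u *\<^sub>R v) (s q x) = 1 / m"
      using \<mu>_shift1[OF that(1) s_in[OF that]] \<mu>_s[OF that] m_def by simp
    have "(1 / m) *\<^sub>R s (q + u *\<^sub>R v) (s q x) = (1 + 1 / m) *\<^sub>R (q + u *\<^sub>R v) - s q x"
      using s_relation[OF inM[OF that(1)] s_in[OF that], of u] unfolding m .
    then have "m *\<^sub>R ((1 / m) *\<^sub>R s (q + u *\<^sub>R v) (s q x)) = m *\<^sub>R ((1 + 1 / m) *\<^sub>R (q + u *\<^sub>R v) - s q x)"
      by (simp only:)
    moreover have "m * (1 + 1 / m) = m + 1" using pos m_def by (simp add: field_simps)
    ultimately have "s (q + u *\<^sub>R v) (s q x) = (m + 1) *\<^sub>R (q + u *\<^sub>R v) - m *\<^sub>R s q x"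
      using pos m_def by (simp add: scaleR_diff_right)
    also have "m *\<^sub>R s q x = (1 + m) *\<^sub>R q - x" unfolding m_def by (rule s_relation[OF that])
    finally show ?thesis unfolding m_def[symmetric] by (simp add: algebra_simps)
  qed
  have shear_iso: "d (x + ((1 + \<mu> q x) * u) *\<^sub>R v) (y + ((1 + \<mu> q y) * u) *\<^sub>R v) = d x y"
    if "q \<in> M" "x \<in> M" "y \<in> M" for q u x y
    using shear[OF that(1,2), of u] shear[OF that(1,3), of u] s_isometry inM s_in that by metis
  have H1: "H b q = 1" if q: "q \<in> M" for q
  proof (rule ccontr)
    assume "H b q \<noteq> 1"
    then have H: "1 - (H b q)\<^sup>2 \<noteq> 0" using H_ge_1[OF b q] by (simp add: power2_eq_1_iff)
    have dist: "d q (q + (2 * u * (1 - (H b q)\<^sup>2)) *\<^sub>R v) \<le> 2 * d b q" for u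
    proof -
      \<comment> \<open>Chosen so that the second shear, taken at \<open>b\<close> with factor
        \<open>1 + 1\<close>, brings \<open>b1\<close> back to \<open>b\<close>. The displacement of
        \<open>q\<close> that remains is proportional to \<open>1 - (H b q)\<^sup>2\<close>.\<close>
      define w where "w = - (1 + \<mu> q b) * u / 2"
      define b1 q1 where "b1 = b + ((1 + \<mu> q b) * u) *\<^sub>R v" and "q1 = q + ((1 + \<mu> q q) * u) *\<^sub>R v"
      have M1: "b1 \<in> M" "q1 \<in> M" unfolding b1_def q1_def using inM b q by auto
      have "d b1 q1 = d b q" unfolding b1_def q1_def using shear_iso q b by blast
      moreover have "d (b1 + ((1 + \<mu> b b1) * w) *\<^sub>R v) (q1 + ((1 + \<mu> b q1) * w) *\<^sub>R v) = d b1 q1"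
        using shear_iso b M1 by blast
      moreover have "b1 + ((1 + \<mu> b b1) * w) *\<^sub>R v = b"
      proof -
        have "\<mu> b b1 = 1" unfolding b1_def using \<mu>_shift2 \<mu>_self b by simp
        then have "b1 + ((1 + \<mu> b b1) * w) *\<^sub>R v = b + ((1 + \<mu> q b) * u + 2 * w) *\<^sub>R v"
          unfolding b1_def by (simp add: scaleR_add_left)
        also have "(1 + \<mu> q b) * u + 2 * w = 0" unfolding w_def by (simp add: field_simps)
        finally show ?thesis by simp
      qed
      moreover have "q1 + ((1 + \<mu> b q1) * w) *\<^sub>R v = q + (2 * u * (1 - (H b q)\<^sup>2)) *\<^sub>R v"
      proof -
        have "\<mu> b q1 = \<mu> b q" unfolding q1_def using \<mu>_shift2 b q by simp
        then have "q1 + ((1 + \<mu> b q1) * w) *\<^sub>R v = q + (2 * u + (1 + \<mu> b q) * w) *\<^sub>R v"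
          unfolding q1_def using \<mu>_self q by (simp add: scaleR_add_left)
        moreover have "(H b q)\<^sup>2 = H b q * H q b" using H_sym b q by (simp add: power2_eq_square)
        moreover have "H b q * H q b = (1 + \<mu> b q) * (1 + \<mu> q b) / 4"
          unfolding H_def f_b using f_pos[OF q] by (simp add: field_simps)
        ultimately have "q1 + ((1 + \<mu> b q1) * w) *\<^sub>R v = q + (2 * u + (1 + \<mu> b q) * w) *\<^sub>R v"
          and "(H b q)\<^sup>2 = (1 + \<mu> b q) * (1 + \<mu> q b) / 4" by simp_all
        moreover from this(2) have "2 * u + (1 + \<mu> b q) * w = 2 * u * (1 - (H b q)\<^sup>2)"
          unfolding w_def by (simp add: field_simps)
        ultimately show ?thesis by simp
      qed
      ultimately have "d b (q + (2 * u * (1 - (H b q)\<^sup>2)) *\<^sub>R v) = d b q" by simp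
      then show ?thesis using triangle[of q b "q + (2 * u * (1 - (H b q)\<^sup>2)) *\<^sub>R v"] inM b q commute[of q b] by simp
    qed
    obtain \<sigma> :: "real \<Rightarrow> real" where \<sigma>: "\<sigma> 0 = 0"
      "\<And>r t. d (q + \<sigma> r *\<^sub>R v) (q + \<sigma> t *\<^sub>R v) = \<bar>r - t\<bar>" using chord_param[OF q v] by blast
    define r where "r = 2 * d b q + 1"
    have "r \<le> d q (q + \<sigma> r *\<^sub>R v)" using \<sigma>(2)[of 0 r] \<sigma>(1) by simp
    moreover have "2 * (x / (2 * D)) * D = x" if "D \<noteq> 0" for x D :: real using that by simp
    then have "d q (q + \<sigma> r *\<^sub>R v) \<le> 2 * d b q"
      using dist[of "\<sigma> r / (2 * (1 - (H b q)\<^sup>2))"] H by metis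
    ultimately have "r \<le> 2 * d b q" by simp
    then show False unfolding r_def by simp
  qed
  \<comment> \<open>Now every direction is null, so all full lines through \<open>b\<close> lie in
    \<open>M\<close>.\<close>
  have "x \<in> M" for x
  proof (cases "x = b")
    case False
    obtain t where t: "t > 0" "b + t *\<^sub>R (x - b) \<in> M" using small_scale by blast
    have "Q (t *\<^sub>R (x - b)) (t *\<^sub>R (x - b)) = 0" using H_base_square[OF t(2)] H1[OF t(2)] by simp
    then have "Q (x - b) (x - b) = 0" using t(1) by (simp add: Q_scale_left Q_scale_right)
    then show ?thesis using null_line[of "x - b" 1] False by simp
  qed (use b in simp)
  then show False using M_ne_UNIV by auto
qed

text \<open>After a midpoint reflection moves \<open>p\<close> to \<open>b\<close>, the value 1 says
  that the difference vector is null.\<close>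

lemma H_eq_1_imp_eq:
  assumes "p \<in> M" "q \<in> M" "H p q = 1"
  shows "p = q"
proof -
  obtain m where m: "m \<in> M" "s m p = b" using exists_s_midpoint[OF assms(1) b] by blast
  have q': "s m q \<in> M" using s_in m assms by blast
  have "H b (s m q) = 1" using H_s[OF m(1) assms(1,2)] m assms(3) by simp
  then have "Q (s m q - b) (s m q - b) = 0" using H_base_square[OF q'] by simp
  then have "s m q = b" using Q_pos[of "s m q - b"] by fastforce
  then show ?thesis using s_inj m assms by metis
qed

end

section \<open>The ball model\<close>

text \<open>Gram-Schmidt with respect to \<open>Q\<close>: \<open>R E v\<close> is the part of
  \<open>v\<close> orthogonal to \<open>E\<close>, and \<open>A\<close> takes coordinates in a
  \<open>Q\<close>-orthonormal basis.\<close>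

lemma exists_orthonormalization:
  fixes Q :: "real ^ 'n \<Rightarrow> real ^ 'n \<Rightarrow> real"
  assumes bil: "bilinear Q" and sym: "\<And>x y. Q x y = Q y x" and pos: "\<And>x. x \<noteq> 0 \<Longrightarrow> Q x x > 0"
  shows "\<exists>A :: real ^ 'n \<Rightarrow> real ^ 'n. linear A \<and> bij A \<and> (\<forall>x y. Q x y = A x \<bullet> A y)"
proof -
  note Qr = bilinear_rsub[OF bil] bilinear_rmul[OF bil] bilinear_rzero[OF bil]
  note Ql = bilinear_lsub[OF bil] bilinear_lmul[OF bil] bilinear_lzero[OF bil]
  have linr: "linear (Q x)" and linl: "linear (\<lambda>x. Q x y)" for x y using bil unfolding bilinear_def by auto
  define ON where "ON E \<longleftrightarrow> finite E \<and> (\<forall>e\<in>E. \<forall>e'\<in>E. Q e e' = (if e = e' then 1 else 0))" for E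
  define R where "R E v = v - (\<Sum>e\<in>E. Q v e *\<^sub>R e)" for E v
  have RE: "Q (R E v) e = 0" if "ON E" "e \<in> E" for E v e
  proof -
    have "Q (R E v) e = Q v e - (\<Sum>e'\<in>E. Q v e' * Q e' e)"
      unfolding R_def Ql(1) by (simp add: linear_sum[OF linl] Ql)
    also have "(\<Sum>e'\<in>E. Q v e' * Q e' e) = (\<Sum>e'\<in>E. if e' = e then Q v e else 0)"
      using that unfolding ON_def by (intro sum.cong) auto
    also have "\<dots> = Q v e" using that unfolding ON_def by simp
    finally show ?thesis by simp
  qed
  have "\<exists>E. ON E \<and> card E = k" if "k \<le> CARD('n)" for k using that
  proof (induction k)
    case 0 then show ?case by (intro exI[of _ "{}"]) (simp add: ON_def)
  next
    case (Suc k)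
    then obtain E where E: "ON E" "card E = k" by auto
    then have fin: "finite E" unfolding ON_def by simp
    have "dim (span E) \<le> k" using dim_le_card'[OF fin] E by simp
    then have "span E \<noteq> UNIV" using Suc by (metis dim_UNIV DIM_cart DIM_real mult.right_neutral not_less_eq_eq)
    then obtain v where v: "v \<notin> span E" by blast
    define w where "w = R E v"
    have "w \<noteq> 0"
    proof
      assume "w = 0"
      then have "v = (\<Sum>e\<in>E. Q v e *\<^sub>R e)" unfolding w_def R_def by simp
      then show False using v by (metis (no_types, lifting) span_base span_scale span_sum)
    qed
    then have Qw: "Q w w > 0" by (rule pos)
    define n where "n = (1 / sqrt (Q w w)) *\<^sub>R w"
    have nn: "Q n n = 1" unfolding n_def using Qw by (simp add: Qr Ql)
    have ne: "Q n e = 0" "Q e n = 0" if "e \<in> E" for e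
    proof -
      show "Q n e = 0" unfolding n_def Ql w_def using RE[OF E(1) that] by simp
      then show "Q e n = 0" using sym by simp
    qed
    have "n \<notin> E" using ne nn by force
    moreover have "ON (insert n E)" using E(1) nn ne \<open>n \<notin> E\<close> unfolding ON_def by auto
    ultimately show ?case using E fin by (intro exI[of _ "insert n E"]) simp
  qed
  then obtain E where E: "ON E" "card E = CARD('n)" by blast
  then have fin: "finite E" unfolding ON_def by simp
  have "independent E"
  proof (rule independent_if_scalars_zero[OF fin])
    fix g e assume g: "(\<Sum>x\<in>E. g x *\<^sub>R x) = 0" and e: "e \<in> E"
    have "0 = Q (\<Sum>x\<in>E. g x *\<^sub>R x) e" unfolding g using Ql by simp
    also have "\<dots> = (\<Sum>x\<in>E. g x * Q x e)" by (simp add: linear_sum[OF linl] Ql)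
    also have "\<dots> = (\<Sum>x\<in>E. if x = e then g e else 0)" using E(1) e unfolding ON_def by (intro sum.cong) auto
    also have "\<dots> = g e" using fin e by simp
    finally show "g e = 0" by simp
  qed
  then have span: "UNIV \<subseteq> span E" using E(2) by (intro card_ge_dim_independent) (auto simp: dim_UNIV)
  have R0: "R E v = 0" for v
  proof -
    have "{x. Q (R E v) x = 0} = UNIV"
    proof -
      have "subspace {x. Q (R E v) x = 0}" 
        by (simp add: subspace_def linear_0[OF linr] linear_add[OF linr] linear_cmul[OF linr])
      moreover have "E \<subseteq> {x. Q (R E v) x = 0}" using RE[OF E(1)] by blast
      ultimately have "span E \<subseteq> {x. Q (R E v) x = 0}" by (rule span_minimal[rotated])
      then show ?thesis using span by blast
    qed
    then have "Q (R E v) (R E v) = 0" by blast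
    then show ?thesis using pos[of "R E v"] by fastforce
  qed
  obtain g where g: "bij_betw g (UNIV :: 'n set) E"
    using finite_same_card_bij[of "UNIV :: 'n set" E] fin E(2) by auto
  define A where "A v = (\<chi> i. Q v (g i))" for v
  have QA: "Q x y = A x \<bullet> A y" for x y
  proof -
    have y: "y = (\<Sum>e\<in>E. Q y e *\<^sub>R e)" using R0[of y] unfolding R_def by simp
    have "Q x y = (\<Sum>e\<in>E. Q y e * Q x e)"
      by (subst (1) y) (simp add: linear_sum[OF linr] Qr)
    also have "\<dots> = (\<Sum>i\<in>UNIV. Q y (g i) * Q x (g i))" by (rule sum.reindex_bij_betw[OF g, symmetric])
    also have "\<dots> = A x \<bullet> A y" unfolding A_def inner_vec_def by (simp add: mult.commute)
    finally show ?thesis .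
  qed
  have lin: "linear A" unfolding A_def
    by (rule linearI) (simp_all add: vec_eq_iff bilinear_ladd[OF bil] Ql)
  have "inj A" unfolding linear_injective_0[OF lin]
  proof (intro allI impI)
    fix x assume "A x = 0"
    then have "Q x x = 0" using QA by simp
    then show "x = 0" using pos[of x] by fastforce
  qed
  moreover have "surj A" by (rule linear_injective_imp_surjective[OF lin \<open>inj A\<close>]) simp
  ultimately show ?thesis using lin QA unfolding bij_def by blast
qed

lemma hyp_self: "norm x < 1 \<Longrightarrow> hyp x x = 1"
proof -
  assume "norm x < 1"
  then have "x \<bullet> x < 1" by (metis norm_eq_sqrt_inner real_sqrt_lt_1_iff)
  then show ?thesis unfolding hyp_def by simp
qed

section \<open>Comparison of the chord constants\<close>

context form_domain
begin

lemma line_constant: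
  assumes p: "p \<in> M" and v: "v \<noteq> 0"
  shows "\<exists>c>0. \<forall>u w. p + u *\<^sub>R v \<in> M \<longrightarrow> p + w *\<^sub>R v \<in> M \<longrightarrow>
    H (p + u *\<^sub>R v) (p + w *\<^sub>R v) = cosh (c * d (p + u *\<^sub>R v) (p + w *\<^sub>R v))"
proof -
  obtain \<sigma> c where \<sigma>: "strict_mono \<sigma>" "\<sigma> 0 = 0" "range \<sigma> = {u. p + u *\<^sub>R v \<in> M}"
    "\<And>r t. d (p + \<sigma> r *\<^sub>R v) (p + \<sigma> t *\<^sub>R v) = \<bar>r - t\<bar>"
    "c \<ge> 0" "\<And>r t. H (p + \<sigma> r *\<^sub>R v) (p + \<sigma> t *\<^sub>R v) = cosh (c * (r - t))"
    using chord_cosh[OF p v] by blast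
  have "c \<noteq> 0"
  proof
    assume "c = 0"
    then have "H (p + \<sigma> 0 *\<^sub>R v) (p + \<sigma> 1 *\<^sub>R v) = 1" using \<sigma>(6) by simp
    moreover have "p + \<sigma> t *\<^sub>R v \<in> M" for t using \<sigma>(3) by blast
    ultimately have "p + \<sigma> 0 *\<^sub>R v = p + \<sigma> 1 *\<^sub>R v" using H_eq_1_imp_eq by blast
    then show False using v strict_mono_less[OF \<sigma>(1), of 0 1] by simp
  qed
  then have "c > 0" using \<sigma>(5) by simp
  moreover have "H (p + u *\<^sub>R v) (p + w *\<^sub>R v) = cosh (c * d (p + u *\<^sub>R v) (p + w *\<^sub>R v))"
    if "p + u *\<^sub>R v \<in> M" "p + w *\<^sub>R v \<in> M" for u w
  proof -
    have "u \<in> range \<sigma>" "w \<in> range \<sigma>" using \<sigma>(3) that by auto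
    then obtain r t where rt: "u = \<sigma> r" "w = \<sigma> t" by blast
    have "cosh (c * (r - t)) = cosh (c * \<bar>r - t\<bar>)" by (metis abs_if cosh_minus mult_minus_right)
    then show ?thesis unfolding rt \<sigma>(4) \<sigma>(6) .
  qed
  ultimately show ?thesis by blast
qed

text \<open>Every chord through \<open>b\<close> crosses a fixed compact sphere, where
  \<open>H b\<close> stays away from 1 and \<open>d b\<close> is bounded; this bounds the constants
  of these chords from below. Midpoint reflections carry the estimate to all pairs. It turns bounds
  on \<open>H\<close> into bounds on \<open>d\<close> before the constants are known to
  agree.\<close>

lemma cosh_le_H: "\<exists>c>0. \<forall>p\<in>M. \<forall>q\<in>M. cosh (c * d p q) \<le> H p q"
proof -
  obtain r where r: "r > 0" "cball b r \<subseteq> M" using open_M b open_contains_cball by blast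
  have sub: "sphere b r \<subseteq> M" using r by auto
  have ne: "sphere b r \<noteq> {}" using r by simp
  have "continuous_on (sphere b r) (\<lambda>x. (\<lambda>(x, y). d x y) (b, x))"
    by (rule continuous_on_compose2[OF cont_d]) (use b sub in \<open>auto intro!: continuous_intros\<close>)
  then have "continuous_on (sphere b r) (d b)" by simp
  then obtain y1 where y1: "y1 \<in> sphere b r" "\<And>y. y \<in> sphere b r \<Longrightarrow> d b y \<le> d b y1"
    using continuous_attains_sup[OF compact_sphere ne] by blast
  obtain y2 where y2: "y2 \<in> sphere b r" "\<And>y. y \<in> sphere b r \<Longrightarrow> H b y2 \<le> H b y"
    using continuous_attains_inf[OF compact_sphere ne continuous_on_subset[OF continuous_on_H[OF b] sub]] by blast
  define c where "c = arcosh (H b y2) / d b y1"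
  have yM: "y1 \<in> M" "y2 \<in> M" using sub y1 y2 by auto
  have yb: "y1 \<noteq> b" "y2 \<noteq> b" using y1 y2 r by auto
  have d1: "d b y1 > 0" using mdist_pos_eq[of b y1] yM yb b by auto
  have h2: "H b y2 > 1" using H_ge_1[OF b yM(2)] H_eq_1_imp_eq[OF b yM(2)] yb by fastforce
  have c: "c > 0" unfolding c_def using d1 h2 by simp
  have base: "cosh (c * d b q) \<le> H b q" if q: "q \<in> M" for q
  proof (cases "q = b")
    case True then show ?thesis using H_self b by simp
  next
    case False
    then have v: "q - b \<noteq> 0" by simp
    obtain c' where c': "c' > 0" "\<And>u w. b + u *\<^sub>R (q - b) \<in> M \<Longrightarrow> b + w *\<^sub>R (q - b) \<in> M \<Longrightarrow>
      H (b + u *\<^sub>R (q - b)) (b + w *\<^sub>R (q - b)) = cosh (c' * d (b + u *\<^sub>R (q - b)) (b + w *\<^sub>R (q - b)))"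
      using line_constant[OF b v] by blast
    define y where "y = b + (r / norm (q - b)) *\<^sub>R (q - b)"
    have y: "y \<in> sphere b r" unfolding y_def using v r by (simp add: dist_norm)
    then have yM: "y \<in> M" using sub by blast
    have "H b y = cosh (c' * d b y)" using c'(2)[of 0 "r / norm (q - b)"] yM b unfolding y_def by simp
    then have "c' * d b y = arcosh (H b y)" using c'(1) by (simp add: arcosh_cosh_real)
    moreover have "arcosh (H b y2) \<le> arcosh (H b y)"
      unfolding not_less[symmetric] using y2(2)[OF y] h2 by (subst arcosh_less_iff_real) auto
    moreover have "c' * d b y \<le> c' * d b y1" using y1(2)[OF y] c' by simp
    ultimately have "arcosh (H b y2) \<le> c' * d b y1" by simp
    then have "c \<le> c'" unfolding c_def using d1 by (simp add: divide_le_eq)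
    then have "c * d b q \<le> c' * d b q" by (simp add: mult_right_mono)
    moreover have "0 \<le> c * d b q" using c by simp
    ultimately have "cosh (c * d b q) \<le> cosh (c' * d b q)" using cosh_real_nonneg_le_iff by simp
    then show ?thesis using c'(2)[of 0 1] q b by simp
  qed
  have "cosh (c * d p q) \<le> H p q" if pq: "p \<in> M" "q \<in> M" for p q
  proof -
    obtain m where m: "m \<in> M" "s m p = b" using exists_s_midpoint[OF pq(1) b] by blast
    have "d p q = d b (s m q)" "H p q = H b (s m q)" using s_isometry H_s m pq by metis+
    then show ?thesis using base s_in m pq by simp
  qed
  then show ?thesis using c by blast
qed

text \<open>Along two asymptotic rays \<open>H\<close> and \<open>d\<close> grow at the same rate, so their constants agree.\<close>

lemma constant_le_of_asymptotic:
  fixes x y :: "real \<Rightarrow> real ^ 'n"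
  assumes M: "p \<in> M" "q \<in> M" "\<And>e. e \<in> E \<Longrightarrow> x e \<in> M" "\<And>e. e \<in> E \<Longrightarrow> y e \<in> M"
    and c: "c > 0" "c' > 0" "\<And>e. e \<in> E \<Longrightarrow> H p (x e) = cosh (c * d p (x e))"
      "\<And>e. e \<in> E \<Longrightarrow> H q (y e) = cosh (c' * d q (y e))"
    and bound: "\<And>e. e \<in> E \<Longrightarrow> H (x e) (y e) \<le> R"
    and unbounded: "\<And>N. \<exists>e\<in>E. H p (x e) > N"
  shows "c' \<le> c"
proof (rule ccontr)
  assume "\<not> c' \<le> c"
  then have cc: "c' - c > 0" by simp
  obtain c0 where c0: "c0 > 0" "\<And>p q. p \<in> M \<Longrightarrow> q \<in> M \<Longrightarrow> cosh (c0 * d p q) \<le> H p q"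
    using cosh_le_H by blast
  obtain e0 where e0: "e0 \<in> E" using unbounded by blast
  have R1: "R \<ge> 1" using bound[OF e0] H_ge_1 M(3,4)[OF e0] by fastforce
  \<comment> \<open>The difference \<open>d p (x e) - d q (y e)\<close> never exceeds
    \<open>k\<close>; the second summand bounds \<open>d (x e) (y e)\<close>.\<close>
  define k where "k = d p q + arcosh R / c0"
  define A where "A = 4 * H p q * R"
  have A: "A > 0" unfolding A_def using R1 H_pos M by simp
  \<comment> \<open>Solves \<open>c' * (N - k) = ln (2 * A) + c * N\<close>, the comparison of
    exponents obtained from two uses of \<open>H_triangle\<close>.\<close>
  define N where "N = (c' * k + ln (2 * A)) / (c' - c)"
  have le: "d p (x e) \<le> N" if e: "e \<in> E" for e
  proof -
    note xy = M(3)[OF e] M(4)[OF e]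
    have "cosh (c0 * d (x e) (y e)) \<le> cosh (arcosh R)" using c0(2)[OF xy] bound[OF e] R1 by simp
    then have "c0 * d (x e) (y e) \<le> arcosh R"
      using cosh_real_nonneg_le_iff[of "c0 * d (x e) (y e)" "arcosh R"] c0(1) R1 by simp
    then have "d (x e) (y e) \<le> arcosh R / c0" using c0(1) by (simp add: field_simps)
    moreover have "d p (x e) \<le> d p q + (d q (y e) + d (y e) (x e))"
      using triangle[of p q "x e"] triangle[of q "y e" "x e"] xy M by linarith
    ultimately have "d p (x e) - k \<le> d q (y e)" unfolding k_def using commute[of "x e" "y e"] by simp
    then have 1: "c' * (d p (x e) - k) \<le> c' * d q (y e)" using c(2) by simp
    have "H q (y e) \<le> 2 * H (x e) q * H (x e) (y e)" using H_triangle M xy by blast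
    also have "\<dots> \<le> 2 * (2 * H p (x e) * H p q) * R"
      using H_triangle[OF M(1) xy(1) M(2)] bound[OF e] H_pos xy M R1
      by (intro mult_mono mult_nonneg_nonneg) (auto simp: less_imp_le)
    finally have "cosh (c' * d q (y e)) \<le> A * cosh (c * d p (x e))"
      unfolding A_def using c(3,4)[OF e] by (simp add: mult_ac)
    moreover have "exp (c' * d q (y e)) / 2 \<le> cosh (c' * d q (y e))"
      unfolding cosh_def by simp
    moreover have "cosh (c * d p (x e)) \<le> exp (c * d p (x e))"
    proof -
      have "exp (- (c * d p (x e))) \<le> exp (c * d p (x e))" using c(1) by simp
      then show ?thesis unfolding cosh_def by simp
    qed
    then have "A * cosh (c * d p (x e)) \<le> A * exp (c * d p (x e))" using A by simp
    ultimately have "exp (c' * d q (y e)) \<le> 2 * A * exp (c * d p (x e))" by linarith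
    also have "\<dots> = exp (ln (2 * A) + c * d p (x e))" using A by (simp add: exp_add)
    finally have "c' * d q (y e) \<le> ln (2 * A) + c * d p (x e)" by simp
    then have "(c' - c) * d p (x e) \<le> c' * k + ln (2 * A)" using 1 by (simp add: algebra_simps)
    then show ?thesis unfolding N_def using cc by (simp add: field_simps)
  qed
  obtain e where e: "e \<in> E" "H p (x e) > cosh (c * N)" using unbounded by blast
  have "c * d p (x e) \<le> c * N" using le[OF e(1)] c by simp
  then have "cosh (c * d p (x e)) \<le> cosh (c * N)"
    using cosh_real_nonneg_le_iff[of "c * d p (x e)" "c * N"] c(1) nonneg[of p "x e"]
    by (smt (verit) mult_nonneg_nonneg)
  then show False using e c(3)[OF e(1)] by simp
qed

end

section \<open>The isometry onto the ball\<close>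

context form_domain
begin

text \<open>Dividing by \<open>B\<close> sends the polar of \<open>b\<close> to infinity, and in
  coordinates orthonormal for \<open>Q\<close> the kernel becomes \<open>hyp\<close>. What remains
  is a common factor for \<open>d\<close>: any two radii of the ball are compared through the chord
  that joins their endpoints.\<close>

lemma hyperbolic_model:
  shows "\<exists>(F :: real ^ 'n \<Rightarrow> real ^ 'n) c. bij_betw F M (ball 0 1) \<and> c > 0 \<and> (\<forall>p\<in>M. \<forall>q\<in>M. hyp (F p) (F q) = cosh (c * d p q))"
proof -
  obtain A :: "real ^ 'n \<Rightarrow> real ^ 'n" where A: "linear A" "bij A" "\<And>x y. Q x y = A x \<bullet> A y"
    using exists_orthonormalization[OF bilinear_Q Q_sym Q_pos] by blast
  define A' where "A' = inv A"
  have A': "linear A'" "\<And>z. A (A' z) = z" "\<And>x. A' (A x) = x"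
    unfolding A'_def using A(1,2) by (auto simp: bij_def surj_f_inv_f inv_f_f linear_injective_left_inverse
        intro!: inj_linear_imp_inv_linear)
  define F where "F p = (1 / B (p - b)) *\<^sub>R A (p - b)" for p
  have FF: "F p \<bullet> F q = Q (p - b) (q - b) / (B (p - b) * B (q - b))" for p q
    unfolding F_def by (simp add: A(3))
  have F_norm: "1 - F p \<bullet> F p = 1 / (f p * B (p - b))\<^sup>2" if "p \<in> M" for p
  proof -
    have "1 - F p \<bullet> F p = ((B (p - b))\<^sup>2 - Q (p - b) (p - b)) / (B (p - b))\<^sup>2"
      unfolding FF using B_pos[OF that] by (simp add: diff_divide_distrib power2_eq_square)
    then show ?thesis unfolding f_square[OF that, symmetric] by (simp add: power_mult_distrib)
  qed
  have F_ball: "norm (F p) < 1" if "p \<in> M" for p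
  proof -
    have "1 - F p \<bullet> F p > 0" unfolding F_norm[OF that] using f_pos[OF that] B_pos[OF that] by simp
    then show ?thesis by (metis diff_gt_0_iff_gt norm_eq_sqrt_inner real_sqrt_lt_1_iff)
  qed
  have hypF: "hyp (F p) (F q) = H p q" if "p \<in> M" "q \<in> M" for p q
  proof -
    note pos = f_pos[OF that(1)] f_pos[OF that(2)] B_pos[OF that(1)] B_pos[OF that(2)]
    define x y where "x = f p * B (p - b)" and "y = f q * B (q - b)"
    have xy: "x > 0" "y > 0" unfolding x_def y_def using pos by auto
    have "sqrt (1 / x\<^sup>2 * (1 / y\<^sup>2)) = 1 / (x * y)"
      using xy by (simp add: real_sqrt_mult real_sqrt_divide)
    then have "hyp (F p) (F q) = (1 - F p \<bullet> F q) * (x * y)"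
      unfolding hyp_def F_norm[OF that(1)] F_norm[OF that(2)] x_def[symmetric] y_def[symmetric] by simp
    also have "\<dots> = H p q" unfolding H_formula[OF that] FF x_def y_def using pos by (simp add: field_simps)
    finally show ?thesis .
  qed
  have F_b: "F b = 0" unfolding F_def using linear_0[OF A(1)] by simp
  have inj: "inj_on F M"
  proof (rule inj_onI)
    fix p q assume pq: "p \<in> M" "q \<in> M" "F p = F q"
    then have "H p q = 1" using hypF[OF pq(1,2)] hyp_self[OF F_ball] by simp
    then show "p = q" using H_eq_1_imp_eq pq by blast
  qed
  have surj: "\<exists>p\<in>M. F p = z" if z: "norm z < 1" for z
  proof (cases "z = 0")
    case True then show ?thesis using F_b b by blast
  next
    case False
    define w where "w = A' z"
    have w: "w \<noteq> 0" "A w = z" unfolding w_def using A'(2)[of z] False linear_0[OF A(1)] by auto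
    obtain \<sigma> c where \<sigma>: "strict_mono \<sigma>" "\<sigma> 0 = 0" "range \<sigma> = {u. b + u *\<^sub>R w \<in> M}"
      "c \<ge> 0" "\<And>r t. H (b + \<sigma> r *\<^sub>R w) (b + \<sigma> t *\<^sub>R w) = cosh (c * (r - t))"
      using chord_cosh[OF b w(1)] by blast
    have \<gamma>M: "b + \<sigma> t *\<^sub>R w \<in> M" for t using \<sigma>(3) by blast
    have "c \<noteq> 0"
    proof
      assume "c = 0"
      then have "H b (b + \<sigma> 1 *\<^sub>R w) = 1" using \<sigma>(5)[of 0 1] \<sigma>(2) by simp
      then have "b = b + \<sigma> 1 *\<^sub>R w" using H_eq_1_imp_eq[OF b \<gamma>M] by blast
      then show False using w strict_mono_less[OF \<sigma>(1), of 0 1] \<sigma>(2) by simp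
    qed
    then have c: "c > 0" using \<sigma>(4) by simp
    define n where "n = z \<bullet> z"
    have n: "0 < n" "n < 1" unfolding n_def using False z
      by (simp_all add: norm_eq_sqrt_inner)
    \<comment> \<open>The value of \<open>hyp 0 z\<close>; the preimage of \<open>z\<close> is the
      point on the ray in direction \<open>w\<close> where \<open>H b\<close> takes this
      value.\<close>
    define h where "h = 1 / sqrt (1 - n)"
    have h: "h > 1" unfolding h_def using n by (simp add: divide_simps)
    have h2: "h\<^sup>2 = 1 / (1 - n)" unfolding h_def using n by (simp add: power_divide)
    define t where "t = arcosh h / c"
    have t: "t > 0" unfolding t_def using c h by simp
    define p where "p = b + \<sigma> t *\<^sub>R w"
    have p: "p \<in> M" unfolding p_def by (rule \<gamma>M)
    have "H b p = cosh (c * (0 - t))" using \<sigma>(5)[of 0 t] \<sigma>(2) unfolding p_def by simp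
    also have "\<dots> = h" unfolding t_def using c h by simp
    finally have Hp: "H b p = h" .
    have Qp: "Q (p - b) (p - b) = (\<sigma> t)\<^sup>2 * n"
      unfolding p_def n_def using A(3)[of w w] w(2) by (simp add: Q_scale_left Q_scale_right power2_eq_square)
    have "(B (p - b))\<^sup>2 * (h\<^sup>2 - 1) = h\<^sup>2 * ((\<sigma> t)\<^sup>2 * n)" using H_base_square[OF p] unfolding Hp Qp .
    moreover have "h\<^sup>2 - 1 = h\<^sup>2 * n" unfolding h2 using n by (simp add: field_simps)
    ultimately have "(B (p - b))\<^sup>2 = (\<sigma> t)\<^sup>2" using n h by simp
    moreover have "\<sigma> t > 0" using strict_mono_less[OF \<sigma>(1), of 0 t] t \<sigma>(2) by simp
    ultimately have Bp: "B (p - b) = \<sigma> t" using B_pos[OF p] by (simp add: power2_eq_iff_nonneg)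
    have "F p = (1 / \<sigma> t) *\<^sub>R (\<sigma> t *\<^sub>R z)"
      unfolding F_def Bp unfolding p_def using linear_cmul[OF A(1)] w(2) by simp
    then have "F p = z" using \<open>\<sigma> t > 0\<close> by simp
    then show ?thesis using p by blast
  qed
  have bij: "bij_betw F M (ball 0 1)"
    unfolding bij_betw_def using inj F_ball surj by (auto simp: image_iff) (metis)
  define g where "g = inv_into M F"
  have g: "g z \<in> M" "F (g z) = z" if "norm z < 1" for z
    unfolding g_def using that bij_betw_imp_surj_on[OF bij] by (auto intro!: inv_into_into f_inv_into_f)
  have gF: "g (F p) = p" if "p \<in> M" for p unfolding g_def using inj that by simp
  have Hg: "H (g z) (g z') = hyp z z'" if "norm z < 1" "norm z' < 1" for z z'
    using hypF[of "g z" "g z'"] g that by simp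
  have g0: "g 0 = b" using gF[OF b] F_b by simp
  text \<open>\<open>g\<close> maps chords of the ball to chords of \<open>M\<close>, as \<open>g z - b = A' z / k z\<close> with \<open>k\<close> affine.\<close>
  define k where "k z = 1 - K b (A' z) / 2" for z
  have gk: "k z > 0 \<and> A' z = k z *\<^sub>R (g z - b)" if z: "norm z < 1" for z
  proof -
    note pos = B_pos[OF g(1)[OF z]]
    have "A' z = (1 / B (g z - b)) *\<^sub>R (g z - b)"
      using g(2)[OF z] A'(3)[of "g z - b"] linear_cmul[OF A'(1)] unfolding F_def by metis
    moreover from this have "k z = 1 - (B (g z - b) - 1) / B (g z - b)"
      unfolding k_def B_def using linear_cmul[OF linear_K[OF b]] by simp
    then have "k z = 1 / B (g z - b)" using pos by (simp add: field_simps)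
    ultimately show ?thesis using pos by simp
  qed
  have chord: "\<exists>c>0. \<forall>t t'. norm (z0 + t *\<^sub>R v) < 1 \<longrightarrow> norm (z0 + t' *\<^sub>R v) < 1 \<longrightarrow>
      hyp (z0 + t *\<^sub>R v) (z0 + t' *\<^sub>R v) = cosh (c * d (g (z0 + t *\<^sub>R v)) (g (z0 + t' *\<^sub>R v)))"
    if z0: "norm z0 < 1" and z1: "norm (z0 + v) < 1" and v: "v \<noteq> 0" for z0 v
  proof -
    define w where "w = g (z0 + v) - g z0"
    have "w \<noteq> 0"
    proof
      assume "w = 0"
      then have "F (g (z0 + v)) = F (g z0)" unfolding w_def by simp
      then show False using g(2) z0 z1 v by simp
    qed
    then obtain c where c: "c > 0" "\<And>u u'. g z0 + u *\<^sub>R w \<in> M \<Longrightarrow> g z0 + u' *\<^sub>R w \<in> M \<Longrightarrow>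
        H (g z0 + u *\<^sub>R w) (g z0 + u' *\<^sub>R w) = cosh (c * d (g z0 + u *\<^sub>R w) (g z0 + u' *\<^sub>R w))"
      using line_constant[OF g(1)[OF z0]] by blast
    have line: "\<exists>u. g (z0 + t *\<^sub>R v) = g z0 + u *\<^sub>R w" if t: "norm (z0 + t *\<^sub>R v) < 1" for t
    proof -
      define z k0 k1 where "z = z0 + t *\<^sub>R v" and "k0 = k z0" and "k1 = k (z0 + v)"
      have kz: "k z = (1 - t) * k0 + t * k1"
        unfolding k_def z_def k0_def k1_def
        using linear_add[OF A'(1)] linear_cmul[OF A'(1)] linear_add[OF linear_K[OF b]] linear_cmul[OF linear_K[OF b]]
        by (simp add: field_simps)
      have "k z *\<^sub>R (g z - b) = A' z" using gk t z_def by simp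
      also have "A' z = (1 - t) *\<^sub>R A' z0 + t *\<^sub>R A' (z0 + v)"
        unfolding z_def using linear_add[OF A'(1)] linear_cmul[OF A'(1)] by (simp add: algebra_simps)
      also have "\<dots> = ((1 - t) * k0) *\<^sub>R (g z0 - b) + (t * k1) *\<^sub>R (g (z0 + v) - b)"
        using gk z0 z1 unfolding k0_def k1_def by (metis scaleR_scaleR)
      also have "\<dots> = k z *\<^sub>R (g z0 - b) + (t * k1) *\<^sub>R w"
        unfolding kz w_def by (simp add: algebra_simps)
      finally have "k z *\<^sub>R (g z - g z0) = (t * k1) *\<^sub>R w" by (simp add: algebra_simps)
      then have "(1 / k z) *\<^sub>R (k z *\<^sub>R (g z - g z0)) = (1 / k z) *\<^sub>R ((t * k1) *\<^sub>R w)" by simp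
      then have "g z - g z0 = (t * k1 / k z) *\<^sub>R w" using gk[OF t] z_def by simp
      then have "g z = g z0 + (t * k1 / k z) *\<^sub>R w" by (metis add.commute diff_add_cancel)
      then show ?thesis unfolding z_def by blast
    qed
    have "hyp (z0 + t *\<^sub>R v) (z0 + t' *\<^sub>R v) = cosh (c * d (g (z0 + t *\<^sub>R v)) (g (z0 + t' *\<^sub>R v)))"
      if tt: "norm (z0 + t *\<^sub>R v) < 1" "norm (z0 + t' *\<^sub>R v) < 1" for t t'
    proof -
      obtain u u' where u: "g (z0 + t *\<^sub>R v) = g z0 + u *\<^sub>R w" "g (z0 + t' *\<^sub>R v) = g z0 + u' *\<^sub>R w"
        using line[OF tt(1)] line[OF tt(2)] by blast
      then show ?thesis using c(2)[of u u'] g(1)[OF tt(1)] g(1)[OF tt(2)] Hg[OF tt] by simp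
    qed
    then show ?thesis using c(1) by blast
  qed
  \<comment> \<open>The factor between \<open>d\<close> and hyperbolic distance on the chord cut out
    by the line \<open>z + t v\<close>. The point \<open>z\<close> may lie on the boundary of the
    ball.\<close>
  define const where "const z v c \<longleftrightarrow> c > 0 \<and> (\<forall>t t'. norm (z + t *\<^sub>R v) < 1 \<longrightarrow> norm (z + t' *\<^sub>R v) < 1 \<longrightarrow>
      hyp (z + t *\<^sub>R v) (z + t' *\<^sub>R v) = cosh (c * d (g (z + t *\<^sub>R v)) (g (z + t' *\<^sub>R v))))" for z v c
  have constD: "hyp (z + t *\<^sub>R v) (z + t' *\<^sub>R v) = cosh (c * d (g (z + t *\<^sub>R v)) (g (z + t' *\<^sub>R v)))"
    if "const z v c" "norm (z + t *\<^sub>R v) < 1" "norm (z + t' *\<^sub>R v) < 1" for z v c t t'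
    using that unfolding const_def by blast
  have const_reparam: "const (z + a *\<^sub>R v) (k *\<^sub>R v) c" if "const z v c" for z v c a k
  proof -
    have e: "z + a *\<^sub>R v + t *\<^sub>R (k *\<^sub>R v) = z + (a + t * k) *\<^sub>R v" for t by (simp add: scaleR_add_left)
    show ?thesis using that unfolding const_def e by blast
  qed
  have const_ex: "\<exists>c. const z v c" if z: "norm (z + a *\<^sub>R v) < 1" and v: "v \<noteq> 0" for z v a
  proof -
    obtain k where k: "k > 0" "z + a *\<^sub>R v + k *\<^sub>R v \<in> ball 0 1"
      using open_scaled_in[of "ball 0 1" "z + a *\<^sub>R v"] z by (metis abs_of_pos mem_ball_0 open_ball order_refl)
    then obtain c where "const (z + a *\<^sub>R v) (k *\<^sub>R v) c"
      using chord[of "z + a *\<^sub>R v" "k *\<^sub>R v"] z v unfolding const_def by auto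
    from const_reparam[OF this, of "- a / k" "1 / k"] have "const z v c" using k(1) by simp
    then show ?thesis by blast
  qed
  have norm_y: "(norm (\<alpha> + e *\<^sub>R (\<beta> - \<alpha>)))\<^sup>2 = 1 - 2 * e * (1 - e) * (1 - \<alpha> \<bullet> \<beta>)"
    if "norm \<alpha> = 1" "norm \<beta> = 1" for \<alpha> \<beta> :: "real ^ 'n" and e
  proof -
    have ip: "\<alpha> \<bullet> \<alpha> = 1" "\<beta> \<bullet> \<beta> = 1" using that by (simp_all add: norm_eq_1)
    show ?thesis unfolding power2_norm_eq_inner
      by (simp add: inner_add inner_diff inner_commute[of \<beta> \<alpha>] ip algebra_simps power2_eq_square)
  qed
  have ip_lt: "\<alpha> \<bullet> \<beta> < 1" if "norm \<alpha> = 1" "norm \<beta> = 1" "\<alpha> \<noteq> \<beta>" for \<alpha> \<beta> :: "real ^ 'n"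
  proof -
    have ip: "\<alpha> \<bullet> \<alpha> = 1" "\<beta> \<bullet> \<beta> = 1" using that by (simp_all add: norm_eq_1)
    have "0 < (\<alpha> - \<beta>) \<bullet> (\<alpha> - \<beta>)" using that(3) by simp
    also have "\<dots> = 2 - 2 * (\<alpha> \<bullet> \<beta>)" by (simp add: inner_diff inner_commute[of \<beta> \<alpha>] ip)
    finally show ?thesis by simp
  qed
  have y_lt: "norm (\<alpha> + e *\<^sub>R (\<beta> - \<alpha>)) < 1"
    if "norm \<alpha> = 1" "norm \<beta> = 1" "\<alpha> \<noteq> \<beta>" "0 < e" "e < 1" for \<alpha> \<beta> :: "real ^ 'n" and e
  proof -
    have "2 * e * (1 - e) * (1 - \<alpha> \<bullet> \<beta>) > 0" using ip_lt that by simp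
    then have "(norm (\<alpha> + e *\<^sub>R (\<beta> - \<alpha>)))\<^sup>2 < 1" using norm_y that by simp
    then show ?thesis by (simp add: abs_square_less_1)
  qed
  \<comment> \<open>The radius to \<open>\<alpha>\<close> and the chord from \<open>\<alpha>\<close>
    to \<open>\<beta>\<close> share a boundary point. Points with the same parameter
    \<open>e\<close> keep \<open>H\<close> between them bounded as \<open>e\<close> tends to 0,
    while both go to infinity.\<close>
  have ray_asy: "c = c'" if ab: "norm \<alpha> = 1" "norm \<beta> = 1" "\<alpha> \<noteq> \<beta>" and r: "const 0 \<alpha> c" and a: "const \<alpha> (\<beta> - \<alpha>) c'"
    for \<alpha> \<beta> c c'
  proof -
    define E where "E = {0<..<1/2 :: real}"
    define x y where "x e = g ((1 - e) *\<^sub>R \<alpha>)" and "y e = g (\<alpha> + e *\<^sub>R (\<beta> - \<alpha>))" for e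
    define q where "q = y (1/2)"
    have xn: "norm ((1 - e) *\<^sub>R \<alpha>) < 1" if "e \<in> E" for e using that ab unfolding E_def by simp
    have yn: "norm (\<alpha> + e *\<^sub>R (\<beta> - \<alpha>)) < 1" if "e \<in> E" for e
      using that y_lt[OF ab] unfolding E_def by simp
    have M: "q \<in> M" "\<And>e. e \<in> E \<Longrightarrow> x e \<in> M" "\<And>e. e \<in> E \<Longrightarrow> y e \<in> M"
      unfolding q_def x_def y_def using g(1) xn yn y_lt[OF ab, of "1/2"] by simp_all
    have c: "c > 0" "c' > 0" using r a unfolding const_def by auto
    have Hx: "H b (x e) = cosh (c * d b (x e))" if e: "e \<in> E" for e
      using constD[OF r, of 0 "1 - e"] xn[OF e] Hg[OF _ xn[OF e], of 0] unfolding x_def g0[symmetric] by simp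
    have Hy: "H q (y e) = cosh (c' * d q (y e))" if e: "e \<in> E" for e
    proof -
      have half: "norm (\<alpha> + (1/2) *\<^sub>R (\<beta> - \<alpha>)) < 1" by (rule y_lt[OF ab]) simp_all
      show ?thesis unfolding q_def y_def Hg[OF half yn[OF e]] by (rule constD[OF a half yn[OF e]])
    qed
    have ip: "\<alpha> \<bullet> \<alpha> = 1" "\<beta> \<bullet> \<beta> = 1" using ab by (simp_all add: norm_eq_1)
    \<comment> \<open>For \<open>0 < e < 1/2\<close> the numerator of \<open>hyp\<close> is at most
      \<open>3 * e\<close> and the denominator at least
      \<open>e * sqrt (1 - \<alpha> \<bullet> \<beta>)\<close>.\<close>
    define R where "R = 3 / sqrt (1 - \<alpha> \<bullet> \<beta>)"
    have bound: "H (x e) (y e) \<le> R" if e: "e \<in> E" for e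
    proof -
      have e': "0 < e" "e < 1/2" using e unfolding E_def by auto
      define z z' where "z = (1 - e) *\<^sub>R \<alpha>" and "z' = \<alpha> + e *\<^sub>R (\<beta> - \<alpha>)"
      have zz: "1 - z \<bullet> z = e * (2 - e)" unfolding z_def using ip by (simp add: algebra_simps)
      have z'z': "1 - z' \<bullet> z' = 2 * e * (1 - e) * (1 - \<alpha> \<bullet> \<beta>)"
        using norm_y[OF ab(1,2), of e] unfolding z'_def power2_norm_eq_inner by simp
      have "1 - z \<bullet> z' = e * (2 - e - (1 - e) * (\<alpha> \<bullet> \<beta>))"
        unfolding z_def z'_def using ip by (simp add: inner_add_right inner_diff_right algebra_simps)
      also have "\<dots> \<le> e * 3"
      proof -
        have "- (\<alpha> \<bullet> \<beta>) \<le> 1" using Cauchy_Schwarz_ineq2[of \<alpha> \<beta>] ab by simp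
        then have "(1 - e) * (- (\<alpha> \<bullet> \<beta>)) \<le> (1 - e) * 1" using e' by (intro mult_left_mono) auto
        then have "2 - e - (1 - e) * (\<alpha> \<bullet> \<beta>) \<le> 3" using e' by simp
        then show ?thesis using e' by (intro mult_left_mono) auto
      qed
      finally have num: "1 - z \<bullet> z' \<le> e * 3" .
      have ip1: "1 - \<alpha> \<bullet> \<beta> > 0" using ip_lt[OF ab] by simp
      have "e * 1 * (e * (1 - \<alpha> \<bullet> \<beta>)) \<le> e * (2 - e) * (2 * e * (1 - e) * (1 - \<alpha> \<bullet> \<beta>))"
      proof (rule mult_mono)
        show "e * 1 \<le> e * (2 - e)" using e' by (intro mult_left_mono) auto
        have "1 \<le> 2 * (1 - e)" using e' by simp
        then have "e * (1 - \<alpha> \<bullet> \<beta>) * 1 \<le> e * (1 - \<alpha> \<bullet> \<beta>) * (2 * (1 - e))"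
          using e' ip1 by (intro mult_left_mono) auto
        then show "e * (1 - \<alpha> \<bullet> \<beta>) \<le> 2 * e * (1 - e) * (1 - \<alpha> \<bullet> \<beta>)" by (simp add: mult_ac)
      qed (use e' ip1 in auto)
      then have "sqrt (e\<^sup>2 * (1 - \<alpha> \<bullet> \<beta>)) \<le> sqrt ((1 - z \<bullet> z) * (1 - z' \<bullet> z'))"
        unfolding zz z'z' by (simp add: power2_eq_square mult_ac)
      then have den: "e * sqrt (1 - \<alpha> \<bullet> \<beta>) \<le> sqrt ((1 - z \<bullet> z) * (1 - z' \<bullet> z'))"
        using e' by (simp add: real_sqrt_mult)
      have "hyp z z' \<le> e * 3 / (e * sqrt (1 - \<alpha> \<bullet> \<beta>))"
        unfolding hyp_def using num den e' ip1 by (intro frac_le) auto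
      also have "\<dots> = R" unfolding R_def using e' by simp
      finally show ?thesis using Hg[OF xn[OF e] yn[OF e]] unfolding x_def y_def z_def z'_def by simp
    qed
    have unb: "\<exists>e\<in>E. H b (x e) > N" for N
    proof -
      define n where "n = \<bar>N\<bar> + 1"
      have n: "n \<ge> 1" "n > N" unfolding n_def by auto
      \<comment> \<open>Makes \<open>3 * e = 1 / n\<^sup>2\<close>, which dominates
        \<open>e * (2 - e)\<close>.\<close>
      define e where "e = 1 / (3 * n\<^sup>2)"
      have n2: "n\<^sup>2 \<ge> 1" using n by simp
      have e: "0 < e" "e < 1/2" unfolding e_def using n2 by (auto simp: divide_simps)
      then have eE: "e \<in> E" unfolding E_def by simp
      have "H b (x e) = hyp 0 ((1 - e) *\<^sub>R \<alpha>)" using Hg[OF _ xn[OF eE], of 0] unfolding x_def g0 by simp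
      also have "\<dots> = 1 / sqrt (e * (2 - e))" unfolding hyp_def using ip by (simp add: algebra_simps)
      finally have Hxe: "H b (x e) = 1 / sqrt (e * (2 - e))" .
      have "e * (2 - e) < e * 3" using e by simp
      also have "\<dots> = (1 / n)\<^sup>2" unfolding e_def by (simp add: power_divide)
      finally have "sqrt (e * (2 - e)) < 1 / n" using n by (intro real_less_lsqrt) auto
      moreover have "sqrt (e * (2 - e)) > 0" using e by simp
      ultimately have "H b (x e) > n" unfolding Hxe using n by (simp add: field_simps)
      then show ?thesis using eE n by force
    qed
    \<comment> \<open>Unboundedness passes from \<open>x\<close> to \<open>y\<close> by two uses of
      \<open>H_triangle\<close>, since \<open>H (x e) (y e)\<close> is bounded and
      \<open>H q b\<close> is fixed.\<close>
    have unb': "\<exists>e\<in>E. H q (y e) > N" for N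
    proof -
      obtain e0 where e0: "e0 \<in> E" using unb by blast
      have R: "R > 0" using bound[OF e0] H_pos M(2,3)[OF e0] by fastforce
      have pb: "H q b > 0" using H_pos M b by blast
      obtain e where e: "e \<in> E" "H b (x e) > 4 * H q b * R * N" using unb by blast
      have "H b (x e) \<le> 2 * H q b * H q (x e)" using H_triangle[OF M(1) b M(2)[OF e(1)]] .
      also have "\<dots> \<le> 2 * H q b * (2 * H (y e) q * H (y e) (x e))"
        using H_triangle[OF M(3)[OF e(1)] M(1) M(2)[OF e(1)]] pb by simp
      also have "\<dots> \<le> 2 * H q b * (2 * H (y e) q * R)"
        using bound[OF e(1)] H_sym[OF M(2)[OF e(1)] M(3)[OF e(1)]] pb H_pos[OF M(3)[OF e(1)] M(1)] by simp
      also have "\<dots> = 4 * H q b * R * H q (y e)" using H_sym[OF M(3)[OF e(1)] M(1)] by simp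
      finally have "4 * H q b * R * N < 4 * H q b * R * H q (y e)" using e(2) by simp
      then have "N < H q (y e)" using R pb by (simp add: mult_less_cancel_left_pos)
      then show ?thesis using e(1) by blast
    qed
    have bound': "H (y e) (x e) \<le> R" if "e \<in> E" for e
      using bound[OF that] H_sym M(2,3)[OF that] by simp
    have "c' \<le> c"
      by (rule constant_le_of_asymptotic[of b q E x y c c' R]) (use b M c Hx Hy bound unb in auto)
    moreover have "c \<le> c'"
      by (rule constant_le_of_asymptotic[of q b E y x c' c R]) (use b M c Hx Hy bound' unb' in auto)
    ultimately show "c = c'" by simp
  qed
  obtain \<alpha>0 :: "real ^ 'n" where \<alpha>0: "norm \<alpha>0 = 1" using vector_choose_size[of 1] by auto
  have ray_ex: "\<exists>c. const 0 \<alpha> c" if "norm \<alpha> = 1" for \<alpha>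
    by (rule const_ex[of _ 0]) (use that in auto)
  obtain c0 where c0: "const 0 \<alpha>0 c0" using ray_ex[OF \<alpha>0] by blast
  \<comment> \<open>Read from its two ends, the chord between \<open>\<alpha>0\<close> and
    \<open>\<beta>\<close> is asymptotic to both radii.\<close>
  have all_ray: "const 0 \<beta> c0" if \<beta>: "norm \<beta> = 1" for \<beta>
  proof (cases "\<beta> = \<alpha>0")
    case True then show ?thesis using c0 by simp
  next
    case False
    obtain c1 where c1: "const 0 \<beta> c1" using ray_ex[OF \<beta>] by blast
    obtain c' where c': "const \<alpha>0 (\<beta> - \<alpha>0) c'"
      using const_ex[OF y_lt[OF \<alpha>0 \<beta>, of "1/2"]] False by auto
    have "const \<beta> (\<alpha>0 - \<beta>) c'" using const_reparam[OF c', of 1 "- 1"] by simp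
    then have "c1 = c'" using ray_asy[OF \<beta> \<alpha>0 _ c1] False by blast
    moreover have "c0 = c'" using ray_asy[OF \<alpha>0 \<beta> _ c0 c'] False by blast
    ultimately show ?thesis using c1 by simp
  qed
  have base: "H b q = cosh (c0 * d b q)" if q: "q \<in> M" for q
  proof (cases "q = b")
    case True then show ?thesis using H_self b by simp
  next
    case False
    define z where "z = F q"
    have z: "norm z < 1" "g z = q" unfolding z_def using F_ball gF q by auto
    have "z \<noteq> 0" using z g0 False by auto
    define \<beta> where "\<beta> = (1 / norm z) *\<^sub>R z"
    have \<beta>: "norm \<beta> = 1" "z = norm z *\<^sub>R \<beta>" unfolding \<beta>_def using \<open>z \<noteq> 0\<close> by simp_all
    have "norm (0 + norm z *\<^sub>R \<beta>) < 1" using z(1) \<beta>(1) by simp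
    then have "hyp (0 *\<^sub>R \<beta>) (norm z *\<^sub>R \<beta>) = cosh (c0 * d (g (0 *\<^sub>R \<beta>)) (g (norm z *\<^sub>R \<beta>)))"
      using constD[OF all_ray[OF \<beta>(1)], of 0 "norm z"] by simp
    then have "hyp 0 z = cosh (c0 * d b q)" unfolding \<beta>(2)[symmetric] using g0 z by simp
    then show ?thesis using Hg[of 0 z] z g0 by simp
  qed
  have "hyp (F p) (F q) = cosh (c0 * d p q)" if pq: "p \<in> M" "q \<in> M" for p q
  proof -
    obtain m where m: "m \<in> M" "s m p = b" using exists_s_midpoint[OF pq(1) b] by blast
    have "d p q = d b (s m q)" "H p q = H b (s m q)" using s_isometry H_s m pq by metis+
    then show ?thesis using base[of "s m q"] s_in m pq hypF by simp
  qed
  moreover have "c0 > 0" using c0 unfolding const_def by blast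
  ultimately show ?thesis using bij by (intro exI[of _ F] exI[of _ c0]) blast
qed

end

section \<open>Reflections of the ball model\<close>

text \<open>The reflection of the ball model at \<open>q\<close>, read off from \<open>X \<mapsto> 2 \<langle>X, Q\<rangle> Q - X\<close> on the hyperboloid.\<close>

definition hyp_refl :: "'a::real_inner \<Rightarrow> 'a \<Rightarrow> 'a" where
  "hyp_refl q x = (1 / (2 * (1 - q \<bullet> x) - (1 - q \<bullet> q))) *\<^sub>R ((2 * (1 - q \<bullet> x)) *\<^sub>R q - (1 - q \<bullet> q) *\<^sub>R x)"

lemma inner_self_less_1_iff: "x \<bullet> x < 1 \<longleftrightarrow> norm x < 1"
  by (metis norm_eq_sqrt_inner real_sqrt_lt_1_iff)

lemma hyp_refl_denominator:
  assumes "norm q < 1" "norm x < 1"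
  shows "2 * (1 - q \<bullet> x) - (1 - q \<bullet> q) > 0"
proof -
  have "0 \<le> (q - x) \<bullet> (q - x)" by simp
  then have "2 * (q \<bullet> x) \<le> q \<bullet> q + x \<bullet> x" by (simp add: inner_diff inner_commute[of x q])
  moreover have "x \<bullet> x < 1" using assms inner_self_less_1_iff by blast
  ultimately show ?thesis by simp
qed

text \<open>The linear map behind the reflection multiplies the Lorentz product by
  \<open>(1 - q \<bullet> q)\<^sup>2\<close>; this is that fact with the denominators of the
  projection cleared.\<close>

lemma hyp_refl_inner:
  assumes "norm q < 1" "norm x < 1" "norm y < 1"
  shows "(1 - hyp_refl q x \<bullet> hyp_refl q y) * ((2 * (1 - q \<bullet> x) - (1 - q \<bullet> q)) * (2 * (1 - q \<bullet> y) - (1 - q \<bullet> q)))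
    = (1 - q \<bullet> q)\<^sup>2 * (1 - x \<bullet> y)"
proof -
  define a b t where "a = q \<bullet> x" and "b = q \<bullet> y" and "t = q \<bullet> q"
  define D E where "D = 2 * (1 - a) - (1 - t)" and "E = 2 * (1 - b) - (1 - t)"
  have pos: "D > 0" "E > 0" unfolding D_def E_def a_def b_def t_def
    using hyp_refl_denominator[OF assms(1,2)] hyp_refl_denominator[OF assms(1,3)] by linarith+
  have "((2 * (1 - a)) *\<^sub>R q - (1 - t) *\<^sub>R x) \<bullet> ((2 * (1 - b)) *\<^sub>R q - (1 - t) *\<^sub>R y)
    = 4 * (1 - a) * (1 - b) * t - 2 * (1 - a) * (1 - t) * b - 2 * (1 - b) * (1 - t) * a + (1 - t)\<^sup>2 * (x \<bullet> y)"
    by (simp add: inner_diff a_def[symmetric] b_def[symmetric] t_def[symmetric] inner_commute[of x q]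
        power2_eq_square algebra_simps)
  then have "hyp_refl q x \<bullet> hyp_refl q y * (D * E)
    = 4 * (1 - a) * (1 - b) * t - 2 * (1 - a) * (1 - t) * b - 2 * (1 - b) * (1 - t) * a + (1 - t)\<^sup>2 * (x \<bullet> y)"
    unfolding hyp_refl_def a_def[symmetric] b_def[symmetric] t_def[symmetric] D_def[symmetric] E_def[symmetric]
    using pos by simp
  then have "(1 - hyp_refl q x \<bullet> hyp_refl q y) * (D * E) = (1 - t)\<^sup>2 * (1 - x \<bullet> y)"
    unfolding left_diff_distrib unfolding D_def E_def by (simp add: power2_eq_square algebra_simps)
  then show ?thesis unfolding D_def E_def a_def b_def t_def .
qed

lemma hyp_refl_ball:
  assumes "norm q < 1" "norm x < 1"
  shows "norm (hyp_refl q x) < 1"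
proof -
  define D where "D = 2 * (1 - q \<bullet> x) - (1 - q \<bullet> q)"
  have D: "D > 0" unfolding D_def using hyp_refl_denominator assms by blast
  have "(1 - hyp_refl q x \<bullet> hyp_refl q x) * (D * D) = (1 - q \<bullet> q)\<^sup>2 * (1 - x \<bullet> x)"
    unfolding D_def by (rule hyp_refl_inner[OF assms assms(2)])
  moreover have "(1 - q \<bullet> q)\<^sup>2 * (1 - x \<bullet> x) > 0" using assms inner_self_less_1_iff[of q] inner_self_less_1_iff[of x] by simp
  ultimately have "1 - hyp_refl q x \<bullet> hyp_refl q x > 0" using D by (metis mult_pos_pos zero_less_mult_pos2)
  then show ?thesis using inner_self_less_1_iff[of "hyp_refl q x"] by simp
qed

lemma hyp_refl_isometry:
  assumes "norm q < 1" "norm x < 1" "norm y < 1"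
  shows "hyp (hyp_refl q x) (hyp_refl q y) = hyp x y"
proof -
  define T where "T = 1 - q \<bullet> q"
  define D E where "D = 2 * (1 - q \<bullet> x) - T" and "E = 2 * (1 - q \<bullet> y) - T"
  have pos: "D > 0" "E > 0" "T > 0" unfolding D_def E_def T_def
    using hyp_refl_denominator[OF assms(1,2)] hyp_refl_denominator[OF assms(1,3)] inner_self_less_1_iff[of q] assms(1)
    by linarith+
  have xy: "1 - hyp_refl q x \<bullet> hyp_refl q y = T\<^sup>2 * (1 - x \<bullet> y) / (D * E)"
    using hyp_refl_inner[OF assms] pos
    unfolding T_def[symmetric] D_def[symmetric] E_def[symmetric] by (simp add: eq_divide_eq)
  have xx: "1 - hyp_refl q x \<bullet> hyp_refl q x = T\<^sup>2 * (1 - x \<bullet> x) / (D * D)"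
    using hyp_refl_inner[OF assms(1,2,2)] pos
    unfolding T_def[symmetric] D_def[symmetric] E_def[symmetric] by (simp add: eq_divide_eq)
  have yy: "1 - hyp_refl q y \<bullet> hyp_refl q y = T\<^sup>2 * (1 - y \<bullet> y) / (E * E)"
    using hyp_refl_inner[OF assms(1,3,3)] pos
    unfolding T_def[symmetric] D_def[symmetric] E_def[symmetric] by (simp add: eq_divide_eq)
  have "T\<^sup>2 * (1 - x \<bullet> x) / (D * D) * (T\<^sup>2 * (1 - y \<bullet> y) / (E * E)) = (T\<^sup>2 / (D * E))\<^sup>2 * ((1 - x \<bullet> x) * (1 - y \<bullet> y))"
    by (simp add: power2_eq_square mult_ac)
  then have "sqrt (T\<^sup>2 * (1 - x \<bullet> x) / (D * D) * (T\<^sup>2 * (1 - y \<bullet> y) / (E * E))) = T\<^sup>2 / (D * E) * sqrt ((1 - x \<bullet> x) * (1 - y \<bullet> y))"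
    using pos by (simp add: real_sqrt_mult)
  then show ?thesis unfolding hyp_def xy xx yy using pos by simp
qed

lemma hyp_refl_self: "norm q < 1 \<Longrightarrow> hyp_refl q q = q"
proof -
  assume "norm q < 1"
  then have "q \<bullet> q < 1" using inner_self_less_1_iff by blast
  then have "2 * (1 - q \<bullet> q) - (1 - q \<bullet> q) \<noteq> 0" by simp
  moreover have "(2 * (1 - q \<bullet> q)) *\<^sub>R q - (1 - q \<bullet> q) *\<^sub>R q = (2 * (1 - q \<bullet> q) - (1 - q \<bullet> q)) *\<^sub>R q"
    by (simp only: scaleR_diff_left)
  ultimately show ?thesis unfolding hyp_refl_def by simp
qed

lemma hyp_refl_scaled:
  assumes "norm q < 1" "norm x < 1"
  shows "(2 * (1 - q \<bullet> x) - (1 - q \<bullet> q)) *\<^sub>R hyp_refl q x = (2 * (1 - q \<bullet> x)) *\<^sub>R q - (1 - q \<bullet> q) *\<^sub>R x"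
  unfolding hyp_refl_def using hyp_refl_denominator[OF assms] by simp

lemma hyp_refl_involution:
  assumes "norm q < 1" "norm x < 1"
  shows "hyp_refl q (hyp_refl q x) = x"
proof -
  define y where "y = hyp_refl q x"
  define D T a where "D = 2 * (1 - q \<bullet> x) - (1 - q \<bullet> q)" and "T = 1 - q \<bullet> q" and "a = 1 - q \<bullet> x"
  have pos: "D > 0" "T > 0" unfolding D_def T_def
    using hyp_refl_denominator[OF assms] inner_self_less_1_iff[of q] assms(1) by linarith+
  have y: "norm y < 1" unfolding y_def using hyp_refl_ball assms by blast
  have Dy: "D *\<^sub>R y = (2 * a) *\<^sub>R q - T *\<^sub>R x"
    using hyp_refl_scaled[OF assms] unfolding D_def T_def a_def y_def .
  \<comment> \<open>The product formula for the pair \<open>q\<close>, \<open>x\<close>, the first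
    of which is fixed.\<close>
  have "(1 - q \<bullet> y) * (D * (2 * (1 - q \<bullet> q) - (1 - q \<bullet> q))) = T\<^sup>2 * a"
    using hyp_refl_inner[OF assms(1,1,2)] hyp_refl_self[OF assms(1)] unfolding D_def T_def a_def y_def by (simp add: mult_ac)
  then have "T * ((1 - q \<bullet> y) * D) = T * (T * a)" unfolding T_def by (simp add: power2_eq_square mult_ac)
  then have qy: "D * (1 - q \<bullet> y) = T * a" using pos by (simp add: mult.commute)
  define E where "E = 2 * (1 - q \<bullet> y) - T"
  have DE: "D * E = T * T"
  proof -
    have "D * E = 2 * (D * (1 - q \<bullet> y)) - D * T" unfolding E_def by (simp add: algebra_simps)
    also have "\<dots> = T * (2 * a - D)" unfolding qy by (simp add: algebra_simps)
    also have "2 * a - D = T" unfolding D_def T_def a_def by simp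
    finally show ?thesis .
  qed
  have "D *\<^sub>R (E *\<^sub>R hyp_refl q y) = D *\<^sub>R ((2 * (1 - q \<bullet> y)) *\<^sub>R q - T *\<^sub>R y)"
    using hyp_refl_scaled[OF assms(1) y] unfolding E_def T_def by simp
  also have "\<dots> = (2 * (D * (1 - q \<bullet> y))) *\<^sub>R q - T *\<^sub>R (D *\<^sub>R y)" by (simp add: scaleR_diff_right mult_ac)
  also have "\<dots> = (T * T) *\<^sub>R x" unfolding qy Dy by (simp add: scaleR_diff_right mult_ac)
  finally have "(T * T) *\<^sub>R hyp_refl q y = (T * T) *\<^sub>R x" using DE by simp
  then show ?thesis using pos unfolding y_def by simp
qed

text \<open>On the hyperboloid \<open>Z = X + Y - 2 \<langle>X, Q\<rangle> Q\<close> is orthogonal to the timelike vector \<open>Q\<close> and null,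
  hence zero.\<close>

lemma hyp_midpoint_unique:
  assumes n: "norm q < 1" "norm x < 1" "norm y < 1"
    and eq: "hyp q y = hyp q x" and xy: "hyp x y = 2 * (hyp q x)\<^sup>2 - 1"
  shows "y = hyp_refl q x"
proof -
  define X Y P where "X = sqrt (1 - x \<bullet> x)" and "Y = sqrt (1 - y \<bullet> y)" and "P = sqrt (1 - q \<bullet> q)"
  have lt: "x \<bullet> x < 1" "y \<bullet> y < 1" "q \<bullet> q < 1" using n inner_self_less_1_iff by auto
  have pos: "X > 0" "Y > 0" "P > 0" unfolding X_def Y_def P_def using lt by auto
  have sq: "X\<^sup>2 = 1 - x \<bullet> x" "Y\<^sup>2 = 1 - y \<bullet> y" "P\<^sup>2 = 1 - q \<bullet> q" unfolding X_def Y_def P_def using lt by auto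
  define c where "c = hyp q x"
  have qx: "1 - q \<bullet> x = c * P * X" unfolding c_def hyp_def real_sqrt_mult P_def[symmetric] X_def[symmetric] using pos by simp
  have "1 - q \<bullet> y = hyp q y * P * Y" unfolding hyp_def real_sqrt_mult P_def[symmetric] Y_def[symmetric] using pos by simp
  then have qy: "1 - q \<bullet> y = c * P * Y" unfolding eq c_def .
  have "1 - x \<bullet> y = hyp x y * X * Y" unfolding hyp_def real_sqrt_mult X_def[symmetric] Y_def[symmetric] using pos by simp
  then have xy': "1 - x \<bullet> y = (2 * c\<^sup>2 - 1) * X * Y" unfolding xy c_def .
  \<comment> \<open>Scaling factors onto the hyperboloid for \<open>x\<close> and \<open>y\<close>;
    \<open>e\<close> combines the one for \<open>q\<close> with the coefficient
    \<open>2 * c\<close>. Then \<open>z\<close> and \<open>z0\<close> are the space and time parts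
    of \<open>Z\<close>.\<close>
  define a b e where "a = 1 / X" and "b = 1 / Y" and "e = 2 * c / P"
  have ab: "a * X = 1" "b * Y = 1" "e * P = 2 * c" unfolding a_def b_def e_def using pos by auto
  define z where "z = a *\<^sub>R x + b *\<^sub>R y - e *\<^sub>R q"
  define z0 where "z0 = a + b - e"
  have zq: "z \<bullet> q = z0"
  proof -
    have "z0 - z \<bullet> q = a * (1 - q \<bullet> x) + b * (1 - q \<bullet> y) - e * (1 - q \<bullet> q)"
      unfolding z_def z0_def by (simp add: inner_diff_left inner_add_left inner_commute algebra_simps)
    also have "\<dots> = (a * X) * c * P + (b * Y) * c * P - (e * P) * P"
      unfolding qx qy sq(3)[symmetric] by (simp add: power2_eq_square mult_ac)
    also have "\<dots> = 0" unfolding ab by simp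
    finally show ?thesis by simp
  qed
  have zz: "z \<bullet> z = z0\<^sup>2"
  proof -
    have "z0\<^sup>2 - z \<bullet> z = a\<^sup>2 * (1 - x \<bullet> x) + b\<^sup>2 * (1 - y \<bullet> y) + e\<^sup>2 * (1 - q \<bullet> q)
      + 2 * a * b * (1 - x \<bullet> y) - 2 * a * e * (1 - q \<bullet> x) - 2 * b * e * (1 - q \<bullet> y)"
      unfolding z_def z0_def
      by (simp add: inner_diff_left inner_add_left inner_diff_right inner_add_right inner_commute[of x q]
          inner_commute[of y q] inner_commute[of y x] power2_eq_square algebra_simps)
    also have "\<dots> = (a * X)\<^sup>2 + (b * Y)\<^sup>2 + (e * P)\<^sup>2 + 2 * (a * X) * (b * Y) * (2 * c\<^sup>2 - 1)
        - 2 * (a * X) * (e * P) * c - 2 * (b * Y) * (e * P) * c"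
      unfolding qx qy xy' sq[symmetric] by (simp add: power2_eq_square algebra_simps)
    also have "\<dots> = 0" unfolding ab by (simp add: power2_eq_square algebra_simps)
    finally show ?thesis by simp
  qed
  have "z = 0"
  proof -
    have "(z \<bullet> q)\<^sup>2 \<le> (z \<bullet> z) * (q \<bullet> q)" by (rule Cauchy_Schwarz_ineq)
    then have "(z \<bullet> z) * (1 - q \<bullet> q) \<le> 0" unfolding zq zz by (simp add: algebra_simps)
    then have "z \<bullet> z \<le> 0" using lt(3) by (simp add: mult_le_0_iff)
    then have "z \<bullet> z = 0" using inner_ge_zero[of z] by linarith
    then show ?thesis by simp
  qed
  then have "b *\<^sub>R y = e *\<^sub>R q - a *\<^sub>R x" unfolding z_def by (simp add: algebra_simps)
  moreover have "b = e - a" using zz \<open>z = 0\<close> unfolding z0_def by simp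
  ultimately have by': "(e - a) *\<^sub>R y = e *\<^sub>R q - a *\<^sub>R x" by simp
  \<comment> \<open>Clears denominators, bringing the relation into the form of
    \<open>hyp_refl_scaled\<close>.\<close>
  define k where "k = X * P\<^sup>2"
  have k: "k > 0" unfolding k_def using pos by simp
  have ke: "k * e = 2 * (1 - q \<bullet> x)"
  proof -
    have "k * e = X * P * (e * P)" unfolding k_def by (simp add: power2_eq_square)
    then show ?thesis unfolding ab qx by simp
  qed
  have ka: "k * a = 1 - q \<bullet> q" unfolding k_def using ab(1) sq(3) by (metis mult.assoc mult.commute mult.right_neutral)
  have "k *\<^sub>R ((e - a) *\<^sub>R y) = k *\<^sub>R (e *\<^sub>R q - a *\<^sub>R x)" unfolding by' ..
  then have "(k * e - k * a) *\<^sub>R y = (k * e) *\<^sub>R q - (k * a) *\<^sub>R x"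
    by (simp add: scaleR_diff_right right_diff_distrib)
  then have "(2 * (1 - q \<bullet> x) - (1 - q \<bullet> q)) *\<^sub>R y
      = (2 * (1 - q \<bullet> x) - (1 - q \<bullet> q)) *\<^sub>R hyp_refl q x"
    unfolding ke ka hyp_refl_scaled[OF n(1,2)] .
  then show ?thesis using hyp_refl_denominator[OF n(1,2)] by simp
qed

lemma tanh_artanh:
  fixes x :: real
  assumes "\<bar>x\<bar> < 1"
  shows "tanh (artanh x) = x"
proof -
  have e: "exp (- 2 * artanh x) = (1 - x) / (1 + x)"
    using assms by (simp add: artanh_def exp_minus)
  have "1 + x \<noteq> 0" using assms by auto
  then show ?thesis unfolding tanh_real_altdef e by (simp add: field_simps)
qed

lemma cosh_eq_iff_nonneg: "0 \<le> x \<Longrightarrow> 0 \<le> y \<Longrightarrow> cosh x = cosh (y::real) \<longleftrightarrow> x = y"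
  by (metis arcosh_cosh_real)

text \<open>The reflection of the ball is pulled back by the chart \<open>E\<close>. Since
  \<open>E\<close> is only known to be a bijection that respects distances, invariance of the lines
  through \<open>p\<close> is proved metrically: two points at equal distance on both sides of
  \<open>p\<close> along a geodesic must be images of each other.\<close>

lemma (in projective_metric) centers_of_hyperbolic:
  assumes "is_hyperbolic_geometry M d"
  shows "centers M d = M \<and> M \<noteq> {}"
proof -
  obtain I c F where I: "open_ellipsoid (I :: 'a set)" "c > 0" "bij_betw F M I"
      "\<And>x y. x \<in> M \<Longrightarrow> y \<in> M \<Longrightarrow> d x y = c * hilbert_dist I (F x) (F y)"
    using assms unfolding is_hyperbolic_geometry_def by blast
  obtain a T where T: "linear T" "bij T" "I = (\<lambda>x. a + T x) ` ball (0 :: 'a) 1"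
    using I(1) unfolding open_ellipsoid_def by blast
  define E where "E = inv_into (ball 0 1) (\<lambda>x. a + T x) \<circ> F"
  have "bij_betw (\<lambda>x. a + T x) (ball 0 1) I"
    unfolding T(3) using T(2) by (auto simp: bij_betw_def inj_on_def bij_def dest: injD)
  then have E: "bij_betw E M (ball 0 1)"
    unfolding E_def by (intro bij_betw_trans[OF I(3)] bij_betw_inv_into)
  have EF: "a + T (E x) = F x" if "x \<in> M" for x
    unfolding E_def using that I(3) T(3) f_inv_into_f[of "F x" "\<lambda>x. a + T x" "ball 0 1"]
    by (auto dest: bij_betwE)
  have En: "norm (E x) < 1" if "x \<in> M" for x using E that by (auto dest: bij_betwE)
  have hyp: "hyp (E x) (E y) = cosh (d x y / c)" if "x \<in> M" "y \<in> M" for x y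
  proof -
    have "hyp (E x) (E y) = cosh (hilbert_dist I (F x) (F y))"
      using hilbert_dist_nonneg_cosh(2)[OF T(1) bij_is_inj[OF T(2)] En[OF that(1)] En[OF that(2)], of a]
      unfolding EF[OF that(1)] EF[OF that(2)] T(3)[symmetric] by simp
    then show ?thesis using I(4)[OF that] I(2) by simp
  qed
  have d_eq: "d x y = d x' y'" if "x \<in> M" "y \<in> M" "x' \<in> M" "y' \<in> M" "hyp (E x) (E y) = hyp (E x') (E y')" for x y x' y'
  proof -
    have "d x y / c = d x' y' / c"
      using that hyp I(2) cosh_eq_iff_nonneg[of "d x y / c" "d x' y' / c"] by simp
    then show ?thesis using I(2) by simp
  qed
  define G where "G = inv_into M E"
  have G: "G z \<in> M" "E (G z) = z" if "norm z < 1" for z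
    unfolding G_def using that bij_betw_imp_surj_on[OF E] by (auto intro!: inv_into_into f_inv_into_f)
  have GE: "G (E x) = x" if "x \<in> M" for x unfolding G_def using E that by (simp add: bij_betw_def)
  have ne: "M \<noteq> {}" using G(1)[of 0] by auto
  have "p \<in> centers M d" if p: "p \<in> M" for p
  proof -
    define q where "q = E p"
    have q: "norm q < 1" unfolding q_def using En p by blast
    define \<phi> where "\<phi> x = G (hyp_refl q (E x))" for x
    have \<phi>M: "\<phi> x \<in> M" and E\<phi>: "E (\<phi> x) = hyp_refl q (E x)" if "x \<in> M" for x
      unfolding \<phi>_def using G hyp_refl_ball[OF q En[OF that]] by auto
    have inv: "\<phi> (\<phi> x) = x" if "x \<in> M" for x
      unfolding \<phi>_def[of "\<phi> x"] E\<phi>[OF that] using hyp_refl_involution[OF q En[OF that]] GE that by simp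
    have iso: "d (\<phi> x) (\<phi> y) = d x y" if "x \<in> M" "y \<in> M" for x y
      by (rule d_eq) (use that \<phi>M E\<phi> hyp_refl_isometry[OF q En[OF that(1)] En[OF that(2)]] in auto)
    have im: "\<phi> ` M = M" using \<phi>M inv by (metis image_eqI image_subsetI subsetI subset_antisym)
    have fix_p: "\<phi> p = p" unfolding \<phi>_def q_def[symmetric] hyp_refl_self[OF q] unfolding q_def by (rule GE[OF p])
    \<comment> \<open>\<open>p\<close> is a metric midpoint of \<open>x\<close> and
      \<open>y\<close>; the doubling formula for \<open>cosh\<close> turns this into the hypothesis
      of \<open>hyp_midpoint_unique\<close>.\<close>
    have opposite: "y = \<phi> x"
      if "x \<in> M" "y \<in> M" "d p x = d p y" "d x y = 2 * d p x" for x y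
    proof -
      have "hyp q (E y) = hyp q (E x)" unfolding q_def hyp[OF p that(1)] hyp[OF p that(2)] that(3) ..
      moreover have "hyp (E x) (E y) = 2 * (hyp q (E x))\<^sup>2 - 1"
        unfolding q_def hyp[OF p that(1)] hyp[OF that(1,2)] that(4) using cosh_double_cosh[of "d p x / c"] by simp
      ultimately have "E y = hyp_refl q (E x)" by (rule hyp_midpoint_unique[OF q En[OF that(1)] En[OF that(2)]])
      then show ?thesis unfolding \<phi>_def using GE[OF that(2)] by simp
    qed
    have lines: "\<phi> ` L = L" if L: "geodesic_line M d L" "p \<in> L" for L
    proof -
      obtain g :: "real \<Rightarrow> 'a" where g: "bij_betw g UNIV L" "\<And>r t. d (g r) (g t) = \<bar>r - t\<bar>"
        using geodesic_isometric[OF L(1)] unfolding isometric_to_real_line_def by blast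
      have LM: "L \<subseteq> M" using L(1) unfolding geodesic_line_def by blast
      have gL: "range g = L" using g(1) unfolding bij_betw_def by blast
      then obtain t0 where t0: "p = g t0" using L(2) by blast
      have gM: "g t \<in> M" for t using gL LM by blast
      have "\<phi> (g t) = g (2 * t0 - t)" for t
        by (rule opposite[symmetric]) (use gM g(2) t0 in \<open>auto simp: abs_if\<close>)
      then have "\<phi> ` L \<subseteq> L" using gL by (metis image_subsetI rangeE rangeI)
      moreover have "L \<subseteq> \<phi> ` L"
      proof
        fix x assume x: "x \<in> L"
        then have "\<phi> x \<in> L" using calculation by blast
        moreover have "x = \<phi> (\<phi> x)" using inv x LM by auto
        ultimately show "x \<in> \<phi> ` L" by (metis imageI)
      qed
      ultimately show ?thesis by blast
    qed
    have "\<exists>x\<in>M. \<phi> x \<noteq> x"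
    proof -
      obtain v :: 'a where v: "v \<noteq> 0" by (metis nonzero_Basis nonempty_Basis ex_in_conv)
      obtain \<sigma> :: "real \<Rightarrow> real" where \<sigma>: "\<sigma> 0 = 0" "range \<sigma> = {u. p + u *\<^sub>R v \<in> M}"
        "\<And>r s. d (p + \<sigma> r *\<^sub>R v) (p + \<sigma> s *\<^sub>R v) = \<bar>r - s\<bar>" using chord_param[OF p v] by blast
      \<comment> \<open>Points at distance 1 from \<open>p\<close> on its two sides along a chord;
        the reflection exchanges them.\<close>
      define x y where "x = p + \<sigma> 1 *\<^sub>R v" and "y = p + \<sigma> (- 1) *\<^sub>R v"
      have M: "x \<in> M" "y \<in> M" unfolding x_def y_def using \<sigma>(2) by blast+
      have dd: "d p x = 1" "d p y = 1" "d x y = 2"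
        using \<sigma>(3)[of 0 1] \<sigma>(3)[of 0 "- 1"] \<sigma>(3)[of 1 "- 1"] unfolding x_def y_def \<sigma>(1) by simp_all
      then have "y = \<phi> x" using opposite M by simp
      moreover have "x \<noteq> y" using dd(3) M by auto
      ultimately show ?thesis using M by metis
    qed
    then have "metric_point_reflection M d p \<phi>"
      unfolding metric_point_reflection_def using im iso inv fix_p lines by (intro conjI) auto
    then show ?thesis unfolding centers_def using p by blast
  qed
  then show ?thesis using ne unfolding centers_def by blast
qed

section \<open>The one-dimensional case and the equivalence\<close>

lemma is_hyperbolic_geometryI:
  fixes F :: "'a::euclidean_space \<Rightarrow> 'a"
  assumes F: "bij_betw F M (ball 0 1)" and c: "c > 0"
    and hyp: "\<And>p q. p \<in> M \<Longrightarrow> q \<in> M \<Longrightarrow> hyp (F p) (F q) = cosh (c * d p q)"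
    and nonneg: "\<And>p q. p \<in> M \<Longrightarrow> q \<in> M \<Longrightarrow> d p q \<ge> 0"
  shows "is_hyperbolic_geometry M d"
proof -
  have ball: "ball 0 1 = (\<lambda>x. 0 + (\<lambda>x. x) x) ` ball (0 :: 'a) 1" by simp
  have "open_ellipsoid (ball (0 :: 'a) 1)"
    unfolding open_ellipsoid_def by (intro exI[of _ 0] exI[of _ "\<lambda>x. x"]) (auto simp: linear_id[unfolded id_def] bij_def)
  moreover have "d p q = (1 / c) * hilbert_dist (ball 0 1) (F p) (F q)" if "p \<in> M" "q \<in> M" for p q
  proof -
    have n: "norm (F p) < 1" "norm (F q) < 1" using F that by (auto dest: bij_betwE)
    have l: "linear (\<lambda>x :: 'a. x)" "inj (\<lambda>x :: 'a. x)" by (auto simp: linear_id[unfolded id_def])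
    have "hilbert_dist (ball 0 1) (F p) (F q) \<ge> 0"
        "cosh (hilbert_dist (ball 0 1) (F p) (F q)) = cosh (c * d p q)"
      using hilbert_dist_nonneg_cosh[OF l n, of 0] hyp[OF that] by simp_all
    then have "hilbert_dist (ball 0 1) (F p) (F q) = c * d p q"
      using cosh_eq_iff_nonneg c nonneg[OF that] by simp
    then show ?thesis using c by simp
  qed
  ultimately show ?thesis unfolding is_hyperbolic_geometry_def
    using F c by (intro exI[of _ "ball 0 1"] exI[of _ "1 / c"] exI[of _ F]) auto
qed

text \<open>\<open>M\<close> is a single chord and the ball an interval. As \<open>tanh\<close>
  parametrizes the interval by Hilbert arc length, both are copies of the real line.\<close>

lemma (in projective_metric) hyperbolic_of_dim_1:
  assumes dim: "DIM('a) = 1" and ne: "M \<noteq> {}"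
  shows "is_hyperbolic_geometry M d"
proof -
  obtain p where p: "p \<in> M" using ne by blast
  obtain v :: 'a where v: "v \<in> Basis" by (metis nonempty_Basis ex_in_conv)
  have vv: "v \<bullet> v = 1" "v \<noteq> 0" using v by auto
  have Basis: "Basis = {v}" using dim v by (metis card_1_singletonE singletonD)
  have span: "x = (x \<bullet> v) *\<^sub>R v" for x
    using euclidean_representation[of x] unfolding Basis by simp
  obtain \<sigma> :: "real \<Rightarrow> real" where \<sigma>: "strict_mono \<sigma>" "range \<sigma> = {u. p + u *\<^sub>R v \<in> M}"
    "\<And>r s. d (p + \<sigma> r *\<^sub>R v) (p + \<sigma> s *\<^sub>R v) = \<bar>r - s\<bar>" using chord_param[OF p vv(2)] by blast
  define \<gamma> where "\<gamma> t = p + \<sigma> t *\<^sub>R v" for t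
  have \<gamma>: "bij_betw \<gamma> UNIV M"
    unfolding bij_betw_def
  proof
    show "inj \<gamma>" unfolding \<gamma>_def using strict_mono_eq[OF \<sigma>(1)] vv by (auto intro!: injI)
    have "x \<in> range \<gamma>" if "x \<in> M" for x
    proof -
      have x: "x = p + ((x - p) \<bullet> v) *\<^sub>R v" using span[of "x - p"] by (metis add.commute diff_add_cancel)
      then have "(x - p) \<bullet> v \<in> range \<sigma>" using \<sigma>(2) that by simp
      then show ?thesis unfolding \<gamma>_def using x by auto
    qed
    moreover have "\<gamma> t \<in> M" for t using \<sigma>(2) unfolding \<gamma>_def by blast
    ultimately show "range \<gamma> = M" by blast
  qed
  define E where "E t = tanh t *\<^sub>R v" for t :: real
  have E: "bij_betw E UNIV (ball 0 1)"
    unfolding bij_betw_def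
  proof
    show "inj E" unfolding E_def using vv by (auto intro!: injI)
    have "z \<in> range E" if "norm z < 1" for z
    proof -
      have "\<bar>z \<bullet> v\<bar> < 1" using that Basis_le_norm[OF v, of z] by simp
      then have "tanh (artanh (z \<bullet> v)) = z \<bullet> v" by (rule tanh_artanh)
      then have "E (artanh (z \<bullet> v)) = z" unfolding E_def using span[of z] by simp
      then show ?thesis by (metis rangeI)
    qed
    moreover have "norm (E t) < 1" for t
      unfolding E_def using v tanh_real_bounds[of t] by auto
    ultimately show "range E = ball 0 1" by auto
  qed
  define F where "F = E \<circ> inv_into UNIV \<gamma>"
  have F: "bij_betw F M (ball 0 1)"
    unfolding F_def by (intro bij_betw_trans[OF bij_betw_inv_into[OF \<gamma>] E])
  have F\<gamma>: "F (\<gamma> t) = E t" for t unfolding F_def using bij_betw_imp_inj_on[OF \<gamma>] by simp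
  have hypE: "hyp (E r) (E t) = cosh (r - t)" for r t
  proof -
    have sech: "1 - tanh r * tanh r = 1 / (cosh r)\<^sup>2" for r :: real
    proof -
      have "1 - tanh r * tanh r = ((cosh r)\<^sup>2 - (sinh r)\<^sup>2) / (cosh r)\<^sup>2"
        unfolding tanh_def by (simp add: diff_divide_distrib power2_eq_square)
      then show ?thesis by (simp add: cosh_square_eq)
    qed
    have "hyp (E r) (E t) = (1 - tanh r * tanh t) / sqrt (1 / (cosh r)\<^sup>2 * (1 / (cosh t)\<^sup>2))"
      unfolding hyp_def E_def by (simp add: vv sech)
    also have "sqrt (1 / (cosh r)\<^sup>2 * (1 / (cosh t)\<^sup>2)) = 1 / (cosh r * cosh t)"
      by (simp add: real_sqrt_mult real_sqrt_divide)
    also have "(1 - tanh r * tanh t) / (1 / (cosh r * cosh t)) = cosh (r - t)"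
      unfolding tanh_def cosh_diff by (simp add: field_simps)
    finally show ?thesis .
  qed
  show ?thesis
  proof (rule is_hyperbolic_geometryI[OF F])
    fix x y assume "x \<in> M" "y \<in> M"
    then obtain r t where rt: "x = \<gamma> r" "y = \<gamma> t" using bij_betw_imp_surj_on[OF \<gamma>] by blast
    have "cosh (r - t) = cosh \<bar>r - t\<bar>" by (metis abs_if cosh_minus)
    then show "hyp (F x) (F y) = cosh (1 * d x y)"
      unfolding rt F\<gamma> hypE using \<sigma>(3)[of r t] unfolding \<gamma>_def by simp
  qed auto
qed

lemma hyperbolic_of_all_centers:
  fixes M :: "(real ^ 'n) set"
  assumes pm: "projective_metric M d" and dim: "CARD('n) \<ge> 2" and cen: "centers M d = M" and ne: "M \<noteq> {}"
  shows "is_hyperbolic_geometry M d"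
proof -
  interpret projective_metric M d by (rule pm)
  obtain K where K: "\<forall>p\<in>M. linear (K p) \<and> (\<forall>x\<in>M. 1 + K p (x - p) > 0) \<and>
      metric_point_reflection M d p (\<lambda>x. p - (1 / (1 + K p (x - p))) *\<^sub>R (x - p))"
    using exists_symmetric_domain cen dim by auto
  interpret symmetric_domain M d K
    using K by (intro symmetric_domain.intro projective_metric_axioms symmetric_domain_axioms.intro) blast+
  obtain b where b: "b \<in> M" using ne by blast
  obtain f where f: "f b = 1" "\<forall>x\<in>M. f x > 0" "\<forall>q\<in>M. \<forall>x\<in>M. f (s q x) = \<mu> q x * f x"
    using exists_density[OF b] by blast
  interpret based_domain M d K b f by unfold_locales (use b f in auto)
  obtain Q where Q: "bilinear Q" "\<forall>x y. Q x y = Q y x"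
    "\<forall>p\<in>M. \<forall>q\<in>M. \<beta> p q = B (p - b) * B (q - b) - Q (p - b) (q - b)" using exists_form by blast
  interpret form_domain M d K b f Q by unfold_locales (use Q in blast)+
  obtain F :: "real ^ 'n \<Rightarrow> real ^ 'n" and c where "bij_betw F M (ball 0 1)" "c > 0" "\<forall>p\<in>M. \<forall>q\<in>M. hyp (F p) (F q) = cosh (c * d p q)"
    using hyperbolic_model by blast
  then show ?thesis by (intro is_hyperbolic_geometryI[of F M c d]) auto
qed

theorem theorem3p2:
  fixes M :: "(real ^ 'n) set" and d :: "real ^ 'n \<Rightarrow> real ^ 'n \<Rightarrow> real"
  assumes "projective_metric_hyperbolic_type M d"
  shows "(\<exists>U. open U \<and> U \<noteq> {} \<and> U \<subseteq> centers M d) \<longleftrightarrow> is_hyperbolic_geometry M d"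
proof
  interpret projective_metric M d by unfold_locales (rule assms)
  assume "\<exists>U. open U \<and> U \<noteq> {} \<and> U \<subseteq> centers M d"
  then obtain U where U: "open U" "U \<noteq> {}" "U \<subseteq> centers M d" by blast
  then have ne: "M \<noteq> {}" unfolding centers_def by blast
  show "is_hyperbolic_geometry M d"
  \<comment> \<open>The analysis of reflections compares independent directions, so the line is
    treated separately.\<close>
  proof (cases "CARD('n) = 1")
    case True
    then show ?thesis using hyperbolic_of_dim_1 ne by simp
  next
    case False
    moreover have "CARD('n) > 0" by (simp add: card_gt_0_iff)
    ultimately have dim: "CARD('n) \<ge> 2" by linarith
    then have "centers M d = M" using all_centers[OF _ U] by simp
    then show ?thesis using hyperbolic_of_all_centers projective_metric_axioms dim ne by blast
  qed
next
  interpret projective_metric M d by unfold_locales (rule assms)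
  assume "is_hyperbolic_geometry M d"
  then show "\<exists>U. open U \<and> U \<noteq> {} \<and> U \<subseteq> centers M d"
    using centers_of_hyperbolic open_M by (intro exI[of _ M]) auto
qed

end
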